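(* Let $J_1,J_2$ be independent subordinators with means $\rho_i=\mathrm{E}J_i(1)$, $\rho_2>0$, $\rho=\rho_1+\rho_2<1$, and Laplace exponents $\eta_i(\alpha)=-\log \mathrm{E}e^{-\alpha J_i(1)}$, $i=1,2$. Consider the two-class accumulating priority queue with unit service rate, class $i$ input $J_i$, and accumulating priority rates $b_1>b_2>0$ (class $2$ is the lowest priority class). Put $a=1-b_2/b_1$, $J_a(t)=J_1(at)$, $$\varphi(\alpha)=\alpha-\eta_1(\alpha)-\eta_2(\alpha),\qquad \varphi_a(\alpha)=\log \mathrm{E}e^{-\alpha(J_a(1)-1)}=\alpha-a\,\eta_1(\alpha),$$ and let $\varphi_a^{-1}$ be the inverse of $\varphi_a$ on $[0,\infty)$. Then the Laplace-Stieltjes transform of the steady state waiting time $W_2$ of class $2$ particles is given, for $\alpha>0$, by $$\mathrm{E}e^{-\alpha W_2}=\frac{\varphi'(0)\,\varphi_a^{-1}(\alpha)}{\varphi\left(\varphi_a^{-1}(\alpha)\right)}\cdot\frac{\eta_2(\varphi_a^{-1}(\alpha))}{\rho_2\,\varphi_a^{-1}(\alpha)}=\frac{\varphi'(0)\,\eta_2(\varphi_a^{-1}(\alpha))}{\rho_2\,\varphi\left(\varphi_a^{-1}(\alpha)\right)}.$$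
   Context: A subordinator is a non-decreasing right-continuous Lévy process started at $0$; write $\eta_i(\alpha)=c_i\alpha+\int_{(0,\infty)}(1-e^{-\alpha x})\nu_i(dx)$ with drift $c_i\ge 0$ and Lévy measure $\nu_i$. The queue. A single server removes work at rate $1$ whenever the system is non-empty. Work of class $i$ consists of infinitesimal customers ("particles") arriving according to $J_i$, either continuously (drift part) or in batches (jumps). The total workload $W(t)$ is the reflection at $0$ of $J_1(t)+J_2(t)-t$ (started from $W(0)=0$). A class $i$ particle that arrived at time $s$ has at time $t\ge s$ the accumulated priority $b_i(t-s)$, and the server always processes next the particles of highest accumulated priority. Content in front of a class $2$ particle. A class $2$ particle arriving on its own at time $s$ has content $W(s-)=W(s)$ in front of it at arrival; a class $2$ particle at location $x\in[0,\Delta J_2(s)]$ in a batch (a jump of $J_2$ at time $s$, of size $\Delta J_2(s)$) has content $W(s-)+x$ in front of it. All of this content is served before the particle. The steady state content in front of an arriving class $2$ particle is a random variable $V$ whose distribution is the long-run average over arriving class $2$ particles: for bounded continuous $f$, $$\mathrm{E}f(V)=\lim_{t\to\infty}\frac{1}{J_2(t)}\Big(c_2\int_0^t f(W(s))\,ds+\sum_{0<s\le t}\int_0^{\Delta J_2(s)}f(W(s-)+x)\,dx\Big)\quad\text{a.s.}$$ Waiting time. Measure time from the arrival of a tagged class $2$ particle, let $v$ be the content in front of it at arrival, and let $J_1$ now denote the class $1$ input after its arrival. If the particle is known to wait at least time $w$, then the class $1$ work arriving at times $t$ with $b_1(w-t)\ge b_2w$, i.e. $t\le aw$, overtakes it.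 Accordingly set $T_0=v$ and $T_{n+1}=v+J_a(T_n)$ for $n\ge 0$; the waiting time of the tagged particle is $T=\lim_{n\to\infty}T_n$. The steady state waiting time $W_2$ is the random variable $T$ obtained when $v$ is replaced by $V$, with $V$ independent of the class $1$ input process after the arrival. *)

theory Defs
  imports "HOL-Probability.Probability"
begin

text \<open>
  Processes are functions \<open>J :: real \<Rightarrow> 'a \<Rightarrow> real\<close>; only their values at times \<open>t \<ge> 0\<close> matter.
\<close>

definition levy_process :: "'a measure \<Rightarrow> (real \<Rightarrow> 'a \<Rightarrow> real) \<Rightarrow> bool" where
  "levy_process M J \<longleftrightarrow>
     prob_space M \<and>
     (\<forall>t\<ge>0. J t \<in> borel_measurable M) \<and>
     (\<forall>\<omega>\<in>space M. J 0 \<omega> = 0) \<and>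
     (\<forall>\<omega>\<in>space M. \<forall>t\<ge>0. continuous (at_right t) (\<lambda>s. J s \<omega>)) \<and>
     (\<forall>\<omega>\<in>space M. \<forall>t>0. \<exists>l. ((\<lambda>s. J s \<omega>) \<longlongrightarrow> l) (at_left t)) \<and>
     (\<forall>s\<ge>0. \<forall>h\<ge>0. distr M borel (\<lambda>\<omega>. J (s + h) \<omega> - J s \<omega>) = distr M borel (J h)) \<and>
     (\<forall>n. \<forall>t::nat \<Rightarrow> real. 0 \<le> t 0 \<and> mono_on {..n} t \<longrightarrow>
        prob_space.indep_vars M (\<lambda>_. borel) (\<lambda>i \<omega>. J (t (Suc i)) \<omega> - J (t i) \<omega>) {..<n})"

definition subordinator :: "'a measure \<Rightarrow> (real \<Rightarrow> 'a \<Rightarrow> real) \<Rightarrow> bool" where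
  "subordinator M J \<longleftrightarrow>
     levy_process M J \<and> (\<forall>\<omega>\<in>space M. mono_on {0..} (\<lambda>t. J t \<omega>))"

definition independent_processes ::
    "'a measure \<Rightarrow> (real \<Rightarrow> 'a \<Rightarrow> real) \<Rightarrow> (real \<Rightarrow> 'a \<Rightarrow> real) \<Rightarrow> bool" where
  "independent_processes M J K \<longleftrightarrow>
     prob_space.indep_var M
       (Pi\<^sub>M {0..} (\<lambda>_. borel)) (\<lambda>\<omega>. \<lambda>t\<in>{0..}. J t \<omega>)
       (Pi\<^sub>M {0..} (\<lambda>_. borel)) (\<lambda>\<omega>. \<lambda>t\<in>{0..}. K t \<omega>)"

definition laplace_exponent :: "'a measure \<Rightarrow> (real \<Rightarrow> 'a \<Rightarrow> real) \<Rightarrow> real \<Rightarrow> real" where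
  "laplace_exponent M J \<alpha> = - ln (LINT \<omega>|M. exp (- \<alpha> * J 1 \<omega>))"

text \<open>
  By the Levy-Khintchine theorem every subordinator has exactly one such pair \<open>(c, \<nu>)\<close>, so that
  assuming this for a subordinator only gives names to its drift and its Levy measure.
\<close>

definition has_drift_levy_measure ::
    "'a measure \<Rightarrow> (real \<Rightarrow> 'a \<Rightarrow> real) \<Rightarrow> real \<Rightarrow> real measure \<Rightarrow> bool" where
  "has_drift_levy_measure M J c \<nu> \<longleftrightarrow>
     0 \<le> c \<and> sets \<nu> = sets borel \<and> emeasure \<nu> {..0} = 0 \<and>
     (\<integral>\<^sup>+x\<in>{0<..}. ennreal (min 1 x) \<partial>\<nu>) < \<infinity> \<and>
     (\<forall>\<alpha>\<ge>0. laplace_exponent M J \<alpha> = c * \<alpha> + (LINT x:{0<..}|\<nu>. 1 - exp (- \<alpha> * x)))"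

definition reflection :: "(real \<Rightarrow> real) \<Rightarrow> real \<Rightarrow> real" where
  "reflection x t = x t - min 0 (INF s\<in>{0..t}. x s)"

definition left_lim :: "(real \<Rightarrow> real) \<Rightarrow> real \<Rightarrow> real" where
  "left_lim x s = Lim (at_left s) x"

definition jump :: "(real \<Rightarrow> real) \<Rightarrow> real \<Rightarrow> real" where
  "jump x s = x s - left_lim x s"

text \<open>The arguments \<open>j1\<close> and \<open>j2\<close> below are sample paths of the two inputs.\<close>

definition workload :: "(real \<Rightarrow> real) \<Rightarrow> (real \<Rightarrow> real) \<Rightarrow> real \<Rightarrow> real" where
  "workload j1 j2 = reflection (\<lambda>t. j1 t + j2 t - t)"

text \<open>
  The average of \<open>f\<close> (content in front) over the class 2 particles arriving during \<open>[0, t]\<close>. Only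
  countably many summands of the unconditional sum are nonzero.
\<close>

definition content_average ::
    "real \<Rightarrow> (real \<Rightarrow> real) \<Rightarrow> (real \<Rightarrow> real) \<Rightarrow> (real \<Rightarrow> real) \<Rightarrow> real \<Rightarrow> real" where
  "content_average c2 j1 j2 f t =
     (1 / j2 t) *
     (c2 * (LINT s:{0..t}|lborel. f (workload j1 j2 s)) +
      (\<Sum>\<^sub>\<infinity>s\<in>{0<..t}.
         LINT x:{0..jump j2 s}|lborel. f (left_lim (workload j1 j2) s + x)))"

text \<open>
  The law \<open>\<mu>\<close> of the steady state content \<open>V\<close>, as a probability measure on \<open>[0, \<infinity>)\<close>; the
  exceptional null set may depend on \<open>f\<close>.
\<close>

definition steady_state_content_law ::
    "'a measure \<Rightarrow> (real \<Rightarrow> 'a \<Rightarrow> real) \<Rightarrow> (real \<Rightarrow> 'a \<Rightarrow> real) \<Rightarrow> real \<Rightarrow> real measure \<Rightarrow> bool" where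
  "steady_state_content_law M J1 J2 c2 \<mu> \<longleftrightarrow>
     prob_space \<mu> \<and> sets \<mu> = sets (restrict_space borel {0..}) \<and>
     (\<forall>f. continuous_on {0..} f \<and> bounded (f ` {0..}) \<longrightarrow>
        (AE \<omega> in M.
           (content_average c2 (\<lambda>t. J1 t \<omega>) (\<lambda>t. J2 t \<omega>) f \<longlongrightarrow> (LINT v|\<mu>. f v)) at_top))"

primrec waiting_iter :: "(real \<Rightarrow> real) \<Rightarrow> real \<Rightarrow> nat \<Rightarrow> real" where
  "waiting_iter ja v 0 = v"
| "waiting_iter ja v (Suc n) = v + ja (waiting_iter ja v n)"

text \<open>
  For \<open>v \<ge> 0\<close> and a nondecreasing nonnegative path \<open>ja\<close> the iterates increase; \<open>lim\<close> is unspecified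
  where they are unbounded, which under the stability condition has probability zero.
\<close>

definition waiting_time :: "(real \<Rightarrow> real) \<Rightarrow> real \<Rightarrow> real" where
  "waiting_time ja v = lim (waiting_iter ja v)"

text \<open>
  The steady state waiting time, as a random variable on the product of the law of \<open>V\<close> with the
  probability space carrying \<open>Ja\<close>: the class 1 input after the arrival is distributed as the class 1
  input from time \<open>0\<close> and is independent of \<open>V\<close>.
\<close>

definition steady_state_waiting_time :: "(real \<Rightarrow> 'a \<Rightarrow> real) \<Rightarrow> real \<times> 'a \<Rightarrow> real" where
  "steady_state_waiting_time Ja = (\<lambda>(v, \<omega>). waiting_time (\<lambda>t. Ja t \<omega>) v)"

end

theory Submission
  imports Defs
begin

text \<open>
  The content in front of an arriving particle is studied through the Laplace transforms of its
  long-run averages. Let \<open>W\<close> be the workload, \<open>L\<close> the idle time and \<open>\<phi>(b) = b - \<eta>1(b) - \<eta>2(b)\<close>. The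
  processes
  \<open>exp (-b W(t)) - 1 + b L(t) - \<phi>(b) \<integral> exp (-b W(s)) ds\<close> (integral over \<open>[0, t]\<close>) and
  \<open>b N(t) - \<eta>2(b) \<integral> exp (-b W(s)) ds\<close>, where \<open>N(t)\<close> is the numerator of the content average of
  \<open>exp (-b x)\<close>, are limits of sums of martingale differences over the increments on finer and finer
  grids, where \<open>W\<close> is replaced by a reflected random walk. Only finitely many independent increments enter
  each sum, its second moment is at most a multiple of \<open>t\<close>, and by Fatou the limits are \<open>o(t)\<close> along
  \<open>t = n\<^sup>2\<close>, hence for all \<open>t\<close> by monotonicity. As \<open>L(t) / t\<close> tends to \<open>1 - \<rho>\<close> by the strong law of large numbers,
  the averages of \<open>exp (-b x)\<close> tend to \<open>(1 - \<rho>) \<eta>2(b) / (\<rho>2 \<phi>(b))\<close> almost surely. This determines the law of \<open>V\<close>; its existence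
  follows from tightness after the substitution \<open>u = exp (-x)\<close>, which turns Laplace transforms into moments
  on the unit interval. The same second moment argument shows that the part of a path of \<open>J2\<close> that is free of
  jumps is the drift.

  The waiting time for content \<open>v\<close> is the first passage time of \<open>t - Ja(t)\<close> over \<open>v\<close>. Stopping the
  Wald martingale on a grid of mesh \<open>h\<close> and letting \<open>h\<close> tend to \<open>0\<close> shows that its Laplace transform at
  \<open>\<alpha> = \<phi>a(\<beta>)\<close> is \<open>exp (-\<beta> v)\<close>, so that integrating over \<open>v\<close> evaluates the transform of \<open>V\<close> at \<open>\<beta>\<close>.
\<close>

section \<open>The strong law of large numbers\<close>

text \<open>The content average is a path functional, while independence within an input is given
  only for finitely many increments. Grids bridge this gap: on a grid everything is a finite sum of
  functions of independent pairs of increments, and refining the grid is a statement about one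
  increasing path at a time. The differences are centred exactly at every mesh, by
  \<open>exp (\<phi> b * h)\<close> and \<open>exp (- h * \<eta>2)\<close>, so that no bias
  accumulates before the limit. The weights read the walk at the left end of a cell; this makes them
  functions of the past and is why left limits of the workload appear in the limits. The times n^2
  are sparse enough for a second moment of order t: it leaves n^2 / n^4, which is summable. The
  content average treats drift and batches separately, whereas \<open>has_drift_levy_measure\<close>
  constrains only the Laplace exponent; hence the drift has to be identified path by path. Only
  Laplace arguments k and 1/k enter the construction of the law, so that one event of probability
  one serves all test functions.\<close>

primrec running_max :: "nat \<Rightarrow> (nat \<Rightarrow> real) \<Rightarrow> real" where
  "running_max 0 u = 0"
| "running_max (Suc n) u = max 0 (u 0 + running_max n (\<lambda>i. u (Suc i)))"

lemma running_max_nonneg: "0 \<le> running_max n u"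
  by (cases n) auto

lemma running_max_abs_le: "\<bar>running_max n u\<bar> \<le> (\<Sum>i<n. \<bar>u i\<bar>)"
proof (induction n arbitrary: u)
  case (Suc n)
  have "(\<Sum>i<Suc n. \<bar>u i\<bar>) = \<bar>u 0\<bar> + (\<Sum>i<n. \<bar>u (Suc i)\<bar>)"
    by (rule sum.lessThan_Suc_shift)
  then show ?case
    using Suc.IH[of "\<lambda>i. u (Suc i)"] running_max_nonneg[of n "\<lambda>i. u (Suc i)"] by auto
qed simp

lemma partial_sum_le_running_max: "k \<le> n \<Longrightarrow> (\<Sum>i<k. u i) \<le> running_max n u"
proof (induction n arbitrary: u k)
  case (Suc n)
  show ?case
  proof (cases k)
    case (Suc k')
    then have "(\<Sum>i<k. u i) = u 0 + (\<Sum>i<k'. u (Suc i))"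
      by (simp only: sum.lessThan_Suc_shift)
    also have "\<dots> \<le> u 0 + running_max n (\<lambda>i. u (Suc i))"
      using Suc.prems Suc by (intro add_left_mono Suc.IH) auto
    finally show ?thesis by simp
  qed simp
qed simp

lemma running_max_mono_Suc: "running_max n u \<le> running_max (Suc n) u"
proof (induction n arbitrary: u)
  case (Suc n)
  show ?case using Suc.IH[of "\<lambda>i. u (Suc i)"] by auto
qed (simp add: running_max_nonneg)

lemma bdd_above_partial_sums_Suc:
  "bdd_above (range (\<lambda>n. \<Sum>i<n. u (Suc i))) \<longleftrightarrow> bdd_above (range (\<lambda>n. \<Sum>i<n. u i :: real))"
proof -
  have S: "(\<Sum>i<Suc n. u i) = u 0 + (\<Sum>i<n. u (Suc i))" for n
    by (rule sum.lessThan_Suc_shift)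
  show ?thesis
  proof
    assume "bdd_above (range (\<lambda>n. \<Sum>i<n. u (Suc i)))"
    then obtain B where B: "(\<Sum>i<n. u (Suc i)) \<le> B" for n by (auto simp: bdd_above_def)
    \<comment> \<open>The maximum with 0 covers the empty sum, which has no first step to split
      off.\<close>
    have "(\<Sum>i<n. u i) \<le> max 0 (u 0 + B)" for n
    proof (cases n)
      case (Suc k)
      then show ?thesis using S[of k] B[of k] by simp
    qed simp
    then show "bdd_above (range (\<lambda>n. \<Sum>i<n. u i))" by (auto intro!: bdd_aboveI2)
  next
    assume "bdd_above (range (\<lambda>n. \<Sum>i<n. u i))"
    then obtain B where B: "(\<Sum>i<n. u i) \<le> B" for n by (auto simp: bdd_above_def)
    have "(\<Sum>i<n. u (Suc i)) \<le> B - u 0" for n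
      using S[of n] B[of "Suc n"] by simp
    then show "bdd_above (range (\<lambda>n. \<Sum>i<n. u (Suc i)))" by (auto intro!: bdd_aboveI2)
  qed
qed

lemma running_max_at_top:
  assumes "\<not> bdd_above (range (\<lambda>n. \<Sum>i<n. u i))"
  shows "filterlim (\<lambda>n. running_max n u) at_top sequentially"
  unfolding filterlim_at_top
proof
  fix Z :: real
  from assms obtain k where "Z < (\<Sum>i<k. u i)" by (auto simp: bdd_above_def not_le)
  then show "\<forall>\<^sub>F n in sequentially. Z \<le> running_max n u"
    using partial_sum_le_running_max[of k _ u]
    by (auto simp: eventually_sequentially intro!: exI[of _ k] intro: order.trans less_imp_le)
qed

lemma measurable_running_max [measurable]:
  "running_max n \<in> borel_measurable (Pi\<^sub>M UNIV (\<lambda>_. borel))"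
proof (induction n)
  case (Suc n)
  have [measurable]: "(\<lambda>u i. u (Suc i)) \<in> Pi\<^sub>M UNIV (\<lambda>_. borel) \<rightarrow>\<^sub>M Pi\<^sub>M UNIV (\<lambda>_. borel :: real measure)"
    by (rule measurable_PiM_single') auto
  have *: "(\<lambda>u. running_max n (\<lambda>i. u (Suc i))) \<in> borel_measurable (Pi\<^sub>M UNIV (\<lambda>_. borel))"
    by (rule measurable_compose[OF _ Suc]) fact
  show ?case
    unfolding running_max.simps
    by (intro borel_measurable_max borel_measurable_const borel_measurable_add measurable_component_singleton UNIV_I *)
qed simp

lemma distr_pair_snd:
  assumes "prob_space M" "sigma_finite_measure N"
  shows "distr (M \<Otimes>\<^sub>M N) N snd = N"
proof (rule measure_eqI)
  interpret M: prob_space M by fact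
  interpret N: sigma_finite_measure N by fact
  fix A assume "A \<in> sets (distr (M \<Otimes>\<^sub>M N) N snd)"
  then have A: "A \<in> sets N" by simp
  have "snd -` A \<inter> space (M \<Otimes>\<^sub>M N) = space M \<times> A"
    using sets.sets_into_space[OF A] by (auto simp: space_pair_measure)
  with A show "emeasure (distr (M \<Otimes>\<^sub>M N) N snd) A = emeasure N A"
    by (simp add: emeasure_distr N.emeasure_pair_measure_Times M.emeasure_space_1)
qed simp

text \<open>
  Garsia's argument: the event that the partial sums are unbounded is invariant under the shift, and
  on it \<open>running_max (Suc n) - running_max n \<circ> shift\<close> tends to the first step, which is
  independent of that event.
\<close>

lemma AE_partial_sums_bdd_above:
  fixes N :: "real measure"
  assumes "prob_space N" and sets: "sets N = sets borel"
    and int: "integrable N (\<lambda>x. x)" and neg: "(LINT x|N. x) < 0"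
  shows "AE u in Pi\<^sub>M (UNIV :: nat set) (\<lambda>_. N). bdd_above (range (\<lambda>n. \<Sum>i<n. u i :: real))"
proof -
  interpret sequence_space N
    by (intro sequence_space.intro product_prob_spaceI assms(1))
  note [measurable_cong] = sets
  have setsS[measurable_cong]: "sets S = sets (Pi\<^sub>M UNIV (\<lambda>_. borel))"
    by (rule sets_PiM_cong) (auto simp: sets)
  have spM: "space N = UNIV" using sets by (simp add: sets_eq_imp_space_eq)
  have spS: "space S = UNIV" by (simp add: space_PiM spM)
  define b where "b = (\<lambda>u::nat\<Rightarrow>real. bdd_above (range (\<lambda>n. \<Sum>i<n. u i)))"
  have [measurable]: "Measurable.pred (Pi\<^sub>M UNIV (\<lambda>_. borel)) b"
  proof -
    \<comment> \<open>Restricting the bound to natural numbers writes the event as a countable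
      union, which gives measurability.\<close>
    have "b = (\<lambda>u. \<exists>B::nat. \<forall>n. (\<Sum>i<n. u i) \<le> real B)"
      unfolding b_def bdd_above_def
      by (auto intro!: ext) (meson order.trans real_arch_simple)
    moreover have "Measurable.pred (Pi\<^sub>M UNIV (\<lambda>_. borel)) (\<lambda>u::nat\<Rightarrow>real. \<exists>B::nat. \<forall>n. (\<Sum>i<n. u i) \<le> real B)"
      by measurable
    ultimately show ?thesis by simp
  qed
  have pm: "prob_space N" by (rule M.prob_space_axioms)
  interpret pp: pair_prob_space N S ..
  define c where "c = (\<lambda>(s::real, u). case_nat s u)"
  have [measurable]: "c \<in> N \<Otimes>\<^sub>M S \<rightarrow>\<^sub>M S"
    unfolding c_def by measurable
  \<comment> \<open>Prepending an independent step leaves the law of the sequence unchanged; this is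
    the stationarity that lets expectations be compared before and after a shift.\<close>
  have iter: "distr (N \<Otimes>\<^sub>M S) S c = S" unfolding c_def by (rule PiM_iter)
  have b_c: "b (c (x, u)) = b u" for x u
    using bdd_above_partial_sums_Suc[of "case_nat x u"] by (simp add: b_def c_def)
  have rm_c: "running_max (Suc n) (c (x, u)) = max 0 (x + running_max n u)" for n x u
    by (simp add: c_def)
  have dc: "distr S N (\<lambda>u. u i) = N" for i by (rule PiM_component) simp
  have icoord: "integrable S (\<lambda>u. \<bar>u i\<bar>)" for i
  proof -
    have "integrable (distr S N (\<lambda>u. u i)) (\<lambda>x. \<bar>x\<bar>)" unfolding dc using int by (rule integrable_abs)
    then show ?thesis by (subst (asm) integrable_distr_eq) (auto)
  qed
  have irm: "integrable S (running_max n)" for n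
  proof (rule Bochner_Integration.integrable_bound)
    show "integrable S (\<lambda>u. \<Sum>i<n. \<bar>u i\<bar>)" by (intro Bochner_Integration.integrable_sum icoord)
    have "norm (running_max n u) \<le> norm (\<Sum>i<n. \<bar>u i\<bar>)" for u
      using running_max_abs_le[of n u] by simp
    then show "AE u in S. norm (running_max n u) \<le> norm (\<Sum>i<n. \<bar>u i\<bar>)" by simp
  qed simp
  define d where "d u = (if b u then 0 else 1::real)" for u
  have [measurable]: "d \<in> borel_measurable (Pi\<^sub>M UNIV (\<lambda>_. borel))" unfolding d_def by measurable
  have d1: "\<bar>d u\<bar> \<le> 1" "0 \<le> d u" for u by (auto simp: d_def)
  have id: "integrable S (\<lambda>u. d u * f u)" if "integrable S f" for f
    by (rule Bochner_Integration.integrable_bound[OF that])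
       (use that in \<open>auto simp: d_def\<close>)
  have dsnd: "distr (N \<Otimes>\<^sub>M S) S snd = S"
    by (rule distr_pair_snd) (rule assms(1), unfold_locales)
  have dfst: "distr (N \<Otimes>\<^sub>M S) N fst = N"
    by (rule P.distr_pair_fst)
  have isnd: "integrable (N \<Otimes>\<^sub>M S) (\<lambda>z. f (snd z))"
      and lsnd: "(LINT z|(N \<Otimes>\<^sub>M S). f (snd z)) = (LINT u|S. f u)" if "integrable S f" for f :: "_ \<Rightarrow> real"
    using that integrable_distr[of snd "N \<Otimes>\<^sub>M S" S f, unfolded dsnd]
      integral_distr[of snd "N \<Otimes>\<^sub>M S" S f, unfolded dsnd] by auto
  have ifst: "integrable (N \<Otimes>\<^sub>M S) fst"
    using int integrable_distr[of fst "N \<Otimes>\<^sub>M S" N "\<lambda>x. x", unfolded dfst] by simp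
  have lc: "(LINT z|(N \<Otimes>\<^sub>M S). f (c z)) = (LINT u|S. f u)" if "f \<in> borel_measurable S" for f :: "_ \<Rightarrow> real"
    using that integral_distr[of c "N \<Otimes>\<^sub>M S" S f, unfolded iter] by simp
  have ic: "integrable (N \<Otimes>\<^sub>M S) (\<lambda>z. f (c z))" if "integrable S f" for f :: "_ \<Rightarrow> real"
    using that integrable_distr[of c "N \<Otimes>\<^sub>M S" S f, unfolded iter] by simp
  have d_c: "d (c z) = d (snd z)" for z using b_c[of "fst z" "snd z"] by (simp add: d_def)
  define g where "g n z = d (snd z) * max (- running_max n (snd z)) (fst z)" for n and z :: "real \<times> (nat \<Rightarrow> real)"
  have [measurable]: "g n \<in> borel_measurable (N \<Otimes>\<^sub>M S)" for n
    unfolding g_def by measurable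
  have pos: "0 \<le> (LINT z|(N \<Otimes>\<^sub>M S). g n z)" for n
  proof -
    have "0 \<le> (LINT u|S. d u * running_max (Suc n) u) - (LINT u|S. d u * running_max n u)"
      using running_max_mono_Suc[of n] d1
      by (subst Bochner_Integration.integral_diff[symmetric])
         (auto intro!: id irm integral_nonneg_AE AE_I2 mult_left_mono simp del: running_max.simps)
    also have "\<dots> = (LINT z|(N \<Otimes>\<^sub>M S). d (c z) * running_max (Suc n) (c z)) - (LINT z|(N \<Otimes>\<^sub>M S). d (snd z) * running_max n (snd z))"
      by (subst lc[symmetric], measurable) (subst lsnd, auto intro: id irm)
    also have "\<dots> = (LINT z|(N \<Otimes>\<^sub>M S). g n z)"
    proof (subst Bochner_Integration.integral_diff[symmetric])
      show "integrable (N \<Otimes>\<^sub>M S) (\<lambda>z. d (c z) * running_max (Suc n) (c z))"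
        by (rule ic[OF id[OF irm]])
      show "integrable (N \<Otimes>\<^sub>M S) (\<lambda>z. d (snd z) * running_max n (snd z))"
        by (rule isnd[OF id[OF irm]])
      have "d (c z) * running_max (Suc n) (c z) - d (snd z) * running_max n (snd z) = g n z" for z
        using rm_c[of n "fst z" "snd z"] by (auto simp: g_def d_c max_def algebra_simps)
      then show "(LINT z|(N \<Otimes>\<^sub>M S). d (c z) * running_max (Suc n) (c z) - d (snd z) * running_max n (snd z)) = (LINT z|(N \<Otimes>\<^sub>M S). g n z)"
        by simp
    qed
    finally show ?thesis .
  qed
  have "(\<lambda>n. LINT z|(N \<Otimes>\<^sub>M S). g n z) \<longlonglongrightarrow> (LINT z|(N \<Otimes>\<^sub>M S). d (snd z) * fst z)"
  proof (rule integral_dominated_convergence)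
    show "integrable (N \<Otimes>\<^sub>M S) (\<lambda>z. \<bar>fst z\<bar>)" using ifst by (rule integrable_abs)
    show "AE z in (N \<Otimes>\<^sub>M S). norm (g n z) \<le> \<bar>fst z\<bar>" for n
    proof (rule AE_I2)
      fix z
      show "norm (g n z) \<le> \<bar>fst z\<bar>"
        using running_max_nonneg[of n "snd z"] by (auto simp: g_def d_def)
    qed
    show "AE z in (N \<Otimes>\<^sub>M S). (\<lambda>n. g n z) \<longlonglongrightarrow> d (snd z) * fst z"
    proof (rule AE_I2)
      fix z
      show "(\<lambda>n. g n z) \<longlonglongrightarrow> d (snd z) * fst z"
      proof (cases "b (snd z)")
        case False
        then have "filterlim (\<lambda>n. running_max n (snd z)) at_top sequentially"
          by (intro running_max_at_top) (simp add: b_def)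
        then have "\<forall>\<^sub>F n in sequentially. - fst z \<le> running_max n (snd z)"
          by (simp add: filterlim_at_top)
        then have "\<forall>\<^sub>F n in sequentially. g n z = d (snd z) * fst z"
          by eventually_elim (auto simp: g_def max_def)
        then show ?thesis by (rule tendsto_eventually)
      qed (simp add: g_def d_def)
    qed
  qed measurable
  then have "0 \<le> (LINT z|(N \<Otimes>\<^sub>M S). d (snd z) * fst z)"
    by (rule LIMSEQ_le_const) (use pos in auto)
  also have "\<dots> = (LINT u|S. LINT x|N. d u * x)"
  proof (subst pp.integral_snd)
    show "integrable (N \<Otimes>\<^sub>M S) (\<lambda>(x, u). d u * x)"
      by (rule Bochner_Integration.integrable_bound[OF ifst]) (use d1 in \<open>auto simp: d_def split: if_splits\<close>)
  qed (simp add: split_beta')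
  also have "\<dots> = (LINT u|S. d u) * (LINT x|N. x)"
    by simp
  finally have "(LINT u|S. d u) \<le> 0"
    using neg by (simp add: zero_le_mult_iff)
  moreover have "integrable S d"
    by (rule P.integrable_const_bound[of _ 1]) (auto simp: d_def)
  ultimately have "AE u in S. d u = 0"
    using d1 by (subst integral_nonneg_eq_0_iff_AE[symmetric]) (auto intro!: antisym integral_nonneg_AE)
  then show ?thesis
    by eventually_elim (auto simp: d_def b_def split: if_splits)
qed

lemma bdd_above_rangeE:
  fixes f :: "'i \<Rightarrow> 'b::preorder"
  assumes "bdd_above (range f)" obtains B where "\<And>n. f n \<le> B"
  using assms by (auto simp: bdd_above_def)

lemma (in prob_space) AE_iid_partial_sums_bdd_above:
  fixes X :: "nat \<Rightarrow> 'a \<Rightarrow> real"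
  assumes indep: "indep_vars (\<lambda>_. borel) X UNIV"
    and id: "\<And>n. distr M borel (X n) = distr M borel (X 0)"
    and int: "integrable M (X 0)" and neg: "expectation (X 0) < 0"
  shows "AE \<omega> in M. bdd_above (range (\<lambda>n. \<Sum>i<n. X i \<omega>))"
proof -
  have [measurable]: "random_variable borel (X i)" for i
    using indep by (auto simp: indep_vars_def)
  define N where "N = distr M borel (X 0)"
  have N: "prob_space N" unfolding N_def by (rule prob_space_distr) simp
  have "AE u in Pi\<^sub>M (UNIV :: nat set) (\<lambda>_. N). bdd_above (range (\<lambda>n. \<Sum>i<n. u i))"
    using int neg
    by (intro AE_partial_sums_bdd_above N) (simp_all add: N_def integrable_distr_eq integral_distr)
  also have "Pi\<^sub>M UNIV (\<lambda>_. N) = Pi\<^sub>M UNIV (\<lambda>i. distr M borel (X i))"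
    unfolding N_def by (intro PiM_cong refl) (metis id)
  also have "\<dots> = distr M (Pi\<^sub>M UNIV (\<lambda>_. borel)) (\<lambda>\<omega>. \<lambda>i\<in>UNIV. X i \<omega>)"
    using indep by (subst (asm) indep_vars_iff_distr_eq_PiM) auto
  finally have "AE u in distr M (Pi\<^sub>M UNIV (\<lambda>_. borel)) (\<lambda>\<omega>. \<lambda>i\<in>UNIV. X i \<omega>). bdd_above (range (\<lambda>n. \<Sum>i<n. u i))" .
  from AE_distrD[OF _ this] show ?thesis
    by (simp add: measurable_restrict)
qed

text \<open>With m the mean, the steps X - (m + 1/k) and (m - 1/k) - X both have mean -1/k, so their
  partial sums are bounded above. Hence the sum of n steps differs from n m by at most a random
  constant plus n/k, for all k at once.\<close>

theorem (in prob_space) strong_law_of_large_numbers: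
  fixes X :: "nat \<Rightarrow> 'a \<Rightarrow> real"
  assumes indep: "indep_vars (\<lambda>_. borel) X UNIV"
    and id: "\<And>n. distr M borel (X n) = distr M borel (X 0)"
    and int: "integrable M (X 0)"
  shows "AE \<omega> in M. (\<lambda>n. (\<Sum>i<n. X i \<omega>) / n) \<longlonglongrightarrow> expectation (X 0)"
proof -
  let ?m = "expectation (X 0)"
  have [measurable]: "random_variable borel (X i)" for i
    using indep by (auto simp: indep_vars_def)
  have bdd: "AE \<omega> in M. bdd_above (range (\<lambda>n. \<Sum>i<n. g (X i \<omega>)))"
    if [measurable]: "g \<in> borel_measurable borel" and "integrable M (\<lambda>\<omega>. g (X 0 \<omega>))" "expectation (\<lambda>\<omega>. g (X 0 \<omega>)) < 0"
    for g :: "real \<Rightarrow> real"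
  proof (rule AE_iid_partial_sums_bdd_above)
    show "indep_vars (\<lambda>_. borel) (\<lambda>i \<omega>. g (X i \<omega>)) UNIV"
      by (rule indep_vars_compose2[OF indep]) simp
    fix n
    have "distr M borel (\<lambda>\<omega>. g (X n \<omega>)) = distr (distr M borel (X n)) borel g" for n
      by (subst distr_distr) (auto simp: o_def)
    then show "distr M borel (\<lambda>\<omega>. g (X n \<omega>)) = distr M borel (\<lambda>\<omega>. g (X 0 \<omega>))"
      by (simp add: id[of n])
  qed fact+
  have A: "AE \<omega> in M. bdd_above (range (\<lambda>n. \<Sum>i<n. X i \<omega> - (?m + 1 / real (Suc k))))" for k
    using bdd[of "\<lambda>x. x - (?m + 1 / real (Suc k))"] int by (simp add: prob_space)
  have B: "AE \<omega> in M. bdd_above (range (\<lambda>n. \<Sum>i<n. (?m - 1 / real (Suc k)) - X i \<omega>))" for k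
    using bdd[of "\<lambda>x. (?m - 1 / real (Suc k)) - x"] int by (simp add: prob_space)
  have "AE \<omega> in M. \<forall>k. bdd_above (range (\<lambda>n. \<Sum>i<n. X i \<omega> - (?m + 1 / real (Suc k)))) \<and>
      bdd_above (range (\<lambda>n. \<Sum>i<n. (?m - 1 / real (Suc k)) - X i \<omega>))"
    unfolding AE_all_countable AE_conj_iff by (intro allI conjI A B)
  then show ?thesis
  proof eventually_elim
    case (elim \<omega>)
    define s where "s n = (\<Sum>i<n. X i \<omega>)" for n
    have "\<exists>B. \<forall>n. \<bar>s n - n * ?m\<bar> \<le> B + n / real (Suc k)" for k
    proof -
      obtain A where A: "\<And>n. (\<Sum>i<n. X i \<omega> - (?m + 1 / real (Suc k))) \<le> A"
        using conjunct1[OF spec[OF elim, of k]] by (rule bdd_above_rangeE) blast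
      obtain B where B: "\<And>n. (\<Sum>i<n. (?m - 1 / real (Suc k)) - X i \<omega>) \<le> B"
        using conjunct2[OF spec[OF elim, of k]] by (rule bdd_above_rangeE) blast
      have "\<bar>s n - n * ?m\<bar> \<le> max A B + n / real (Suc k)" for n
      proof -
        have "(\<Sum>i<n. X i \<omega> - c) = s n - n * c" "(\<Sum>i<n. c - X i \<omega>) = n * c - s n" for c :: real
          by (simp_all add: s_def sum_subtractf)
        with A[of n] B[of n] show ?thesis
          by (simp add: ring_distribs del: of_nat_Suc)
      qed
      then show ?thesis by blast
    qed
    then obtain B where B: "\<And>k n. \<bar>s n - n * ?m\<bar> \<le> B k + n / real (Suc k)" by metis
    show ?case
      unfolding s_def[symmetric]
    proof (rule LIMSEQ_I)
      fix r :: real assume "0 < r"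
      then obtain k where k: "1 / real (Suc k) < r / 2"
        by (metis half_gt_zero nat_approx_posE)
      obtain n0 where n0: "B k < real n0 * (r / 2)"
        using \<open>0 < r\<close> reals_Archimedean3[of "r/2"] by auto
      show "\<exists>no. \<forall>n\<ge>no. norm (s n / real n - ?m) < r"
      proof (intro exI allI impI)
        fix n assume n: "Suc n0 \<le> n"
        then have "B k < real n * (r / 2)"
          using n0 \<open>0 < r\<close> by (smt (verit, best) Suc_leD half_gt_zero mult_right_mono of_nat_mono)
        moreover have "real n / real (Suc k) < real n * (r / 2)"
          using mult_strict_left_mono[OF k, of "real n"] n by simp
        ultimately have "\<bar>s n - n * ?m\<bar> < n * r"
          using B[of n k] mult.commute[of "real n" r] by linarith
        moreover have "s n / real n - ?m = (s n - n * ?m) / n"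
          using n by (simp add: field_simps)
        ultimately show "norm (s n / real n - ?m) < r"
          using n by (simp add: abs_divide field_simps)
      qed
    qed
  qed
qed

section \<open>Second moments of martingale sums and almost sure limits along squares\<close>

lemma (in prob_space) expectation_past_mult_next:
  fixes X :: "nat \<Rightarrow> 'a \<Rightarrow> 'b" and F :: "(nat \<Rightarrow> 'b) \<Rightarrow> real" and H :: "'b \<Rightarrow> real"
  assumes indep: "indep_vars (\<lambda>_. S) X {..<n}" and i: "i < n"
    and F: "F \<in> borel_measurable (Pi\<^sub>M {..<i} (\<lambda>_. S))" "\<And>u. \<bar>F u\<bar> \<le> B"
    and H: "H \<in> borel_measurable S" "\<And>x. \<bar>H x\<bar> \<le> C"
  shows "expectation (\<lambda>\<omega>. F (\<lambda>l\<in>{..<i}. X l \<omega>) * H (X i \<omega>)) =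
    expectation (\<lambda>\<omega>. F (\<lambda>l\<in>{..<i}. X l \<omega>)) * expectation (\<lambda>\<omega>. H (X i \<omega>))"
proof -
  have "indep_var borel (F \<circ> (\<lambda>\<omega>. restrict (\<lambda>l. X l \<omega>) {..<i})) borel
      ((\<lambda>u. H (u i)) \<circ> (\<lambda>\<omega>. restrict (\<lambda>l. X l \<omega>) {i}))"
    using i H(1) by (intro indep_var_compose[OF indep_var_restrict[OF indep]] F) auto
  then have iv: "indep_var borel (\<lambda>\<omega>. F (\<lambda>l\<in>{..<i}. X l \<omega>)) borel (\<lambda>\<omega>. H (X i \<omega>))"
    by (simp add: o_def)
  have "integrable M (\<lambda>\<omega>. F (\<lambda>l\<in>{..<i}. X l \<omega>))"
    using F(2) iv by (intro integrable_const_bound[of _ B]) (auto dest: indep_var_rv1)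
  moreover have "integrable M (\<lambda>\<omega>. H (X i \<omega>))"
    using H(2) iv by (intro integrable_const_bound[of _ C]) (auto dest: indep_var_rv2)
  ultimately show ?thesis
    by (rule indep_var_lebesgue_integral[OF iv])
qed

text \<open>Martingale differences are orthogonal: the product of the past sum with the next
  difference is a function of the past times a centred independent factor, so second moments add
  up.\<close>

lemma (in prob_space) second_moment_martingale_sum:
  fixes X :: "nat \<Rightarrow> 'a \<Rightarrow> 'b" and F :: "nat \<Rightarrow> (nat \<Rightarrow> 'b) \<Rightarrow> real" and H :: "'b \<Rightarrow> real"
  assumes indep: "indep_vars (\<lambda>_. S) X {..<n}"
    and F: "\<And>i. i < n \<Longrightarrow> F i \<in> borel_measurable (Pi\<^sub>M {..<i} (\<lambda>_. S))" "\<And>i u. \<bar>F i u\<bar> \<le> 1"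
    and H: "H \<in> borel_measurable S" "\<And>x. \<bar>H x\<bar> \<le> C"
    and H0: "\<And>i. i < n \<Longrightarrow> expectation (\<lambda>\<omega>. H (X i \<omega>)) = 0"
    and H2: "\<And>i. i < n \<Longrightarrow> expectation (\<lambda>\<omega>. (H (X i \<omega>))\<^sup>2) \<le> v"
  shows "integrable M (\<lambda>\<omega>. (\<Sum>i<n. F i (\<lambda>l\<in>{..<i}. X l \<omega>) * H (X i \<omega>))\<^sup>2)"
    and "expectation (\<lambda>\<omega>. (\<Sum>i<n. F i (\<lambda>l\<in>{..<i}. X l \<omega>) * H (X i \<omega>))\<^sup>2) \<le> n * v"
proof -
  note [measurable] = H(1)
  have X[measurable]: "random_variable S (X i)" if "i < n" for i
    using indep that by (auto simp: indep_vars_def)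
  define D where "D i \<omega> = F i (\<lambda>l\<in>{..<i}. X l \<omega>) * H (X i \<omega>)" for i \<omega>
  have Fm[measurable]: "(\<lambda>\<omega>. F i (\<lambda>l\<in>{..<i}. X l \<omega>)) \<in> borel_measurable M" if "i < n" for i
    using that by (intro measurable_compose[OF _ F(1)] measurable_restrict X) auto
  have Hm[measurable]: "(\<lambda>\<omega>. H (X i \<omega>)) \<in> borel_measurable M" if "i < n" for i
    using that by (intro measurable_compose[OF X H(1)])
  have Dm[measurable]: "D i \<in> borel_measurable M" if "i < n" for i
    using that unfolding D_def by (intro borel_measurable_times Fm Hm)
  have C: "0 \<le> C" using H(2)[of undefined] by linarith
  have F1: "\<bar>F i u * y\<bar> \<le> \<bar>y\<bar>" for i u y
    using F(2)[of i u] by (simp add: abs_mult mult_left_le_one_le)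
  have DC: "\<bar>D i \<omega>\<bar> \<le> C" for i \<omega>
    using F1 H(2) unfolding D_def by (rule order.trans)
  have SC: "\<bar>\<Sum>i<k. D i \<omega>\<bar> \<le> k * C" for k \<omega>
    using order.trans[OF sum_abs sum_bounded_above[of "{..<k}" "\<lambda>i. \<bar>D i \<omega>\<bar>" C]] DC by auto
  have Sm[measurable]: "(\<lambda>\<omega>. \<Sum>i<k. D i \<omega>) \<in> borel_measurable M" if "k \<le> n" for k
    using that by (intro borel_measurable_sum Dm) auto
  have int: "integrable M (\<lambda>\<omega>. (\<Sum>i<k. D i \<omega>)\<^sup>2)" if "k \<le> n" for k
    using that SC[of _ k] by (intro integrable_const_bound[of _ "(k * C)\<^sup>2"])
      (auto intro!: AE_I2 power2_le_iff_abs_le[THEN iffD2] borel_measurable_power Sm simp: C)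
  have "expectation (\<lambda>\<omega>. (\<Sum>i<k. D i \<omega>)\<^sup>2) \<le> k * v" if "k \<le> n" for k
    using that
  proof (induction k)
    case (Suc k)
    then have k: "k < n" by simp
    define G where "G u = (\<Sum>i<k. F i (restrict u {..<i}) * H (u i)) * F k u" for u
    have GX: "G (\<lambda>l\<in>{..<k}. X l \<omega>) = (\<Sum>i<k. D i \<omega>) * F k (\<lambda>l\<in>{..<k}. X l \<omega>)" for \<omega>
      unfolding G_def D_def by (intro arg_cong2[where f="(*)"] sum.cong refl) (simp_all add: Int_absorb1 restrict_restrict)
    have "expectation (\<lambda>\<omega>. (\<Sum>i<k. D i \<omega>) * D k \<omega>) =
        expectation (\<lambda>\<omega>. (\<Sum>i<k. D i \<omega>) * F k (\<lambda>l\<in>{..<k}. X l \<omega>)) * expectation (\<lambda>\<omega>. H (X k \<omega>))"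
    proof -
      \<comment> \<open>Clipping at \<open>k * C\<close> changes no value attained on the
        probability space and makes the required bound for arbitrary arguments immediate.\<close>
      let ?G = "\<lambda>u. max (- (k * C)) (min (k * C) (G u))"
      have g: "?G (\<lambda>l\<in>{..<k}. X l \<omega>) = (\<Sum>i<k. D i \<omega>) * F k (\<lambda>l\<in>{..<k}. X l \<omega>)" for \<omega>
        using F1[of k "\<lambda>l\<in>{..<k}. X l \<omega>" "\<Sum>i<k. D i \<omega>"] SC[of \<omega> k] by (auto simp: GX mult.commute)
      have "expectation (\<lambda>\<omega>. ?G (\<lambda>l\<in>{..<k}. X l \<omega>) * H (X k \<omega>)) =
          expectation (\<lambda>\<omega>. ?G (\<lambda>l\<in>{..<k}. X l \<omega>)) * expectation (\<lambda>\<omega>. H (X k \<omega>))"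
      proof (rule expectation_past_mult_next[OF indep k _ _ H])
        have "(\<lambda>u. F i (restrict u {..<i}) * H (u i)) \<in> borel_measurable (Pi\<^sub>M {..<k} (\<lambda>_. S))" if "i < k" for i
          using that k by (intro borel_measurable_times measurable_compose[OF _ F(1)] measurable_restrict_subset
              measurable_compose[OF _ H(1)] measurable_component_singleton) auto
        then have "G \<in> borel_measurable (Pi\<^sub>M {..<k} (\<lambda>_. S))"
          unfolding G_def using k by (intro borel_measurable_times[OF borel_measurable_sum] F(1)) auto
        then show "?G \<in> borel_measurable (Pi\<^sub>M {..<k} (\<lambda>_. S))" by simp
        have "0 \<le> k * C" using C by simp
        then show "\<bar>?G u\<bar> \<le> k * C" for u by linarith
      qed
      then show ?thesis unfolding g by (simp add: D_def mult.assoc)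
    qed
    with H0[OF k] have 0: "expectation (\<lambda>\<omega>. (\<Sum>i<k. D i \<omega>) * D k \<omega>) = 0" by simp
    have bd: "\<bar>(\<Sum>i<k. D i \<omega>) * D k \<omega>\<bar> \<le> (k * C) * C" for \<omega>
      unfolding abs_mult using C by (intro mult_mono SC DC) auto
    have i2: "integrable M (\<lambda>\<omega>. (\<Sum>i<k. D i \<omega>) * D k \<omega>)"
      using bd k by (intro integrable_const_bound[of _ "(k * C) * C"] borel_measurable_times Sm Dm) auto
    have sq: "integrable M (\<lambda>\<omega>. f \<omega> ^ 2)" if "\<And>\<omega>. \<bar>f \<omega>\<bar> \<le> C" "f \<in> borel_measurable M" for f :: "'a \<Rightarrow> real"
      using that by (intro integrable_const_bound[of _ "C\<^sup>2"])
        (auto intro!: AE_I2 power2_le_iff_abs_le[THEN iffD2] simp: C)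
    have i3: "integrable M (\<lambda>\<omega>. (D k \<omega>)\<^sup>2)" using DC k by (intro sq Dm)
    have "expectation (\<lambda>\<omega>. (D k \<omega>)\<^sup>2) \<le> expectation (\<lambda>\<omega>. (H (X k \<omega>))\<^sup>2)"
      using F1[of k] unfolding D_def
      by (intro integral_mono i3[unfolded D_def] sq[OF H(2)] Hm k) (auto simp: abs_le_square_iff)
    with H2[OF k] have 3: "expectation (\<lambda>\<omega>. (D k \<omega>)\<^sup>2) \<le> v" by linarith
    have "expectation (\<lambda>\<omega>. (\<Sum>i<Suc k. D i \<omega>)\<^sup>2) =
        expectation (\<lambda>\<omega>. (\<Sum>i<k. D i \<omega>)\<^sup>2 + 2 * ((\<Sum>i<k. D i \<omega>) * D k \<omega>) + (D k \<omega>)\<^sup>2)"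
      by (intro Bochner_Integration.integral_cong refl) (simp add: power2_sum algebra_simps)
    also have "\<dots> = expectation (\<lambda>\<omega>. (\<Sum>i<k. D i \<omega>)\<^sup>2) + 2 * expectation (\<lambda>\<omega>. (\<Sum>i<k. D i \<omega>) * D k \<omega>) + expectation (\<lambda>\<omega>. (D k \<omega>)\<^sup>2)"
      using int[of k] i2 i3 k by simp
    also have "\<dots> \<le> k * v + 0 + v"
      using Suc 0 3 by simp
    finally show ?case by (simp add: algebra_simps)
  qed (simp add: prob_space)
  from this[of n] int[of n]
  show "integrable M (\<lambda>\<omega>. (\<Sum>i<n. F i (\<lambda>l\<in>{..<i}. X l \<omega>) * H (X i \<omega>))\<^sup>2)"
    and "expectation (\<lambda>\<omega>. (\<Sum>i<n. F i (\<lambda>l\<in>{..<i}. X l \<omega>) * H (X i \<omega>))\<^sup>2) \<le> n * v"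
    by (simp_all add: D_def)
qed

text \<open>Fatou's lemma. Measurability of the limit \<open>g\<close> is not among the assumptions,
  so the bound is stated for a measurable version \<open>q\<close> of its square.\<close>

lemma nn_integral_square_limit_le:
  fixes f :: "nat \<Rightarrow> 'a \<Rightarrow> real"
  assumes [measurable]: "\<And>m. f m \<in> borel_measurable M"
    and bound: "\<And>m. (\<integral>\<^sup>+\<omega>. ennreal ((f m \<omega>)\<^sup>2) \<partial>M) \<le> C"
    and lim: "AE \<omega> in M. (\<lambda>m. f m \<omega>) \<longlonglongrightarrow> g \<omega>"
  obtains q :: "'a \<Rightarrow> ennreal" where "q \<in> borel_measurable M" "(\<integral>\<^sup>+\<omega>. q \<omega> \<partial>M) \<le> C"
    "AE \<omega> in M. q \<omega> = ennreal ((g \<omega>)\<^sup>2)"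
proof
  let ?q = "\<lambda>\<omega>. liminf (\<lambda>m. ennreal ((f m \<omega>)\<^sup>2))"
  show "?q \<in> borel_measurable M" by measurable
  have "(\<integral>\<^sup>+\<omega>. ?q \<omega> \<partial>M) \<le> liminf (\<lambda>m. \<integral>\<^sup>+\<omega>. ennreal ((f m \<omega>)\<^sup>2) \<partial>M)"
    by (rule nn_integral_liminf) simp
  also have "\<dots> \<le> C" by (intro Liminf_le bound always_eventually allI) simp
  finally show "(\<integral>\<^sup>+\<omega>. ?q \<omega> \<partial>M) \<le> C" .
  from lim show "AE \<omega> in M. ?q \<omega> = ennreal ((g \<omega>)\<^sup>2)"
    by eventually_elim (auto intro!: lim_imp_Liminf tendsto_ennrealI tendsto_power)
qed

text \<open>By the linear bound, the squares of g(n^2) / n^2 have a sum of expectation at most C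
  times the sum of 1 / n^2. The sum is therefore finite almost surely and its terms tend to
  0.\<close>

lemma AE_square_times_limit_zero:
  fixes f :: "nat \<Rightarrow> nat \<Rightarrow> 'a \<Rightarrow> real" and g :: "nat \<Rightarrow> 'a \<Rightarrow> real"
  assumes meas: "\<And>m N. f m N \<in> borel_measurable M"
    and bound: "\<And>m N. (\<integral>\<^sup>+\<omega>. ennreal ((f m N \<omega>)\<^sup>2) \<partial>M) \<le> ennreal (C * real N)"
    and C: "0 \<le> C"
    and lim: "AE \<omega> in M. \<forall>N. (\<lambda>m. f m N \<omega>) \<longlonglongrightarrow> g N \<omega>"
  shows "AE \<omega> in M. (\<lambda>n. g (n\<^sup>2) \<omega> / (real n)\<^sup>2) \<longlonglongrightarrow> 0"
proof -
  have "\<exists>q. q \<in> borel_measurable M \<and> (\<integral>\<^sup>+\<omega>. q \<omega> \<partial>M) \<le> ennreal (C * real N) \<and>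
      (AE \<omega> in M. q \<omega> = ennreal ((g N \<omega>)\<^sup>2))" for N
  proof -
    from lim have "AE \<omega> in M. (\<lambda>m. f m N \<omega>) \<longlonglongrightarrow> g N \<omega>" by eventually_elim auto
    then show ?thesis
      by (rule nn_integral_square_limit_le[where f = "\<lambda>m. f m N" and g = "g N", OF meas bound]) blast
  qed
  then obtain q where q[measurable]: "\<And>N. q N \<in> borel_measurable M"
    and qb: "\<And>N. (\<integral>\<^sup>+\<omega>. q N \<omega> \<partial>M) \<le> ennreal (C * real N)"
    and qg: "\<And>N. AE \<omega> in M. q N \<omega> = ennreal ((g N \<omega>)\<^sup>2)"
    by metis
  \<comment> \<open>The square of the normalisation 1 / n^2, with the index shifted to avoid
    division by 0.\<close>
  let ?w = "\<lambda>n. 1 / real (Suc n) ^ 4"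
  let ?R = "\<lambda>\<omega>. \<Sum>n. ennreal (?w n) * q ((Suc n)\<^sup>2) \<omega>"
  have "(\<integral>\<^sup>+\<omega>. ?R \<omega> \<partial>M) = (\<Sum>n. \<integral>\<^sup>+\<omega>. ennreal (?w n) * q ((Suc n)\<^sup>2) \<omega> \<partial>M)"
    by (rule nn_integral_suminf) simp
  also have "\<dots> = (\<Sum>n. ennreal (?w n) * (\<integral>\<^sup>+\<omega>. q ((Suc n)\<^sup>2) \<omega> \<partial>M))"
    by (simp add: nn_integral_cmult)
  also have "\<dots> \<le> (\<Sum>n. ennreal (C * (1 / real (Suc n) ^ 2)))"
  proof (rule suminf_le)
    fix n
    have "ennreal (?w n) * (\<integral>\<^sup>+\<omega>. q ((Suc n)\<^sup>2) \<omega> \<partial>M) \<le> ennreal (?w n) * ennreal (C * real ((Suc n)\<^sup>2))"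
      by (intro mult_left_mono qb) simp
    also have "\<dots> = ennreal (?w n * (C * real ((Suc n)\<^sup>2)))"
      using C by (subst ennreal_mult) auto
    also have "?w n * (C * real ((Suc n)\<^sup>2)) = C * (1 / real (Suc n) ^ 2)"
      unfolding of_nat_power by (simp add: divide_simps power2_eq_square power4_eq_xxxx del: of_nat_Suc)
    finally show "ennreal (?w n) * (\<integral>\<^sup>+\<omega>. q ((Suc n)\<^sup>2) \<omega> \<partial>M) \<le> ennreal (C * (1 / real (Suc n) ^ 2))" .
  qed auto
  also have "\<dots> < \<infinity>"
  proof -
    have "summable (\<lambda>n. C * (1 / real (Suc n) ^ 2))"
      using inverse_power_summable[of 2, where 'a=real] summable_Suc_iff[of "\<lambda>n. 1 / real n ^ 2"]
      by (intro summable_mult) (simp add: inverse_eq_divide del: of_nat_Suc)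
    then show ?thesis
      using C by (subst suminf_ennreal2) auto
  qed
  finally have "AE \<omega> in M. ?R \<omega> \<noteq> \<infinity>"
    by (intro nn_integral_PInf_AE) auto
  moreover have "AE \<omega> in M. \<forall>N. q N \<omega> = ennreal ((g N \<omega>)\<^sup>2)"
    using qg by (simp add: AE_all_countable)
  ultimately show ?thesis
  proof eventually_elim
    case (elim \<omega>)
    have "ennreal (?w n) * q ((Suc n)\<^sup>2) \<omega> = ennreal ((g ((Suc n)\<^sup>2) \<omega> / (real (Suc n))\<^sup>2)\<^sup>2)" for n
      using elim(2) by (simp add: ennreal_mult[symmetric] power_divide del: of_nat_Suc)
    with elim(1) have "(\<Sum>n. ennreal ((g ((Suc n)\<^sup>2) \<omega> / (real (Suc n))\<^sup>2)\<^sup>2)) \<noteq> top" by simp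
    then have "summable (\<lambda>n. (g ((Suc n)\<^sup>2) \<omega> / (real (Suc n))\<^sup>2)\<^sup>2)"
      by (intro summable_suminf_not_top) auto
    then have "(\<lambda>n. (g ((Suc n)\<^sup>2) \<omega> / (real (Suc n))\<^sup>2)\<^sup>2) \<longlonglongrightarrow> 0"
      by (rule summable_LIMSEQ_zero)
    from tendsto_real_sqrt[OF this, unfolded real_sqrt_abs real_sqrt_zero]
    have "(\<lambda>n. g ((Suc n)\<^sup>2) \<omega> / (real (Suc n))\<^sup>2) \<longlonglongrightarrow> 0"
      by (rule tendsto_rabs_zero_cancel)
    then show ?case
      by (rule LIMSEQ_imp_Suc)
  qed
qed

section \<open>Increasing paths and reflection\<close>

text \<open>For a batch of size x this is a times the average of exp(-a y) over a uniform location y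
  in the batch. The value at 0 is the continuous extension, so that one integrand serves both drift
  (no jump) and batches.\<close>

definition exp_slope :: "real \<Rightarrow> real \<Rightarrow> real" where
  "exp_slope a x = (if x = 0 then a else (1 - exp (- a * x)) / x)"

lemma mult_exp_slope: "x * exp_slope a x = 1 - exp (- a * x)"
  by (simp add: exp_slope_def)

lemma exp_slope_nonneg: "0 \<le> a \<Longrightarrow> 0 \<le> x \<Longrightarrow> 0 \<le> exp_slope a x"
  by (simp add: exp_slope_def)

lemma exp_slope_le: "0 \<le> a \<Longrightarrow> 0 \<le> x \<Longrightarrow> exp_slope a x \<le> a"
  using exp_ge_add_one_self[of "- a * x"] by (auto simp: exp_slope_def divide_simps)

lemma isCont_exp_slope: "isCont (exp_slope a) x"
proof (cases "x = 0")
  case True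
  have "((\<lambda>x. 1 - exp (- a * x)) has_real_derivative a) (at 0)"
    by (auto intro!: derivative_eq_intros)
  then have "((\<lambda>x. (1 - exp (- a * x)) / x) \<longlongrightarrow> a) (at 0)"
    by (simp add: has_field_derivative_iff)
  then have "(exp_slope a \<longlongrightarrow> a) (at 0)"
    by (rule Lim_transform_eventually) (auto simp: exp_slope_def eventually_at_filter)
  with True show ?thesis by (simp add: isCont_def exp_slope_def)
next
  case False
  have "isCont (\<lambda>x. (1 - exp (- a * x)) / x) x" using False by (intro continuous_intros) auto
  moreover have "\<forall>\<^sub>F y in nhds x. exp_slope a y = (1 - exp (- a * y)) / y"
    using t1_space_nhds[OF False] by eventually_elim (simp add: exp_slope_def)
  ultimately show ?thesis
    by (subst isCont_cong) auto
qed

lemma measurable_exp_slope [measurable]: "exp_slope a \<in> borel_measurable borel"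
  using isCont_exp_slope by (intro borel_measurable_continuous_onI continuous_at_imp_continuous_on) auto

text \<open>Used with x a jump size: dividing by k and letting k grow filters out the jump-free part
  of a path.\<close>

lemma exp_slope_div_tendsto:
  assumes "0 \<le> x"
  shows "(\<lambda>k. exp_slope (real k) x / real k) \<longlonglongrightarrow> (if x = 0 then 1 else 0)"
proof (cases "x = 0")
  case True
  have "\<forall>\<^sub>F k in sequentially. exp_slope (real k) x / real k = 1"
    using eventually_gt_at_top[of 0] by eventually_elim (simp add: True exp_slope_def)
  with True show ?thesis by (simp add: tendsto_eventually)
next
  case False
  have "(\<lambda>k. exp_slope (real k) x / real k) \<longlonglongrightarrow> 0"
  proof (rule tendsto_sandwich[of "\<lambda>_. 0" _ _ "\<lambda>k. inverse x * (1 / real k)"])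
    show "\<forall>\<^sub>F k in sequentially. exp_slope (real k) x / real k \<le> inverse x * (1 / real k)"
    proof (intro always_eventually allI)
      fix k :: nat
      have "exp_slope (real k) x \<le> inverse x"
        using False assms by (simp add: exp_slope_def divide_simps)
      from divide_right_mono[OF this, of "real k"]
      show "exp_slope (real k) x / real k \<le> inverse x * (1 / real k)" by simp
    qed
    show "(\<lambda>k. inverse x * (1 / real k)) \<longlonglongrightarrow> 0"
      using tendsto_mult_right_zero[OF lim_1_over_n, of "inverse x"] by simp
  qed (use assms in \<open>auto intro!: divide_nonneg_nonneg exp_slope_nonneg always_eventually\<close>)
  with False show ?thesis by simp
qed

lemma exp_slope_eq_integral:
  assumes "0 \<le> a"
  shows "exp_slope a x = a * (LINT u:{0..1}|lborel. exp (- a * (u * x)))"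
proof (cases "a * x = 0")
  case True
  then show ?thesis by (auto simp: exp_slope_def set_lebesgue_integral_def)
next
  case False
  have "((\<lambda>u. - exp (- a * (u * x)) / (a * x)) has_real_derivative exp (- a * (u * x))) (at u)" for u
    using False by (auto intro!: derivative_eq_intros)
  then have "(\<integral>u. exp (- a * (u * x)) * indicator {0..1} u \<partial>lborel) =
      - exp (- a * (1 * x)) / (a * x) - - exp (- a * (0 * x)) / (a * x)"
    by (intro integral_FTC_Icc_real continuous_intros) auto
  also have "\<dots> = (1 - exp (- a * x)) / (a * x)" by (simp add: diff_divide_distrib)
  finally show ?thesis
    using False by (simp add: exp_slope_def set_lebesgue_integral_def mult.commute[of "indicator _ _"])
qed

text \<open>Cells are open on the left and closed on the right, hence the ceiling minus one. A jump
  at a grid point then belongs to the cell that it closes, and the left end of the cell stays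
  strictly below s.\<close>

definition grid_index :: "real \<Rightarrow> nat \<Rightarrow> real \<Rightarrow> nat" where
  "grid_index t m s = nat (\<lceil>s * real m / t\<rceil> - 1)"

lemma grid_index_iff:
  assumes "0 < m" "0 < s" "0 < t"
  shows "real i * (t / m) < s \<and> s \<le> real (Suc i) * (t / m) \<longleftrightarrow> i = grid_index t m s"
proof -
  have "0 < s * m / t" using assms by simp
  then have c: "0 < \<lceil>s * m / t\<rceil>" by simp
  have "i = grid_index t m s \<longleftrightarrow> int i = \<lceil>s * m / t\<rceil> - 1"
    unfolding grid_index_def using c by linarith
  also have "\<dots> \<longleftrightarrow> \<lceil>s * m / t\<rceil> = int i + 1" by linarith
  also have "\<dots> \<longleftrightarrow> real i < s * m / t \<and> s * m / t \<le> real i + 1"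
    by (simp add: ceiling_eq_iff)
  also have "\<dots> \<longleftrightarrow> real i * (t / m) < s \<and> s \<le> real (Suc i) * (t / m)"
    using assms by (simp add: field_simps)
  finally show ?thesis by simp
qed

lemma grid_index_less:
  assumes "0 < m" "0 < s" "s \<le> t"
  shows "grid_index t m s < m"
proof -
  have "real (grid_index t m s) * (t / m) < s"
    using grid_index_iff[of m s t] assms by auto
  also have "s \<le> real m * (t / m)" using assms by simp
  finally show ?thesis
    using assms by (simp add: divide_strict_right_mono field_simps)
qed

lemma grid_index_at_left:
  assumes "0 < s" "0 < t"
  shows "filterlim (\<lambda>m. real (grid_index t m s) * (t / m)) (at_left s) sequentially"
proof -
  have *: "\<forall>\<^sub>F m in sequentially. real (grid_index t m s) * (t / m) < s \<and> s - t / m \<le> real (grid_index t m s) * (t / m)"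
    using eventually_gt_at_top[of 0]
    by eventually_elim (use grid_index_iff[OF _ assms] in \<open>force simp: algebra_simps add_divide_distrib\<close>)
  have z: "(\<lambda>m. s - t / real m) \<longlonglongrightarrow> s"
    using tendsto_diff[OF tendsto_const tendsto_mult_right_zero[OF lim_1_over_n, of t], of s] by simp
  have "(\<lambda>m. real (grid_index t m s) * (t / m)) \<longlonglongrightarrow> s"
    by (rule tendsto_sandwich[OF _ _ z tendsto_const]) (use * in \<open>auto elim: eventually_mono\<close>)
  then show "filterlim (\<lambda>m. real (grid_index t m s) * (t / m)) (at_left s) sequentially"
    using * by (auto simp: filterlim_at elim: eventually_mono)
qed

lemma grid_index_Suc_tendsto:
  assumes "0 < s" "0 < t"
  shows "(\<lambda>m. real (Suc (grid_index t m s)) * (t / m)) \<longlonglongrightarrow> s"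
    and "\<forall>\<^sub>F m in sequentially. s \<le> real (Suc (grid_index t m s)) * (t / m)"
proof -
  have "(\<lambda>m. real (grid_index t m s) * (t / m) + t / real m) \<longlonglongrightarrow> s + 0"
    using grid_index_at_left[OF assms] tendsto_mult_right_zero[OF lim_1_over_n, of t]
    by (intro tendsto_add) (auto simp: filterlim_at)
  then show "(\<lambda>m. real (Suc (grid_index t m s)) * (t / m)) \<longlonglongrightarrow> s"
    by (simp add: algebra_simps add_divide_distrib)
  show "\<forall>\<^sub>F m in sequentially. s \<le> real (Suc (grid_index t m s)) * (t / m)"
    using eventually_gt_at_top[of 0]
    by eventually_elim (use grid_index_iff[OF _ assms] in blast)
qed

section \<open>Increasing right-continuous functions and their Stieltjes measures\<close>

locale stieltjes =
  fixes F :: "real \<Rightarrow> real"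
  assumes mono: "x \<le> y \<Longrightarrow> F x \<le> F y"
    and right_cont: "continuous (at_right x) F"
begin

lemma tendsto_left_lim: "(F \<longlongrightarrow> left_lim F s) (at_left s)"
proof -
  have "\<exists>l. (F \<longlongrightarrow> l) (at_left s)"
  proof
    let ?l = "Sup (F ` {..<s})"
    have bdd: "bdd_above (F ` {..<s})" by (auto intro!: bdd_aboveI[of _ "F s"] mono)
    have ne: "F ` {..<s} \<noteq> {}" using lt_ex by auto
    show "(F \<longlongrightarrow> ?l) (at_left s)"
    proof (rule order_tendstoI)
      fix a assume "a < ?l"
      then obtain r where r: "r < s" "a < F r" using less_cSup_iff[OF ne bdd] by auto
      show "\<forall>\<^sub>F x in at_left s. a < F x"
        unfolding eventually_at_left[OF r(1)] using r mono less_le_trans by (meson less_imp_le)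
    next
      fix a assume "?l < a"
      then have "F x < a" if "x < s" for x
        using cSup_upper[OF _ bdd, of "F x"] that by auto
      then show "\<forall>\<^sub>F x in at_left s. F x < a"
        by (auto simp: eventually_at_filter)
    qed
  qed
  then obtain l where l: "(F \<longlongrightarrow> l) (at_left s)" ..
  then have "left_lim F s = l" unfolding left_lim_def by (rule tendsto_Lim[rotated]) simp
  with l show ?thesis by simp
qed

lemma left_lim_le: "left_lim F s \<le> F s"
  by (rule tendsto_upperbound[OF tendsto_left_lim]) (auto simp: eventually_at_filter intro!: mono always_eventually)

lemma le_left_lim: "r < s \<Longrightarrow> F r \<le> left_lim F s"
  by (rule tendsto_lowerbound[OF tendsto_left_lim])
     (auto simp: eventually_at_left[of r] intro!: mono exI[of _ r])

lemma mono_left_lim: "mono (left_lim F)"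
  by (rule monoI) (metis left_lim_le le_left_lim le_less order_refl order_trans)

lemma jump_nonneg: "0 \<le> jump F s"
  using left_lim_le by (simp add: jump_def)

lemma measurable_F [measurable]: "F \<in> borel_measurable borel"
  by (rule borel_measurable_mono) (auto intro: monoI mono)

lemma measurable_left_lim [measurable]: "left_lim F \<in> borel_measurable borel"
  by (rule borel_measurable_mono[OF mono_left_lim])

lemma measurable_jump [measurable]: "jump F \<in> borel_measurable borel"
  unfolding jump_def[abs_def] by simp

lemma isCont_iff_jump: "isCont F s \<longleftrightarrow> jump F s = 0"
proof -
  have "isCont F s \<longleftrightarrow> (F \<longlongrightarrow> F s) (at_left s)"
    using right_cont[of s] by (auto simp: isCont_def continuous_within filterlim_at_split)
  also have "\<dots> \<longleftrightarrow> left_lim F s = F s"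
    using tendsto_left_lim tendsto_unique[OF trivial_limit_at_left_real] by metis
  finally show ?thesis by (auto simp: jump_def)
qed

lemma countable_jumps: "countable {s. jump F s \<noteq> 0}"
  using mono_ctble_discont[of F] mono by (simp add: isCont_iff_jump[symmetric] mono_def)

abbreviation "\<mu> \<equiv> interval_measure F"

lemma emeasure_Ioc: "a \<le> b \<Longrightarrow> emeasure \<mu> {a<..b} = ennreal (F b - F a)"
  by (rule emeasure_interval_measure_Ioc) (auto intro: mono right_cont)

lemma measure_Ioc: "a \<le> b \<Longrightarrow> measure \<mu> {a<..b} = F b - F a"
  by (rule measure_interval_measure_Ioc) (auto intro: mono right_cont)

lemma integrable_Ioc: "integrable \<mu> (indicat_real {a<..b})"
  by (cases "a \<le> b") (auto simp: integrable_indicator_iff emeasure_Ioc)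

lemma integrable_bounded_Ioc:
  assumes [measurable]: "f \<in> borel_measurable borel" and "\<And>s. a < s \<Longrightarrow> s \<le> b \<Longrightarrow> \<bar>f s\<bar> \<le> B"
  shows "integrable \<mu> (\<lambda>s. indicat_real {a<..b} s * f s)"
proof (rule Bochner_Integration.integrable_bound)
  show "integrable \<mu> (\<lambda>s. B * indicat_real {a<..b} s)"
    by (intro integrable_mult_right integrable_Ioc)
  show "AE s in \<mu>. norm (indicat_real {a<..b} s * f s) \<le> norm (B * indicat_real {a<..b} s)"
    using assms(2) by (intro AE_I2) (auto simp: indicator_def intro: order.trans[OF _ abs_ge_self])
qed simp

text \<open>Continuity from above along half-open intervals shrinking to s. It is the link between
  atoms of the measure and jumps of the path.\<close>

lemma emeasure_singleton: "emeasure \<mu> {s} = ennreal (jump F s)"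
proof -
  let ?A = "\<lambda>n::nat. {s - 1 / real (Suc n)<..s}"
  have "(\<lambda>n. emeasure \<mu> (?A n)) \<longlonglongrightarrow> emeasure \<mu> (\<Inter>n. ?A n)"
  proof (rule Lim_emeasure_decseq)
    show "decseq ?A"
      by (auto simp: decseq_def frac_le intro: le_less_trans[OF diff_left_mono] elim!: le_less_trans[rotated])
  qed (auto simp: emeasure_Ioc)
  also have "(\<Inter>n. ?A n) = {s}"
  proof -
    have "x = s" if x: "\<And>n. s - 1 / real (Suc n) < x" "x \<le> s" for x
    proof (rule ccontr)
      assume "x \<noteq> s"
      then have "0 < s - x" using x(2) by simp
      then obtain n where "1 / real (Suc n) < s - x" using nat_approx_posE by blast
      with x(1)[of n] show False by simp
    qed
    then show ?thesis by auto
  qed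
  also have "(\<lambda>n. emeasure \<mu> (?A n)) = (\<lambda>n. ennreal (F s - F (s - 1 / real (Suc n))))"
    by (simp add: emeasure_Ioc)
  finally have 1: "(\<lambda>n. ennreal (F s - F (s - 1 / real (Suc n)))) \<longlonglongrightarrow> emeasure \<mu> {s}" .
  have "filterlim (\<lambda>n. s - 1 / real (Suc n)) (at_left s) sequentially"
    using tendsto_diff[OF tendsto_const LIMSEQ_Suc[OF lim_1_over_n], of s]
    by (auto simp: filterlim_at)
  then have "(\<lambda>n. ennreal (F s - F (s - 1 / real (Suc n)))) \<longlonglongrightarrow> ennreal (F s - left_lim F s)"
    by (intro tendsto_ennrealI tendsto_diff tendsto_const filterlim_compose[OF tendsto_left_lim])
  from LIMSEQ_unique[OF 1 this] show ?thesis by (simp add: jump_def)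
qed

text \<open>
  The sum is the integral of a step function that equals \<open>ym m i * exp_slope a d\<close> on the
  \<open>i\<close>-th grid cell, where \<open>d\<close> is the increment of \<open>F\<close> over that cell; as the cells shrink to
  \<open>s\<close>, these increments converge to the jump at \<open>s\<close>.
\<close>

lemma grid_sum_tendsto:
  assumes t: "0 < t" and a: "0 \<le> a"
    and ym: "\<And>m i. \<bar>ym m i\<bar> \<le> 1"
    and lim: "\<And>s. 0 < s \<Longrightarrow> s \<le> t \<Longrightarrow> (\<lambda>m. ym m (grid_index t m s)) \<longlonglongrightarrow> y s"
    and [measurable]: "y \<in> borel_measurable borel"
  shows "(\<lambda>m. \<Sum>i<m. ym m i * (1 - exp (- a * (F (real (Suc i) * (t / m)) - F (real i * (t / m))))))
    \<longlonglongrightarrow> (LINT s:{0<..t}|\<mu>. y s * exp_slope a (jump F s))"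
proof -
  let ?D = "\<lambda>m i. F (real (Suc i) * (t / real m)) - F (real i * (t / real m))"
  let ?I = "\<lambda>m i. {real i * (t / real m)<..real (Suc i) * (t / real m)}"
  define g where "g m s = (\<Sum>i<m. (ym m i * exp_slope a (?D m i)) * indicat_real (?I m i) s)" for m s
  have le: "real i * (t / real m) \<le> real (Suc i) * (t / real m)" for i m
    using t by (intro mult_right_mono) auto
  have D: "0 \<le> ?D m i" for m i using mono[OF le] by simp
  have gval: "g m s = (if s \<in> {0<..t} then ym m (grid_index t m s) * exp_slope a (?D m (grid_index t m s)) else 0)"
    if "0 < m" for m s
  proof (cases "s \<in> {0<..t}")
    case True
    let ?k = "grid_index t m s"
    have k: "?k < m" using True that by (intro grid_index_less) auto
    have "s \<in> ?I m i \<longleftrightarrow> i = ?k" for i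
      using grid_index_iff[of m s t i] True that t by auto
    then have "g m s = (\<Sum>i<m. if i = ?k then ym m i * exp_slope a (?D m i) else 0)"
      unfolding g_def by (intro sum.cong) (auto simp: indicator_def)
    then show ?thesis using k True by simp
  next
    case False
    have "s \<notin> ?I m i" if "i < m" for i
    proof
      assume s: "s \<in> ?I m i"
      have "0 \<le> real i * (t / m)" using t by simp
      moreover have "real (Suc i) * (t / m) \<le> real m * (t / m)"
        using that t by (intro mult_right_mono) auto
      then have "real (Suc i) * (t / m) \<le> t" using \<open>0 < m\<close> by simp
      ultimately show False using s False by (auto simp del: of_nat_Suc)
    qed
    then show ?thesis using False unfolding g_def by (auto intro!: sum.neutral simp: indicator_def)
  qed
  have int: "(LINT s|\<mu>. g m s) = (\<Sum>i<m. ym m i * (1 - exp (- a * ?D m i)))" for m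
  proof -
    have "(LINT s|\<mu>. g m s) = (\<Sum>i<m. (ym m i * exp_slope a (?D m i)) * measure \<mu> (?I m i))"
      unfolding g_def
      by (subst Bochner_Integration.integral_sum) (auto intro!: integrable_mult_right integrable_Ioc simp del: of_nat_Suc)
    also have "\<dots> = (\<Sum>i<m. ym m i * (?D m i * exp_slope a (?D m i)))"
      using measure_Ioc[OF le] by (simp add: mult_ac del: of_nat_Suc)
    finally show ?thesis by (simp only: mult_exp_slope)
  qed
  have "(\<lambda>m. LINT s|\<mu>. g m s) \<longlonglongrightarrow> (LINT s|\<mu>. indicator {0<..t} s *\<^sub>R (y s * exp_slope a (jump F s)))"
  proof (rule integral_dominated_convergence)
    show "integrable \<mu> (\<lambda>s. a * indicat_real {0<..t} s)"
      by (intro integrable_mult_right integrable_Ioc)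
    show "g m \<in> borel_measurable \<mu>" for m unfolding g_def by measurable
    show "AE s in \<mu>. norm (g m s) \<le> a * indicat_real {0<..t} s" for m
    proof (rule AE_I2)
      fix s
      show "norm (g m s) \<le> a * indicat_real {0<..t} s"
      proof (cases "m = 0")
        case True
        then show ?thesis using a by (simp add: g_def)
      next
        case False
        have "\<bar>ym m i * exp_slope a (?D m i)\<bar> \<le> 1 * a" for i
          unfolding abs_mult using exp_slope_nonneg[OF a D] exp_slope_le[OF a D]
          by (intro mult_mono ym) (auto simp only: abs_of_nonneg abs_ge_zero zero_le_one)
        then show ?thesis using gval[of m s] False by (auto simp: indicator_def)
      qed
    qed
    show "AE s in \<mu>. (\<lambda>m. g m s) \<longlonglongrightarrow> indicator {0<..t} s *\<^sub>R (y s * exp_slope a (jump F s))"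
    proof (rule AE_I2)
      fix s
      show "(\<lambda>m. g m s) \<longlonglongrightarrow> indicator {0<..t} s *\<^sub>R (y s * exp_slope a (jump F s))"
      proof (cases "s \<in> {0<..t}")
        case True
        then have s: "0 < s" "s \<le> t" by auto
        have "(\<lambda>m. F (real (Suc (grid_index t m s)) * (t / m))) \<longlonglongrightarrow> F s"
        proof -
          \<comment> \<open>The right end of the cell may coincide with s, so right continuity is
            used on the closed half-line.\<close>
          have "(F \<longlongrightarrow> F s) (at s within {s..})"
            using right_cont[of s] by (simp add: continuous_within at_within_Ici_at_right)
          then show ?thesis
            using grid_index_Suc_tendsto[OF s(1) t]
            by (rule_tac continuous_within_tendsto_compose[of s "{s..}" F]) (auto simp: continuous_within elim: eventually_mono simp del: of_nat_Suc)
        qed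
        moreover have "(\<lambda>m. F (real (grid_index t m s) * (t / m))) \<longlonglongrightarrow> left_lim F s"
          by (rule filterlim_compose[OF tendsto_left_lim grid_index_at_left[OF s(1) t]])
        ultimately have "(\<lambda>m. ?D m (grid_index t m s)) \<longlonglongrightarrow> jump F s"
          unfolding jump_def by (intro tendsto_diff)
        then have "(\<lambda>m. ym m (grid_index t m s) * exp_slope a (?D m (grid_index t m s))) \<longlonglongrightarrow> y s * exp_slope a (jump F s)"
          by (intro tendsto_mult lim s isCont_tendsto_compose[OF isCont_exp_slope])
        moreover have "\<forall>\<^sub>F m in sequentially. ym m (grid_index t m s) * exp_slope a (?D m (grid_index t m s)) = g m s"
          using eventually_gt_at_top[of 0] by eventually_elim (use gval True in simp)
        ultimately have "(\<lambda>m. g m s) \<longlonglongrightarrow> y s * exp_slope a (jump F s)"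
          by (rule Lim_transform_eventually)
        with True show ?thesis by simp
      next
        case False
        have "\<forall>\<^sub>F m in sequentially. g m s = 0"
          using eventually_gt_at_top[of 0] by eventually_elim (simp only: gval False if_False)
        with False show ?thesis by (simp add: tendsto_eventually)
      qed
    qed
  qed (measurable)
  then show ?thesis by (simp add: int set_lebesgue_integral_def)
qed

end

text \<open>Makes \<open>grid_sum_tendsto\<close> available for integrals over time, by taking the
  identity as the increasing function.\<close>

lemma lborel_eq_interval_measure: "lborel = interval_measure (\<lambda>x::real. x)"
proof (rule lborel_eqI)
  interpret stieltjes "\<lambda>x::real. x" by standard auto
  fix l u :: real assume lu: "\<And>b. b \<in> Basis \<Longrightarrow> l \<bullet> b \<le> u \<bullet> b"
  have "l \<le> u" using lu[of 1] by simp
  have "emeasure \<mu> {u} = 0"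
    using isCont_iff_jump[of u] by (simp add: emeasure_singleton)
  have "emeasure \<mu> {l<..<u} = emeasure \<mu> {l<..u}"
  proof (cases "l = u")
    case False
    with \<open>l \<le> u\<close> have "{l<..u} = insert u {l<..<u}" by auto
    then have "emeasure \<mu> {l<..u} = emeasure \<mu> {u} + emeasure \<mu> {l<..<u}"
      by (simp only:) (rule emeasure_insert, auto)
    then show ?thesis using \<open>emeasure \<mu> {u} = 0\<close> by (simp only: add_0)
  qed simp
  then show "emeasure \<mu> (box l u) = (\<Prod>b\<in>Basis. (u - l) \<bullet> b)"
    using \<open>l \<le> u\<close> by (simp add: box_real emeasure_Ioc)
qed simp

section \<open>Idle time, the reflected walk on a grid, and its limit\<close>

definition idle_time :: "(real \<Rightarrow> real) \<Rightarrow> real \<Rightarrow> real" where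
  "idle_time F t = - min 0 (INF s\<in>{0..t}. F s - s)"

text \<open>The discrete counterpart of \<open>idle_time\<close>. The start value 0 also stands for
  the term at index 0 of a walk that starts at 0.\<close>

primrec running_deficit :: "(nat \<Rightarrow> real) \<Rightarrow> nat \<Rightarrow> real" where
  "running_deficit x 0 = 0"
| "running_deficit x (Suc i) = max (running_deficit x i) (- x (Suc i))"

definition reflected_walk :: "(nat \<Rightarrow> real) \<Rightarrow> nat \<Rightarrow> real" where
  "reflected_walk x i = x i + running_deficit x i"

lemma running_deficit_cong: "(\<And>l. l \<le> i \<Longrightarrow> x l = y l) \<Longrightarrow> running_deficit x i = running_deficit y i"
  by (induction i) auto

lemma running_deficit_ge: "0 < l \<Longrightarrow> l \<le> i \<Longrightarrow> - x l \<le> running_deficit x i"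
  by (induction i) (auto simp: le_Suc_eq)

lemma running_deficit_nonneg: "0 \<le> running_deficit x i"
  by (induction i) auto

lemma running_deficit_le: "0 \<le> B \<Longrightarrow> (\<And>l. l \<le> i \<Longrightarrow> - x l \<le> B) \<Longrightarrow> running_deficit x i \<le> B"
  by (induction i) auto

text \<open>Lindley's recursion, from the two cases of the maximum in
  \<open>running_deficit\<close>.\<close>

lemma reflected_walk_Suc: "reflected_walk x (Suc i) = max 0 (reflected_walk x i + (x (Suc i) - x i))"
  by (auto simp: reflected_walk_def)

lemma reflected_walk_0: "x 0 = 0 \<Longrightarrow> reflected_walk x 0 = 0"
  by (simp add: reflected_walk_def)

lemma reflected_walk_nonneg: "x 0 = 0 \<Longrightarrow> 0 \<le> reflected_walk x i"
  by (cases i) (auto simp: reflected_walk_0 reflected_walk_Suc)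

text \<open>
  The discrete Kella--Whitt identity. The error term is the second order remainder of
  \<open>exp (b I)\<close>, where \<open>I \<le> h\<close> is the idle time of one step.
\<close>

lemma reflected_walk_exp_sum:
  assumes x0: "x 0 = 0" and step: "\<And>i. x i - h \<le> x (Suc i)" and b: "0 \<le> b" and h: "0 \<le> h" "b * h \<le> 1"
  shows "\<bar>(\<Sum>i<m. exp (- b * reflected_walk x i) * (exp (- b * (x (Suc i) - x i)) - 1)) -
    (exp (- b * reflected_walk x m) - 1 + b * running_deficit x m)\<bar> \<le> m * (b * h)\<^sup>2"
proof (induction m)
  case (Suc m)
  let ?w = "reflected_walk x" and ?d = "x (Suc m) - x m" and ?L = "running_deficit x"
  define y where "y = b * (?L (Suc m) - ?L m)"
  have I: "?L (Suc m) - ?L m = max 0 (- (?w m + ?d))"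
    by (auto simp: reflected_walk_def)
  have "0 \<le> ?w m" by (rule reflected_walk_nonneg) (rule x0)
  with step[of m] h(1) have "?L (Suc m) - ?L m \<le> h" "0 \<le> ?L (Suc m) - ?L m" unfolding I by auto
  then have y: "0 \<le> y" "y \<le> b * h" unfolding y_def using b by (auto intro: mult_left_mono)
  \<comment> \<open>If the step does not cross 0, both sides vanish. Otherwise the reflected walk is
    put back to 0, the second exponential is 1, and \<open>y\<close> is b times the amount by which
    the step would have gone below 0.\<close>
  have "exp (- b * (?w m + ?d)) - exp (- b * ?w (Suc m)) = exp y - 1"
    unfolding y_def I reflected_walk_Suc
    by (cases "0 \<le> ?w m + ?d") (auto simp: max_def right_diff_distrib distrib_left)
  then have "exp (- b * ?w m) * (exp (- b * ?d) - 1) =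
      exp (- b * ?w (Suc m)) - exp (- b * ?w m) + (exp y - 1)"
    by (simp add: algebra_simps exp_add exp_diff exp_minus) (simp add: divide_simps exp_add[symmetric])
  moreover have "\<bar>exp y - 1 - y\<bar> \<le> (b * h)\<^sup>2"
  proof -
    have "exp y \<le> 1 + y + y\<^sup>2" using y h by (intro exp_bound) auto
    moreover have "y\<^sup>2 \<le> (b * h)\<^sup>2" using y by (intro power_mono) auto
    ultimately show ?thesis using exp_ge_add_one_self[of y] by linarith
  qed
  ultimately show ?case
    using Suc by (simp add: y_def algebra_simps del: running_deficit.simps)
qed (simp add: reflected_walk_0 x0)

locale input_path = stieltjes F for F +
  assumes zero: "F 0 = 0"
begin

lemma nonneg: "0 \<le> s \<Longrightarrow> 0 \<le> F s"
  using mono[of 0 s] zero by simp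

lemma bdd_below_net: "bdd_below ((\<lambda>s. F s - s) ` {0..t})"
proof (rule bdd_belowI2)
  fix s assume "s \<in> {0..t}"
  then show "- t \<le> F s - s" using nonneg[of s] by auto
qed

lemma idle_time_ge: "0 \<le> s \<Longrightarrow> s \<le> t \<Longrightarrow> s - F s \<le> idle_time F t"
  using cINF_lower[OF bdd_below_net, of s t] by (auto simp: idle_time_def)

lemma idle_time_nonneg: "0 \<le> idle_time F t"
  by (simp add: idle_time_def)

lemma idle_time_le:
  assumes "0 \<le> t" "0 \<le> B" "\<And>s. 0 \<le> s \<Longrightarrow> s \<le> t \<Longrightarrow> s - F s \<le> B"
  shows "idle_time F t \<le> B"
proof -
  have "- B \<le> (INF s\<in>{0..t}. F s - s)"
    using assms(1,3) by (intro cINF_greatest) force+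
  then show ?thesis using assms(2) by (auto simp: idle_time_def)
qed

lemma idle_time_mono: "0 \<le> s \<Longrightarrow> s \<le> t \<Longrightarrow> idle_time F s \<le> idle_time F t"
  by (intro idle_time_le idle_time_nonneg idle_time_ge) auto

text \<open>As F increases, the net input falls at most at unit rate. The idle time is thus
  continuous even where F jumps, and the jumps of the workload are those of the input.\<close>

lemma idle_time_lipschitz:
  assumes "0 \<le> s" "s \<le> t"
  shows "idle_time F t \<le> idle_time F s + (t - s)"
proof (rule idle_time_le)
  fix r assume r: "0 \<le> r" "r \<le> t"
  show "r - F r \<le> idle_time F s + (t - s)"
  proof (cases "r \<le> s")
    case False
    then show ?thesis using idle_time_ge[of s s] mono[of s r] r assms by auto
  qed (use idle_time_ge[of r s] r assms in auto)
qed (use assms idle_time_nonneg in auto)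

lemma idle_time_tendsto_left:
  assumes "0 < s" shows "(idle_time F \<longlongrightarrow> idle_time F s) (at_left s)"
proof (rule tendsto_sandwich)
  have *: "\<forall>\<^sub>F r in at_left s. 0 \<le> r \<and> r \<le> s"
    using assms by (auto simp: eventually_at_left[of 0] intro!: exI[of _ 0])
  show "\<forall>\<^sub>F r in at_left s. idle_time F s - (s - r) \<le> idle_time F r"
    using * by eventually_elim (use idle_time_lipschitz in force)
  show "\<forall>\<^sub>F r in at_left s. idle_time F r \<le> idle_time F s"
    using * by eventually_elim (use idle_time_mono in force)
  have "((\<lambda>r. idle_time F s - (s - r)) \<longlongrightarrow> idle_time F s - (s - s)) (at_left s)"
    by (intro tendsto_intros)
  then show "((\<lambda>r. idle_time F s - (s - r)) \<longlongrightarrow> idle_time F s) (at_left s)" by simp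
qed (rule tendsto_const)

definition W :: "real \<Rightarrow> real" where "W t = F t - t + idle_time F t"

text \<open>The left limit of \<open>W\<close>. The idle time is continuous, so it is taken at s
  itself; \<open>max 0 s\<close> keeps it monotone, hence measurable, on the whole line.\<close>

definition W_left :: "real \<Rightarrow> real" where
  "W_left s = left_lim F s - s + idle_time F (max 0 s)"

lemma W_nonneg: "0 \<le> t \<Longrightarrow> 0 \<le> W t"
  using idle_time_ge[of t t] by (simp add: W_def)

lemma W_tendsto_left: "0 < s \<Longrightarrow> (W \<longlongrightarrow> W_left s) (at_left s)"
  unfolding W_def W_left_def
  by (intro tendsto_add tendsto_diff tendsto_left_lim tendsto_ident_at) (simp add: idle_time_tendsto_left)

lemma W_left_nonneg: "0 < s \<Longrightarrow> 0 \<le> W_left s"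
  by (rule tendsto_lowerbound[OF W_tendsto_left])
     (auto simp: eventually_at_left[of 0] intro!: exI[of _ 0] W_nonneg)

lemma W_left_eq_W: "0 < s \<Longrightarrow> jump F s = 0 \<Longrightarrow> W_left s = W s"
  by (simp add: W_def W_left_def jump_def)

lemma measurable_W_left [measurable]: "W_left \<in> borel_measurable borel"
proof -
  have "mono (\<lambda>s. idle_time F (max 0 s))" by (intro monoI idle_time_mono) auto
  then have [measurable]: "(\<lambda>s. idle_time F (max 0 s)) \<in> borel_measurable borel" by (rule borel_measurable_mono)
  show ?thesis unfolding W_left_def[abs_def] by measurable
qed

definition grid_walk :: "real \<Rightarrow> nat \<Rightarrow> real" where "grid_walk h i = F (real i * h) - real i * h"

lemma grid_walk_0: "grid_walk h 0 = 0" by (simp add: grid_walk_def zero)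

text \<open>Rounding a time s down to the grid lowers s - F s by at most h because F increases, so
  observing the infimum only on the grid costs at most one mesh width.\<close>

lemma running_deficit_grid_walk:
  assumes "0 < h"
  shows "running_deficit (grid_walk h) i \<le> idle_time F (real i * h)"
    and "idle_time F (real i * h) \<le> running_deficit (grid_walk h) i + h"
proof -
  show "running_deficit (grid_walk h) i \<le> idle_time F (real i * h)"
  proof (rule running_deficit_le)
    fix l assume "l \<le> i"
    then show "- grid_walk h l \<le> idle_time F (real i * h)"
      using idle_time_ge[of "real l * h" "real i * h"] assms by (simp add: grid_walk_def)
  qed (rule idle_time_nonneg)
  show "idle_time F (real i * h) \<le> running_deficit (grid_walk h) i + h"
  proof (rule idle_time_le)
    fix s assume s: "0 \<le> s" "s \<le> real i * h"
    define l where "l = nat \<lfloor>s / h\<rfloor>"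
    have "0 \<le> s / h" using s assms by simp
    then have l: "real l \<le> s / h" "s / h < real l + 1" unfolding l_def by linarith+
    then have l': "real l * h \<le> s" "s \<le> real l * h + h" using assms by (simp_all add: field_simps)
    have "real l \<le> real i" using l(1) s assms by (meson divide_le_eq order.trans)
    then have "l \<le> i" by simp
    then have "- grid_walk h l \<le> running_deficit (grid_walk h) i"
      using running_deficit_ge[of l i "grid_walk h"] running_deficit_nonneg[of "grid_walk h" i]
      by (cases "l = 0") (auto simp: grid_walk_0)
    then show "s - F s \<le> running_deficit (grid_walk h) i + h"
      using mono[OF l'(1)] l'(2) by (simp add: grid_walk_def)
  qed (use assms running_deficit_nonneg in \<open>auto intro!: add_nonneg_nonneg\<close>)
qed

lemma reflected_grid_walk_approx:
  assumes "0 < h"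
  shows "\<bar>reflected_walk (grid_walk h) i - W (real i * h)\<bar> \<le> h"
  using running_deficit_grid_walk[OF assms, of i] by (simp add: reflected_walk_def grid_walk_def W_def)

lemma mesh_tendsto_0: "(\<lambda>m. t / real m) \<longlonglongrightarrow> 0"
  using tendsto_mult_right_zero[OF lim_1_over_n, of t] by simp

lemma reflected_grid_walk_tendsto_left:
  assumes t: "0 < t" and s: "0 < s" "s \<le> t"
  shows "(\<lambda>m. reflected_walk (grid_walk (t / m)) (grid_index t m s)) \<longlonglongrightarrow> W_left s"
proof -
  have "(\<lambda>m. reflected_walk (grid_walk (t / m)) (grid_index t m s) - W (real (grid_index t m s) * (t / m))) \<longlonglongrightarrow> 0"
  proof (rule Lim_null_comparison[OF _ mesh_tendsto_0])
    show "\<forall>\<^sub>F m in sequentially. norm (reflected_walk (grid_walk (t / m)) (grid_index t m s) - W (real (grid_index t m s) * (t / m))) \<le> t / m"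
      using eventually_gt_at_top[of 0]
      by eventually_elim (use t in \<open>simp add: reflected_grid_walk_approx del: times_divide_eq_right\<close>)
  qed
  moreover have "(\<lambda>m. W (real (grid_index t m s) * (t / m))) \<longlonglongrightarrow> W_left s"
    by (rule filterlim_compose[OF W_tendsto_left[OF s(1)] grid_index_at_left[OF s(1) t]])
  ultimately show ?thesis
    by (rule Lim_transform[rotated])
qed

lemma running_deficit_tendsto:
  assumes t: "0 < t"
  shows "(\<lambda>m. running_deficit (grid_walk (t / m)) m) \<longlonglongrightarrow> idle_time F t"
    and "(\<lambda>m. reflected_walk (grid_walk (t / m)) m) \<longlonglongrightarrow> W t"
proof -
  have *: "\<bar>running_deficit (grid_walk (t / m)) m - idle_time F t\<bar> \<le> t / m"
      "\<bar>reflected_walk (grid_walk (t / m)) m - W t\<bar> \<le> t / m" if "0 < m" for m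
    using running_deficit_grid_walk[of "t / m" m] reflected_grid_walk_approx[of "t / m" m] t that
    by (auto simp: abs_le_iff)
  show "(\<lambda>m. running_deficit (grid_walk (t / m)) m) \<longlonglongrightarrow> idle_time F t"
    by (rule LIM_zero_cancel, rule Lim_null_comparison[OF _ mesh_tendsto_0[of t]])
       (use eventually_gt_at_top[of 0] in \<open>eventually_elim, use * in simp\<close>)
  show "(\<lambda>m. reflected_walk (grid_walk (t / m)) m) \<longlonglongrightarrow> W t"
    by (rule LIM_zero_cancel, rule Lim_null_comparison[OF _ mesh_tendsto_0[of t]])
       (use eventually_gt_at_top[of 0] in \<open>eventually_elim, use * in simp\<close>)
qed

text \<open>The weight of a cell depends only on the increments over earlier cells, which is what
  turns the weighted sums below into martingale sums once their factors are centred.\<close>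

definition weight :: "real \<Rightarrow> real \<Rightarrow> nat \<Rightarrow> nat \<Rightarrow> real" where
  "weight b t m i = exp (- b * reflected_walk (grid_walk (t / m)) i)"

lemma weight_bounds: "0 \<le> b \<Longrightarrow> 0 \<le> weight b t m i" "0 \<le> b \<Longrightarrow> weight b t m i \<le> 1" "0 \<le> b \<Longrightarrow> \<bar>weight b t m i\<bar> \<le> 1"
  by (auto simp: weight_def intro!: mult_nonneg_nonneg reflected_walk_nonneg grid_walk_0)

lemma weight_tendsto:
  assumes "0 < t" "0 < s" "s \<le> t"
  shows "(\<lambda>m. weight b t m (grid_index t m s)) \<longlonglongrightarrow> exp (- b * W_left s)"
  unfolding weight_def by (intro tendsto_intros reflected_grid_walk_tendsto_left assms)

text \<open>\<open>grid_sum_tendsto\<close> for the identity: it has no jumps, so the slope is the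
  constant a. Using 1 - exp(-a h) in place of a h is what allows this instance.\<close>

lemma weight_sum_tendsto:
  assumes "0 < t" "0 \<le> b" "0 \<le> a"
  shows "(\<lambda>m. \<Sum>i<m. weight b t m i * (1 - exp (- a * (t / m)))) \<longlonglongrightarrow>
    a * (LINT s:{0<..t}|lborel. exp (- b * W_left s))"
proof -
  interpret id: stieltjes "\<lambda>x::real. x" by standard auto
  have "jump (\<lambda>x::real. x) s = 0" for s using id.isCont_iff_jump[of s] by simp
  moreover have eq: "real (Suc i) * y - real i * y = y" for i y by (simp add: algebra_simps)
  have "(\<lambda>m. \<Sum>i<m. weight b t m i * (1 - exp (- a * (real (Suc i) * (t / m) - real i * (t / m)))))
      \<longlonglongrightarrow> (LINT s:{0<..t}|id.\<mu>. exp (- b * W_left s) * exp_slope a (jump (\<lambda>x. x) s))"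
    by (rule id.grid_sum_tendsto) (use assms weight_bounds weight_tendsto in auto)
  ultimately show ?thesis
    unfolding lborel_eq_interval_measure eq by (simp add: exp_slope_def mult.commute)
qed

text \<open>For \<open>c = \<phi> b\<close> the centring exp(c h) will be the exact mean of the
  exponential of a net input step. The error of the discrete identity is m (b t / m)^2 = (b t)^2 / m
  and disappears in the limit.\<close>

lemma kella_whitt_tendsto:
  assumes t: "0 < t" and b: "0 \<le> b" and c: "0 \<le> c"
  shows "(\<lambda>m. \<Sum>i<m. weight b t m i * (exp (- b * (grid_walk (t / m) (Suc i) - grid_walk (t / m) i)) - exp (c * (t / m))))
    \<longlonglongrightarrow> exp (- b * W t) - 1 + b * idle_time F t - c * (LINT s:{0<..t}|lborel. exp (- b * W_left s))"
proof -
  have "(\<lambda>m. (\<Sum>i<m. weight b t m i * (exp (- b * (grid_walk (t / m) (Suc i) - grid_walk (t / m) i)) - 1)) -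
      (exp (- b * reflected_walk (grid_walk (t / m)) m) - 1 + b * running_deficit (grid_walk (t / m)) m)) \<longlonglongrightarrow> 0"
  proof (rule Lim_null_comparison)
    \<comment> \<open>A mesh below 1 / (b + 1) satisfies b h <= 1, as the discrete identity demands;
      the added 1 avoids a division by 0 for b = 0.\<close>
    have "\<forall>\<^sub>F m in sequentially. t / real m < 1 / (b + 1)"
      using b by (intro order_tendstoD(2)[OF mesh_tendsto_0]) auto
    then show "\<forall>\<^sub>F m in sequentially. norm ((\<Sum>i<m. weight b t m i * (exp (- b * (grid_walk (t / m) (Suc i) - grid_walk (t / m) i)) - 1)) -
      (exp (- b * reflected_walk (grid_walk (t / m)) m) - 1 + b * running_deficit (grid_walk (t / m)) m)) \<le> real m * (b * (t / m))\<^sup>2"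
      using eventually_gt_at_top[of 0]
    proof eventually_elim
      case (elim m)
      have "grid_walk (t / m) i - t / m \<le> grid_walk (t / m) (Suc i)" for i
        using mono[of "real i * (t / m)" "real (Suc i) * (t / m)"] t by (simp add: grid_walk_def algebra_simps add_divide_distrib)
      moreover have "(b + 1) * (t / m) \<le> 1" using elim(1) b by (simp add: pos_less_divide_eq mult.commute)
      then have "b * (t / m) + t / m \<le> 1" by (simp only: distrib_right mult_1)
      moreover have "0 \<le> t / m" using t by simp
      ultimately show ?case
        unfolding real_norm_def weight_def using b
        by (intro reflected_walk_exp_sum grid_walk_0) auto
    qed
    have "(\<lambda>m. (b * t)\<^sup>2 * (1 / real m)) \<longlonglongrightarrow> 0"
      by (intro tendsto_mult_right_zero lim_1_over_n)
    then show "(\<lambda>m. real m * (b * (t / m))\<^sup>2) \<longlonglongrightarrow> 0"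
      by (rule Lim_transform_eventually)
         (use eventually_gt_at_top[of 0] in \<open>eventually_elim, simp add: power2_eq_square\<close>)
  qed
  moreover have "(\<lambda>m. exp (- b * reflected_walk (grid_walk (t / m)) m) - 1 + b * running_deficit (grid_walk (t / m)) m)
      \<longlonglongrightarrow> exp (- b * W t) - 1 + b * idle_time F t"
    by (intro tendsto_intros running_deficit_tendsto t)
  ultimately have 1: "(\<lambda>m. \<Sum>i<m. weight b t m i * (exp (- b * (grid_walk (t / m) (Suc i) - grid_walk (t / m) i)) - 1))
      \<longlonglongrightarrow> exp (- b * W t) - 1 + b * idle_time F t"
    by (rule Lim_transform[rotated])
  have 3: "(\<lambda>m. exp (c * (t / m)) * (\<Sum>i<m. weight b t m i * (1 - exp (- c * (t / m))))) \<longlonglongrightarrow>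
      exp (c * 0) * (c * (LINT s:{0<..t}|lborel. exp (- b * W_left s)))"
    by (intro tendsto_mult weight_sum_tendsto t b c tendsto_exp tendsto_const mesh_tendsto_0)
  \<comment> \<open>Moves the centring from 1 to e = exp(c h): the correction is e times the summand
    of \<open>weight_sum_tendsto\<close>, and the factor e tends to 1.\<close>
  have 2: "x * (y - 1) - e * (x * (1 - inverse e)) = x * (y - e)" if "e \<noteq> 0" for x y e :: real
    using that by (simp add: field_simps)
  from tendsto_diff[OF 1 3]
  show ?thesis
    by (simp only: sum_distrib_left sum_subtractf[symmetric] mult_minus_left exp_minus 2[OF exp_not_eq_zero]) simp
qed

end

section \<open>Subordinators\<close>

text \<open>For k^2 <= t <= (k+1)^2 monotonicity encloses f t / t between its neighbours on the
  squares, up to the factor (k/(k+1))^2, which tends to 1.\<close>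

lemma mono_div_tendsto_at_top:
  fixes f :: "real \<Rightarrow> real"
  assumes mono: "mono_on {0..} f" and nonneg: "\<And>t. 0 \<le> t \<Longrightarrow> 0 \<le> f t"
    and lim: "(\<lambda>n. f ((real n)\<^sup>2) / (real n)\<^sup>2) \<longlonglongrightarrow> c"
  shows "((\<lambda>t. f t / t) \<longlongrightarrow> c) at_top"
proof -
  define k where "k t = nat \<lfloor>sqrt t\<rfloor>" for t
  have k_lim: "filterlim k sequentially at_top"
    unfolding k_def
    by (rule filterlim_compose[OF filterlim_nat_sequentially filterlim_compose[OF filterlim_floor_sequentially sqrt_at_top]])
  have k: "(real (k t))\<^sup>2 \<le> t" "t \<le> (real (Suc (k t)))\<^sup>2" if "1 \<le> t" for t
  proof -
    have "0 \<le> sqrt t" using that by simp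
    then have "real (k t) \<le> sqrt t" "sqrt t \<le> real (Suc (k t))" unfolding k_def by linarith+
    then have "(real (k t))\<^sup>2 \<le> (sqrt t)\<^sup>2" "(sqrt t)\<^sup>2 \<le> (real (Suc (k t)))\<^sup>2"
      using \<open>0 \<le> sqrt t\<close> by (intro power_mono; simp)+
    then show "(real (k t))\<^sup>2 \<le> t" "t \<le> (real (Suc (k t)))\<^sup>2" using that by simp_all
  qed
  have r: "(\<lambda>n. ((real n)\<^sup>2) / (real (Suc n))\<^sup>2) \<longlonglongrightarrow> 1"
  proof -
    have "(\<lambda>n. (real n / real (Suc n))\<^sup>2) \<longlonglongrightarrow> 1\<^sup>2"
      by (intro tendsto_power LIMSEQ_n_over_Suc_n)
    then show ?thesis by (simp add: power_divide)
  qed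
  have "(\<lambda>n. f ((real n)\<^sup>2) / (real n)\<^sup>2 * ((real n)\<^sup>2 / (real (Suc n))\<^sup>2)) \<longlonglongrightarrow> c * 1"
    by (intro tendsto_mult lim r)
  from filterlim_compose[OF this k_lim]
  have lo: "((\<lambda>t. f ((real (k t))\<^sup>2) / (real (k t))\<^sup>2 * ((real (k t))\<^sup>2 / (real (Suc (k t)))\<^sup>2)) \<longlongrightarrow> c) at_top"
    by simp
  have "(\<lambda>n. f ((real (Suc n))\<^sup>2) / (real (Suc n))\<^sup>2 / ((real n)\<^sup>2 / (real (Suc n))\<^sup>2)) \<longlonglongrightarrow> c / 1"
    by (intro tendsto_divide r LIMSEQ_Suc[OF lim]) simp
  from filterlim_compose[OF this k_lim]
  have up: "((\<lambda>t. f ((real (Suc (k t)))\<^sup>2) / (real (Suc (k t)))\<^sup>2 / ((real (k t))\<^sup>2 / (real (Suc (k t)))\<^sup>2)) \<longlongrightarrow> c) at_top"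
    by simp
  have ev: "\<forall>\<^sub>F t in at_top. 1 \<le> t \<and> 0 < k t"
    using eventually_ge_at_top[of 1] filterlim_iff[THEN iffD1, OF k_lim, rule_format, OF eventually_gt_at_top[of 0]]
    by eventually_elim simp
  show ?thesis
  proof (rule tendsto_sandwich[OF _ _ lo up])
    show "\<forall>\<^sub>F t in at_top. f ((real (k t))\<^sup>2) / (real (k t))\<^sup>2 * ((real (k t))\<^sup>2 / (real (Suc (k t)))\<^sup>2) \<le> f t / t"
      using ev
    proof eventually_elim
      case (elim t)
      have "f ((real (k t))\<^sup>2) / (real (Suc (k t)))\<^sup>2 \<le> f t / t"
        using elim k[of t] nonneg[of t]
        by (intro frac_le mono_onD[OF mono]) auto
      then show ?case using elim by simp
    qed
    show "\<forall>\<^sub>F t in at_top. f t / t \<le> f ((real (Suc (k t)))\<^sup>2) / (real (Suc (k t)))\<^sup>2 / ((real (k t))\<^sup>2 / (real (Suc (k t)))\<^sup>2)"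
      using ev
    proof eventually_elim
      case (elim t)
      have "f t / t \<le> f ((real (Suc (k t)))\<^sup>2) / (real (k t))\<^sup>2"
        using elim k[of t] by (intro frac_le mono_onD[OF mono] nonneg) auto
      then show ?case by (simp del: of_nat_Suc)
    qed
  qed
qed

locale subordinator_space = prob_space M for M :: "'a measure" and J :: "real \<Rightarrow> 'a \<Rightarrow> real" +
  assumes sub: "subordinator M J"
begin

lemma measurable_J: "0 \<le> t \<Longrightarrow> J t \<in> borel_measurable M"
  using sub by (auto simp: subordinator_def levy_process_def)

lemma J_zero: "\<omega> \<in> space M \<Longrightarrow> J 0 \<omega> = 0"
  using sub by (auto simp: subordinator_def levy_process_def)

lemma J_mono: "\<omega> \<in> space M \<Longrightarrow> 0 \<le> s \<Longrightarrow> s \<le> t \<Longrightarrow> J s \<omega> \<le> J t \<omega>"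
  using sub by (auto simp: subordinator_def mono_on_def)

lemma J_nonneg: "\<omega> \<in> space M \<Longrightarrow> 0 \<le> t \<Longrightarrow> 0 \<le> J t \<omega>"
  using J_mono[of \<omega> 0 t] J_zero by simp

lemma J_right_cont: "\<omega> \<in> space M \<Longrightarrow> 0 \<le> t \<Longrightarrow> continuous (at_right t) (\<lambda>s. J s \<omega>)"
  using sub by (auto simp: subordinator_def levy_process_def)

lemma J_increment_distr: "0 \<le> s \<Longrightarrow> 0 \<le> h \<Longrightarrow> distr M borel (\<lambda>\<omega>. J (s + h) \<omega> - J s \<omega>) = distr M borel (J h)"
  using sub by (auto simp: subordinator_def levy_process_def)

lemma J_indep_increments:
  "0 \<le> t 0 \<Longrightarrow> mono_on {..n} t \<Longrightarrow> indep_vars (\<lambda>_. borel) (\<lambda>i \<omega>. J (t (Suc i)) \<omega> - J (t i) \<omega>) {..<n}"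
  using sub by (auto simp: subordinator_def levy_process_def)

definition increment :: "real \<Rightarrow> nat \<Rightarrow> 'a \<Rightarrow> real" where
  "increment h i \<omega> = J (real (Suc i) * h) \<omega> - J (real i * h) \<omega>"

lemma increment_nonneg: "0 \<le> h \<Longrightarrow> \<omega> \<in> space M \<Longrightarrow> 0 \<le> increment h i \<omega>"
  using J_mono[of \<omega> "real i * h" "real (Suc i) * h"] by (simp add: increment_def mult_right_mono)

lemma measurable_increment: "0 \<le> h \<Longrightarrow> increment h i \<in> borel_measurable M"
  unfolding increment_def by (intro borel_measurable_diff measurable_J) auto

lemma distr_increment: "0 \<le> h \<Longrightarrow> distr M borel (increment h i) = distr M borel (J h)"
  using J_increment_distr[of "real i * h" h] by (simp add: increment_def[abs_def] algebra_simps)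

lemma indep_increments: "0 \<le> h \<Longrightarrow> indep_vars (\<lambda>_. borel) (increment h) {..<n}"
  using J_indep_increments[of "\<lambda>i. real i * h" n]
  by (simp add: increment_def[abs_def] mono_on_def mult_right_mono del: of_nat_Suc)

lemma indep_increments_UNIV: "0 \<le> h \<Longrightarrow> indep_vars (\<lambda>_. borel) (increment h) UNIV"
proof -
  assume h: "0 \<le> h"
  have "indep_sets (\<lambda>i. {increment h i -` A \<inter> space M |A. A \<in> sets borel}) UNIV"
    unfolding indep_sets_finite_index_sets[of _ UNIV]
  proof (intro allI impI)
    fix K :: "nat set" assume "finite K"
    then obtain n where "K \<subseteq> {..<n}" by (auto simp: finite_nat_iff_bounded)
    then have "indep_vars (\<lambda>_. borel) (increment h) K"
      using indep_vars_subset[OF indep_increments[OF h]] by blast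
    then show "indep_sets (\<lambda>i. {increment h i -` A \<inter> space M |A. A \<in> sets borel}) K"
      by (simp add: indep_vars_def2)
  qed
  then show ?thesis
    using measurable_increment[OF h] by (simp add: indep_vars_def2)
qed

lemma sum_increment: "\<omega> \<in> space M \<Longrightarrow> (\<Sum>i<n. increment h i \<omega>) = J (real n * h) \<omega>"
  by (induction n) (auto simp: increment_def J_zero)

lemma integrable_exp: "0 \<le> \<alpha> \<Longrightarrow> 0 \<le> t \<Longrightarrow> integrable M (\<lambda>\<omega>. exp (- \<alpha> * J t \<omega>))"
  using J_nonneg measurable_J by (intro integrable_const_bound[of _ 1]) auto

lemma laplace_pos: "0 \<le> \<alpha> \<Longrightarrow> 0 \<le> t \<Longrightarrow> 0 < expectation (\<lambda>\<omega>. exp (- \<alpha> * J t \<omega>))"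
proof -
  assume *: "0 \<le> \<alpha>" "0 \<le> t"
  have "expectation (\<lambda>\<omega>. exp (- \<alpha> * J t \<omega>)) \<noteq> 0"
    using integral_nonneg_eq_0_iff_AE[OF integrable_exp[OF *]] by (simp add: AE_False)
  moreover have "0 \<le> expectation (\<lambda>\<omega>. exp (- \<alpha> * J t \<omega>))" by (intro integral_nonneg_AE) simp
  ultimately show "0 < expectation (\<lambda>\<omega>. exp (- \<alpha> * J t \<omega>))" by (auto simp only: order_less_le)
qed

lemma laplace_antimono:
  "0 \<le> \<alpha> \<Longrightarrow> 0 \<le> s \<Longrightarrow> s \<le> t \<Longrightarrow> expectation (\<lambda>\<omega>. exp (- \<alpha> * J t \<omega>)) \<le> expectation (\<lambda>\<omega>. exp (- \<alpha> * J s \<omega>))"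
  using J_mono by (intro integral_mono integrable_exp) (auto intro: mult_left_mono)

lemma expectation_increment:
  assumes "0 \<le> h" and [measurable]: "f \<in> borel_measurable borel"
  shows "expectation (\<lambda>\<omega>. f (increment h i \<omega>)) = expectation (\<lambda>\<omega>. f (J h \<omega>) :: real)"
proof -
  note [measurable] = measurable_increment[OF assms(1)] measurable_J[OF assms(1)]
  have "expectation (\<lambda>\<omega>. f (increment h i \<omega>)) = integral\<^sup>L (distr M borel (increment h i)) f"
    by (subst integral_distr) auto
  also have "\<dots> = expectation (\<lambda>\<omega>. f (J h \<omega>))"
    unfolding distr_increment[OF assms(1)] by (subst integral_distr) auto
  finally show ?thesis .
qed

lemma laplace_mult:
  assumes a: "0 \<le> \<alpha>" and h: "0 \<le> h"
  shows "expectation (\<lambda>\<omega>. exp (- \<alpha> * J (real n * h) \<omega>)) = expectation (\<lambda>\<omega>. exp (- \<alpha> * J h \<omega>)) ^ n"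
proof -
  have iv: "indep_vars (\<lambda>_. borel) (\<lambda>i \<omega>. exp (- \<alpha> * increment h i \<omega>)) {..<n}"
    by (rule indep_vars_compose2[OF indep_increments[OF h]]) simp
  have "expectation (\<lambda>\<omega>. exp (- \<alpha> * J (real n * h) \<omega>)) = expectation (\<lambda>\<omega>. \<Prod>i<n. exp (- \<alpha> * increment h i \<omega>))"
    by (intro Bochner_Integration.integral_cong refl)
       (simp add: sum_increment[symmetric] exp_sum[symmetric] sum_distrib_left del: sum_increment)
  also have "\<dots> = (\<Prod>i<n. expectation (\<lambda>\<omega>. exp (- \<alpha> * increment h i \<omega>)))"
  proof (rule indep_vars_lebesgue_integral[OF _ iv])
    show "integrable M (\<lambda>\<omega>. exp (- \<alpha> * increment h i \<omega>))" for i
      using increment_nonneg[OF h] a measurable_increment[OF h, of i]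
      by (intro integrable_const_bound[of _ 1]) auto
  qed simp
  also have "\<dots> = expectation (\<lambda>\<omega>. exp (- \<alpha> * J h \<omega>)) ^ n"
    by (simp add: expectation_increment[OF h, of "\<lambda>x. exp (- \<alpha> * x)", simplified])
  finally show ?thesis .
qed

abbreviation "\<eta> \<equiv> laplace_exponent M J"

text \<open>Increments over cells of length 1/m are independent with a common law, so the transform
  at time 1/m is the positive m-th root of the transform at time 1.\<close>

lemma laplace_rational:
  assumes a: "0 \<le> \<alpha>" and m: "0 < m"
  shows "expectation (\<lambda>\<omega>. exp (- \<alpha> * J (real k / real m) \<omega>)) = exp (- (real k / real m) * \<eta> \<alpha>)"
proof -
  let ?g = "expectation (\<lambda>\<omega>. exp (- \<alpha> * J (1 / real m) \<omega>))"
  have "expectation (\<lambda>\<omega>. exp (- \<alpha> * J 1 \<omega>)) = ?g ^ m"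
    using laplace_mult[OF a, of "1 / real m" m] m by simp
  moreover have "expectation (\<lambda>\<omega>. exp (- \<alpha> * J 1 \<omega>)) = exp (- \<eta> \<alpha>)"
    using laplace_pos[OF a, of 1] by (simp add: laplace_exponent_def)
  moreover have "exp (- \<eta> \<alpha>) = exp (- \<eta> \<alpha> / real m) ^ m"
    using m by (simp add: exp_of_nat_mult[symmetric])
  ultimately have "?g ^ m = exp (- \<eta> \<alpha> / real m) ^ m" by simp
  then have g: "?g = exp (- \<eta> \<alpha> / real m)"
  proof (rule power_eq_imp_eq_base[OF _ _ _ m])
    show "0 \<le> ?g" using laplace_pos[OF a, of "1 / real m"] by simp
  qed simp
  have "expectation (\<lambda>\<omega>. exp (- \<alpha> * J (real k * (1 / real m)) \<omega>)) = ?g ^ k"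
    by (rule laplace_mult[OF a]) simp
  also have "\<dots> = exp (- (real k / real m) * \<eta> \<alpha>)"
    unfolding g by (simp add: exp_of_nat_mult[symmetric])
  finally show ?thesis by simp
qed

text \<open>The transform decreases in time, so its value at t is squeezed between those at rational
  times approaching t from both sides.\<close>

lemma laplace_eq:
  assumes a: "0 \<le> \<alpha>" and t: "0 \<le> t"
  shows "expectation (\<lambda>\<omega>. exp (- \<alpha> * J t \<omega>)) = exp (- t * \<eta> \<alpha>)"
proof (rule antisym)
  let ?g = "\<lambda>t. expectation (\<lambda>\<omega>. exp (- \<alpha> * J t \<omega>))"
  define k where "k m = nat \<lfloor>t * real m\<rfloor>" for m
  have k: "real (k m) \<le> t * real m" "t * real m \<le> real (Suc (k m))" for m
  proof -
    have "0 \<le> t * real m" using t by simp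
    then show "real (k m) \<le> t * real m" "t * real m \<le> real (Suc (k m))"
      unfolding k_def by linarith+
  qed
  have inv: "(\<lambda>m. 1 / real m) \<longlonglongrightarrow> 0" by (rule lim_1_over_n)
  have lo: "(\<lambda>m. real (k m) / real m) \<longlonglongrightarrow> t"
  proof (rule tendsto_sandwich[of "\<lambda>m. t - 1 / real m" _ _ "\<lambda>_. t"])
    show "\<forall>\<^sub>F m in sequentially. t - 1 / real m \<le> real (k m) / real m"
      using eventually_gt_at_top[of 0]
    proof eventually_elim
      case (elim m)
      have "(t * real m - 1) / real m \<le> real (k m) / real m"
        using k(2)[of m] by (intro divide_right_mono) auto
      then show ?case using elim by (simp add: diff_divide_distrib)
    qed
    show "\<forall>\<^sub>F m in sequentially. real (k m) / real m \<le> t"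
      using eventually_gt_at_top[of 0] by eventually_elim (use k(1) in \<open>simp add: field_simps\<close>)
    show "(\<lambda>m. t - 1 / real m) \<longlonglongrightarrow> t" using tendsto_diff[OF tendsto_const inv, of t] by simp
  qed simp
  have up: "(\<lambda>m. real (Suc (k m)) / real m) \<longlonglongrightarrow> t"
    using tendsto_add[OF lo inv] by (simp add: add_divide_distrib add.commute)
  show "?g t \<le> exp (- t * \<eta> \<alpha>)"
  proof (rule tendsto_lowerbound)
    show "(\<lambda>m. exp (- (real (k m) / real m) * \<eta> \<alpha>)) \<longlonglongrightarrow> exp (- t * \<eta> \<alpha>)"
      by (intro tendsto_intros lo)
    show "\<forall>\<^sub>F m in sequentially. ?g t \<le> exp (- (real (k m) / real m) * \<eta> \<alpha>)"
      using eventually_gt_at_top[of 0]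
    proof eventually_elim
      case (elim m)
      have "real (k m) / real m \<le> t" using k(1)[of m] elim by (simp add: field_simps)
      then show ?case unfolding laplace_rational[OF a elim, symmetric] by (intro laplace_antimono a) auto
    qed
  qed simp
  show "exp (- t * \<eta> \<alpha>) \<le> ?g t"
  proof (rule tendsto_upperbound)
    show "(\<lambda>m. exp (- (real (Suc (k m)) / real m) * \<eta> \<alpha>)) \<longlonglongrightarrow> exp (- t * \<eta> \<alpha>)"
      by (intro tendsto_intros up)
    show "\<forall>\<^sub>F m in sequentially. exp (- (real (Suc (k m)) / real m) * \<eta> \<alpha>) \<le> ?g t"
      using eventually_gt_at_top[of 0]
    proof eventually_elim
      case (elim m)
      have "t \<le> real (Suc (k m)) / real m" using k(2)[of m] elim by (simp add: field_simps)
      then show ?case unfolding laplace_rational[OF a elim, symmetric] by (intro laplace_antimono a t) auto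
    qed
  qed simp
qed

lemma exponent_nonneg: "0 \<le> \<alpha> \<Longrightarrow> 0 \<le> \<eta> \<alpha>"
  using laplace_antimono[of \<alpha> 0 1] laplace_eq[of \<alpha> 1] laplace_eq[of \<alpha> 0] by simp

lemma exponent_0: "\<eta> 0 = 0"
  by (simp add: laplace_exponent_def prob_space)

end

section \<open>Subordinators with finite mean\<close>

locale integrable_subordinator = subordinator_space +
  assumes int: "integrable M (J 1)"
begin

definition \<rho> :: real where "\<rho> = expectation (J 1)"

lemma rho_nonneg: "0 \<le> \<rho>"
  unfolding \<rho>_def using J_nonneg by (intro integral_nonneg_AE) auto

lemma integrable_J: "0 \<le> t \<Longrightarrow> t \<le> 1 \<Longrightarrow> integrable M (J t)"
  using J_mono J_nonneg measurable_J by (intro Bochner_Integration.integrable_bound[OF int]) (auto intro!: AE_I2)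

lemma expectation_J_inverse: assumes "0 < m" shows "expectation (J (1 / real m)) = \<rho> / real m"
proof -
  let ?h = "1 / real m"
  have h: "0 \<le> ?h" "?h \<le> 1" using assms by auto
  have ii: "integrable M (increment ?h i)" for i
  proof -
    have "integrable (distr M borel (increment ?h i)) (\<lambda>x. x)"
      unfolding distr_increment[OF h(1)] using integrable_J[OF h] measurable_J[OF h(1)]
      by (simp add: integrable_distr_eq)
    then show ?thesis using measurable_increment[OF h(1)] by (simp add: integrable_distr_eq)
  qed
  have "\<rho> = expectation (\<lambda>\<omega>. \<Sum>i<m. increment ?h i \<omega>)"
    unfolding \<rho>_def using assms by (intro Bochner_Integration.integral_cong refl) (simp add: sum_increment)
  also have "\<dots> = (\<Sum>i<m. expectation (increment ?h i))"
    using ii by (intro Bochner_Integration.integral_sum) auto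
  also have "\<dots> = real m * expectation (J ?h)"
    using expectation_increment[OF h(1), of "\<lambda>x. x"] by simp
  finally show ?thesis using assms by simp
qed

text \<open>Compare the transforms at the short time 1/m: their difference lies between 0 and (y -
  x) \<rho> / m. After multiplication by m it tends to the difference of the exponents, as a
  derivative at time 0.\<close>

lemma exponent_diff:
  assumes x: "0 \<le> x" "x \<le> y"
  shows "\<eta> x \<le> \<eta> y" and "\<eta> y - \<eta> x \<le> \<rho> * (y - x)"
proof -
  have 1: "0 \<le> exp (- (1 / real m) * \<eta> x) - exp (- (1 / real m) * \<eta> y) \<and>
      exp (- (1 / real m) * \<eta> x) - exp (- (1 / real m) * \<eta> y) \<le> (y - x) * (\<rho> / real m)" if m: "0 < m" for m
  proof -
    let ?h = "1 / real m"
    have h: "0 \<le> ?h" "?h \<le> 1" using m by auto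
    have y: "0 \<le> y" using x by simp
    have eq: "exp (- (1 / real m) * \<eta> x) - exp (- (1 / real m) * \<eta> y) =
        expectation (\<lambda>\<omega>. exp (- x * J ?h \<omega>) - exp (- y * J ?h \<omega>))"
      using laplace_eq[OF x(1) h(1)] laplace_eq[OF y h(1)]
      by (simp only: Bochner_Integration.integral_diff[OF integrable_exp[OF x(1) h(1)] integrable_exp[OF y h(1)]])
    have b: "0 \<le> exp (- x * z) - exp (- y * z)" "exp (- x * z) - exp (- y * z) \<le> (y - x) * z" if z: "0 \<le> z" for z
    proof -
      show "0 \<le> exp (- x * z) - exp (- y * z)" using x z by (simp add: mult_right_mono)
      have "exp (- x * z) - exp (- y * z) = exp (- x * z) * (1 - exp (- ((y - x) * z)))"
        by (simp add: algebra_simps exp_add[symmetric])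
      also have "\<dots> \<le> 1 * ((y - x) * z)"
        using x z exp_ge_add_one_self[of "- ((y - x) * z)"] by (intro mult_mono) auto
      finally show "exp (- x * z) - exp (- y * z) \<le> (y - x) * z" by simp
    qed
    have "expectation (\<lambda>\<omega>. exp (- x * J ?h \<omega>) - exp (- y * J ?h \<omega>)) \<le> expectation (\<lambda>\<omega>. (y - x) * J ?h \<omega>)"
      using x y h b(2) J_nonneg
      by (intro integral_mono Bochner_Integration.integrable_diff integrable_exp integrable_mult_right integrable_J) auto
    moreover have "0 \<le> expectation (\<lambda>\<omega>. exp (- x * J ?h \<omega>) - exp (- y * J ?h \<omega>))"
      using b(1) J_nonneg h by (intro integral_nonneg_AE AE_I2) auto
    ultimately show ?thesis
      unfolding eq using expectation_J_inverse[OF m] by simp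
  qed
  have lim: "(\<lambda>m. real m * (exp (- (1 / real m) * \<eta> x) - exp (- (1 / real m) * \<eta> y))) \<longlonglongrightarrow> \<eta> y - \<eta> x"
  proof -
    have "((\<lambda>h. (exp (- h * \<eta> x) - exp (- h * \<eta> y))) has_real_derivative \<eta> y - \<eta> x) (at 0)"
      by (auto intro!: derivative_eq_intros)
    then have "((\<lambda>h. (exp (- h * \<eta> x) - exp (- h * \<eta> y)) / h) \<longlongrightarrow> \<eta> y - \<eta> x) (at 0)"
      by (simp add: has_field_derivative_iff)
    moreover have "filterlim (\<lambda>m. 1 / real m) (at 0) sequentially"
      using lim_1_over_n eventually_gt_at_top[of "0::nat"]
      by (auto simp: filterlim_at elim!: eventually_mono)
    ultimately have "(\<lambda>m. (exp (- (1 / real m) * \<eta> x) - exp (- (1 / real m) * \<eta> y)) / (1 / real m)) \<longlonglongrightarrow> \<eta> y - \<eta> x"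
      by (rule filterlim_compose)
    then show ?thesis by (simp add: mult.commute)
  qed
  have "0 \<le> \<eta> y - \<eta> x"
  proof (rule tendsto_lowerbound[OF lim])
    show "\<forall>\<^sub>F m in sequentially. 0 \<le> real m * (exp (- (1 / real m) * \<eta> x) - exp (- (1 / real m) * \<eta> y))"
      using eventually_gt_at_top[of 0]
      by eventually_elim (rule mult_nonneg_nonneg[OF of_nat_0_le_iff conjunct1[OF 1]])
  qed simp
  then show "\<eta> x \<le> \<eta> y" by simp
  have "\<eta> y - \<eta> x \<le> (y - x) * \<rho>"
  proof (rule tendsto_upperbound[OF lim])
    show "\<forall>\<^sub>F m in sequentially. real m * (exp (- (1 / real m) * \<eta> x) - exp (- (1 / real m) * \<eta> y)) \<le> (y - x) * \<rho>"
      using eventually_gt_at_top[of 0]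
    proof eventually_elim
      case (elim m)
      have "real m * (exp (- (1 / real m) * \<eta> x) - exp (- (1 / real m) * \<eta> y)) \<le> real m * ((y - x) * (\<rho> / real m))"
        using 1[OF elim] by (intro mult_left_mono) auto
      then show ?case using elim by simp
    qed
  qed simp
  then show "\<eta> y - \<eta> x \<le> \<rho> * (y - x)" by (simp add: mult.commute)
qed

lemma exponent_le: "0 \<le> x \<Longrightarrow> \<eta> x \<le> \<rho> * x"
  using exponent_diff(2)[of 0 x] exponent_0 by simp

text \<open>From above, \<open>\<eta> x / x\<close> is at most \<rho>. From below, 1 - exp(-\<eta>)
  <= \<eta> bounds it by the mean of (1 - exp(-x J)) / x, where J is the input at time 1; dominated
  convergence gives \<rho> there as well.\<close>

lemma exponent_derivative_0: "(\<eta> has_real_derivative \<rho>) (at 0 within {0..})"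
proof -
  have "((\<lambda>x. \<eta> x / x) \<longlongrightarrow> \<rho>) (at 0 within {0..})"
  proof (rule tendsto_sandwich)
    show "\<forall>\<^sub>F x in at 0 within {0..}. expectation (\<lambda>\<omega>. (1 - exp (- x * J 1 \<omega>)) / x) \<le> \<eta> x / x"
      unfolding eventually_at_filter
    proof (intro always_eventually allI impI)
      fix x :: real assume "x \<noteq> 0" "x \<in> {0..}"
      then have x: "0 < x" by auto
      have "expectation (\<lambda>\<omega>. 1 - exp (- x * J 1 \<omega>)) = 1 - exp (- \<eta> x)"
        using x laplace_eq[of x 1] integrable_exp[of x 1] by (simp add: prob_space)
      also have "\<dots> \<le> \<eta> x" using exp_ge_add_one_self[of "- \<eta> x"] by simp
      finally show "expectation (\<lambda>\<omega>. (1 - exp (- x * J 1 \<omega>)) / x) \<le> \<eta> x / x"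
        using x by (simp add: divide_right_mono)
    qed
    show "\<forall>\<^sub>F x in at 0 within {0..}. \<eta> x / x \<le> \<rho>"
      using exponent_le by (auto simp: eventually_at_filter divide_le_eq)
    show "((\<lambda>x. expectation (\<lambda>\<omega>. (1 - exp (- x * J 1 \<omega>)) / x)) \<longlongrightarrow> \<rho>) (at 0 within {0..})"
      unfolding tendsto_at_iff_sequentially comp_def
    proof (intro allI impI)
      fix X :: "nat \<Rightarrow> real" assume X: "\<forall>i. X i \<in> {0..} - {0}" "X \<longlonglongrightarrow> 0"
      then have X0: "0 < X i" for i by (auto simp: less_le)
      show "(\<lambda>n. expectation (\<lambda>\<omega>. (1 - exp (- X n * J 1 \<omega>)) / X n)) \<longlonglongrightarrow> \<rho>"
        unfolding \<rho>_def
      proof (rule integral_dominated_convergence[OF _ _ int])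
        note [measurable] = measurable_J[of 1, simplified]
        show "J 1 \<in> borel_measurable M" by simp
        show "(\<lambda>\<omega>. (1 - exp (- X n * J 1 \<omega>)) / X n) \<in> borel_measurable M" for n by measurable
        show "AE \<omega> in M. norm ((1 - exp (- X n * J 1 \<omega>)) / X n) \<le> J 1 \<omega>" for n
        proof (rule AE_I2)
          fix \<omega> assume "\<omega> \<in> space M"
          then have "0 \<le> J 1 \<omega>" by (intro J_nonneg) auto
          moreover have "1 - exp (- X n * J 1 \<omega>) \<le> X n * J 1 \<omega>"
            using exp_ge_add_one_self[of "- X n * J 1 \<omega>"] by simp
          ultimately show "norm ((1 - exp (- X n * J 1 \<omega>)) / X n) \<le> J 1 \<omega>"
            using X0[of n] by (simp add: divide_le_eq mult.commute)
        qed
        show "AE \<omega> in M. (\<lambda>n. (1 - exp (- X n * J 1 \<omega>)) / X n) \<longlonglongrightarrow> J 1 \<omega>"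
        proof (rule AE_I2)
          fix \<omega>
          have "((\<lambda>x. 1 - exp (- x * J 1 \<omega>)) has_real_derivative J 1 \<omega>) (at 0)"
            by (auto intro!: derivative_eq_intros)
          then have "((\<lambda>x. (1 - exp (- x * J 1 \<omega>)) / x) \<longlongrightarrow> J 1 \<omega>) (at 0)"
            by (simp add: has_field_derivative_iff)
          moreover have "filterlim X (at 0) sequentially"
            using X X0 by (auto simp: filterlim_at less_imp_neq)
          ultimately show "(\<lambda>n. (1 - exp (- X n * J 1 \<omega>)) / X n) \<longlonglongrightarrow> J 1 \<omega>"
            by (rule filterlim_compose)
        qed
      qed
    qed
  qed simp
  then show ?thesis by (simp add: has_field_derivative_iff exponent_0)
qed

lemma AE_J_div_tendsto: "AE \<omega> in M. ((\<lambda>t. J t \<omega> / t) \<longlongrightarrow> \<rho>) at_top"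
proof -
  have eq: "distr M borel (increment 1 n) = distr M borel (increment 1 0)" for n
    by (simp add: distr_increment)
  have J1: "increment 1 0 \<omega> = J 1 \<omega>" if "\<omega> \<in> space M" for \<omega> using J_zero[OF that] by (simp add: increment_def)
  have "integrable M (increment 1 0)"
    using int by (subst Bochner_Integration.integrable_cong[OF refl J1]) auto
  then have "AE \<omega> in M. (\<lambda>n. (\<Sum>i<n. increment 1 i \<omega>) / n) \<longlonglongrightarrow> expectation (increment 1 0)"
    by (intro strong_law_of_large_numbers indep_increments_UNIV eq) simp
  then show ?thesis
  proof (rule AE_mp, intro AE_I2 impI)
    fix \<omega> assume \<omega>: "\<omega> \<in> space M"
      and lim: "(\<lambda>n. (\<Sum>i<n. increment 1 i \<omega>) / n) \<longlonglongrightarrow> expectation (increment 1 0)"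
    have "expectation (increment 1 0) = \<rho>"
      unfolding \<rho>_def by (intro Bochner_Integration.integral_cong J1 refl)
    with lim have "(\<lambda>n. J (real n) \<omega> / real n) \<longlonglongrightarrow> \<rho>" using sum_increment[OF \<omega>, of 1] by simp
    \<comment> \<open>The squares are the subsequence from which
      \<open>mono_div_tendsto_at_top\<close> recovers all times.\<close>
    from LIMSEQ_subseq_LIMSEQ[OF this, of "\<lambda>n. n\<^sup>2"]
    have "(\<lambda>n. J ((real n)\<^sup>2) \<omega> / (real n)\<^sup>2) \<longlonglongrightarrow> \<rho>"
      by (simp add: strict_mono_def o_def power_strict_mono)
    then show "((\<lambda>t. J t \<omega> / t) \<longlongrightarrow> \<rho>) at_top"
      by (intro mono_div_tendsto_at_top) (auto intro!: J_nonneg J_mono \<omega> mono_onI)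
  qed
qed

end

text \<open>With p = exp(-x), a variable in [0,1] of mean p has variance at most p (1 - p) <= 1 - p
  <= x. With x proportional to the mesh, sums of such terms have second moments linear in the
  horizon.\<close>

lemma (in prob_space) variance_unit_interval_le:
  fixes Y :: "'a \<Rightarrow> real"
  assumes [measurable]: "Y \<in> borel_measurable M" and Y: "\<And>\<omega>. \<omega> \<in> space M \<Longrightarrow> 0 \<le> Y \<omega> \<and> Y \<omega> \<le> 1"
    and E: "expectation Y = exp (- x)"
  shows "expectation (\<lambda>\<omega>. (Y \<omega> - exp (- x))\<^sup>2) \<le> x"
proof -
  have iY: "integrable M Y" using Y by (intro integrable_const_bound[of _ 1]) auto
  have i2: "integrable M (\<lambda>\<omega>. (Y \<omega>)\<^sup>2)" using Y by (intro integrable_const_bound[of _ 1]) (auto simp: power_le_one)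
  have "expectation (\<lambda>\<omega>. (Y \<omega> - exp (- x))\<^sup>2) = expectation (\<lambda>\<omega>. (Y \<omega>)\<^sup>2) - (exp (- x))\<^sup>2"
    unfolding E[symmetric] by (rule variance_eq[OF iY i2])
  also have "expectation (\<lambda>\<omega>. (Y \<omega>)\<^sup>2) \<le> expectation Y"
    using Y by (intro integral_mono i2 iY) (auto simp: power2_eq_square mult_left_le)
  finally have "expectation (\<lambda>\<omega>. (Y \<omega> - exp (- x))\<^sup>2) \<le> exp (- x) * (1 - exp (- x))"
    by (simp add: E algebra_simps power2_eq_square)
  also
  have "exp (- x) \<le> 1"
    using integral_mono[OF iY, of "\<lambda>_. 1"] Y by (simp add: E prob_space)
  then have "exp (- x) * (1 - exp (- x)) \<le> 1 * (1 - exp (- x))" by (intro mult_right_mono) auto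
  also have "\<dots> \<le> x" using exp_ge_add_one_self[of "- x"] by simp
  finally show ?thesis .
qed

lemma input_path_add:
  assumes "input_path F" "input_path G"
  shows "input_path (\<lambda>s. F s + G s)"
proof -
  interpret F: input_path F by fact
  interpret G: input_path G by fact
  show ?thesis
    by standard (auto intro!: add_mono F.mono G.mono continuous_add F.right_cont G.right_cont simp: F.zero G.zero)
qed

section \<open>Sample paths of a subordinator and their drift\<close>

context subordinator_space
begin

text \<open>Freezing the process at its initial value on negative times makes each path increasing
  on the whole line, as its Stieltjes measure requires.\<close>

definition path :: "'a \<Rightarrow> real \<Rightarrow> real" where "path \<omega> s = J (max 0 s) \<omega>"

lemma path_eq: "0 \<le> s \<Longrightarrow> path \<omega> s = J s \<omega>"
  by (simp add: path_def)

lemma input_path_path: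
  assumes \<omega>: "\<omega> \<in> space M" shows "input_path (path \<omega>)"
proof
  show "path \<omega> x \<le> path \<omega> y" if "x \<le> y" for x y
    using that unfolding path_def by (intro J_mono \<omega>) auto
  show "continuous (at_right x) (path \<omega>)" for x
  proof (cases "0 \<le> x")
    case True
    have "((\<lambda>s. J s \<omega>) \<longlongrightarrow> J x \<omega>) (at_right x)"
      using J_right_cont[OF \<omega> True] by (simp add: continuous_within)
    then have "(path \<omega> \<longlongrightarrow> J x \<omega>) (at_right x)"
      by (rule Lim_transform_eventually) (use True in \<open>auto simp: eventually_at_filter path_def\<close>)
    then show ?thesis using True by (simp add: continuous_within path_def)
  next
    case False
    have "\<forall>\<^sub>F s in at_right x. path \<omega> s = path \<omega> x"
      unfolding eventually_at_right[of x 0, simplified] using False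
      by (auto simp: path_def eventually_at_right[of x 0] intro!: exI[of _ 0])
    then show ?thesis by (simp add: continuous_within tendsto_eventually)
  qed
  show "path \<omega> 0 = 0" by (simp add: path_def J_zero \<omega>)
qed

lemma path_grid: "0 \<le> h \<Longrightarrow> path \<omega> (real (Suc i) * h) - path \<omega> (real i * h) = increment h i \<omega>"
  by (simp add: path_eq increment_def)

lemma expectation_exp_increment:
  "0 \<le> \<alpha> \<Longrightarrow> 0 \<le> h \<Longrightarrow> expectation (\<lambda>\<omega>. exp (- \<alpha> * increment h i \<omega>)) = exp (- h * \<eta> \<alpha>)"
  using expectation_increment[of h "\<lambda>x. exp (- \<alpha> * x)"] by (simp add: laplace_eq[simplified])

text \<open>For the Laplace argument k, the limit \<open>g k\<close> of the centred grid sums has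
  second moment at most \<open>t * \<eta> (real k)\<close>, hence at most t R k. So g k / k has
  second moment at most t R / k, while pathwise it tends to c t minus the jump-free mass. By Fatou
  this difference vanishes almost surely.\<close>

lemma AE_continuous_part:
  assumes \<eta>_le: "\<And>k::nat. \<eta> (real k) \<le> R * real k"
    and drift: "(\<lambda>k. \<eta> (real k) / real k) \<longlonglongrightarrow> c" and t: "0 < t"
  shows "AE \<omega> in M. (LINT s:{0<..t}|interval_measure (path \<omega>). indicator {s. jump (path \<omega>) s = 0} s) = c * t"
proof -
  \<comment> \<open>Increments are nonnegative on the space; \<open>max 0\<close> only makes the
    summand bounded as a function on the whole line.\<close>
  define f where "f k m \<omega> = (\<Sum>i<m. 1 * (exp (- real k * max 0 (increment (t / real m) i \<omega>)) - exp (- (t / real m) * \<eta> (real k))))"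
    for k m :: nat and \<omega>
  define g where "g k \<omega> = t * \<eta> (real k) - (LINT s:{0<..t}|interval_measure (path \<omega>). 1 * exp_slope (real k) (jump (path \<omega>) s))"
    for k :: nat and \<omega>
  have [measurable]: "increment (t / real m) i \<in> borel_measurable M" for i m
    using t by (intro measurable_increment) simp
  have meas: "f k m \<in> borel_measurable M" for k m
    unfolding f_def by measurable
  have bound: "(\<integral>\<^sup>+\<omega>. ennreal ((f k m \<omega>)\<^sup>2) \<partial>M) \<le> ennreal (t * \<eta> (real k))" for k m
  proof -
    let ?h = "t / real m"
    define H where "H x = exp (- real k * max 0 x) - exp (- ?h * \<eta> (real k))" for x
    have h: "0 \<le> ?h" using t by simp
    have inc: "max 0 (increment ?h i \<omega>) = increment ?h i \<omega>" if "\<omega> \<in> space M" for i \<omega>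
      using increment_nonneg[OF h that, of i] by simp
    have E: "expectation (\<lambda>\<omega>. exp (- real k * max 0 (increment ?h i \<omega>))) = exp (- (?h * \<eta> (real k)))" for i
    proof -
      have "expectation (\<lambda>\<omega>. exp (- real k * max 0 (increment ?h i \<omega>))) = expectation (\<lambda>\<omega>. exp (- real k * increment ?h i \<omega>))"
        by (intro Bochner_Integration.integral_cong refl) (simp only: inc)
      then show ?thesis using expectation_exp_increment[of "real k" ?h i] h by simp
    qed
    have iE: "integrable M (\<lambda>\<omega>. exp (- real k * max 0 (increment ?h i \<omega>)))" for i
      using measurable_increment[OF h, of i] by (intro integrable_const_bound[of _ 1]) auto
    note sm = second_moment_martingale_sum[where X = "increment ?h" and F = "\<lambda>_ _. 1" and H = H and n = m
        and C = 1 and v = "?h * \<eta> (real k)", OF indep_increments[OF h]]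
    have H1: "H \<in> borel_measurable borel" unfolding H_def by simp
    have e1: "exp (- ?h * \<eta> (real k)) \<le> 1" using mult_nonneg_nonneg[OF h exponent_nonneg[of "real k"]] by simp
    have H2: "\<bar>H x\<bar> \<le> 1" for x
    proof -
      have "exp (- real k * max 0 x) \<le> 1" by simp
      then show ?thesis
        using e1 exp_gt_zero[of "- ?h * \<eta> (real k)"] exp_gt_zero[of "- real k * max 0 x"] unfolding H_def by linarith
    qed
    have H3: "expectation (\<lambda>\<omega>. H (increment ?h i \<omega>)) = 0" for i
      unfolding H_def using E[of i] iE[of i] by (simp add: prob_space)
    have H4: "expectation (\<lambda>\<omega>. (H (increment ?h i \<omega>))\<^sup>2) \<le> ?h * \<eta> (real k)" for i
      using variance_unit_interval_le[OF _ _ E[of i]] measurable_increment[OF h, of i]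
      by (simp add: H_def)
    have fH: "f k m \<omega> = (\<Sum>i<m. 1 * H (increment ?h i \<omega>))" for \<omega> by (simp add: f_def H_def)
    have "expectation (\<lambda>\<omega>. (f k m \<omega>)\<^sup>2) \<le> real m * (?h * \<eta> (real k))"
      unfolding fH by (intro sm(2) H1 H2 H3 H4) auto
    moreover have i: "integrable M (\<lambda>\<omega>. (f k m \<omega>)\<^sup>2)"
      unfolding fH by (intro sm(1) H1 H2 H3 H4) auto
    moreover have "real m * (?h * \<eta> (real k)) \<le> t * \<eta> (real k)"
      using t exponent_nonneg[of "real k"] by (cases "m = 0") auto
    ultimately have "expectation (\<lambda>\<omega>. (f k m \<omega>)\<^sup>2) \<le> t * \<eta> (real k)" by linarith
    with i show ?thesis by (subst nn_integral_eq_integral) (auto intro: ennreal_leI)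
  qed
  have lim: "(\<lambda>m. f k m \<omega>) \<longlonglongrightarrow> g k \<omega>" if \<omega>: "\<omega> \<in> space M" for k \<omega>
  proof -
    interpret p: input_path "path \<omega>" by (rule input_path_path[OF \<omega>])
    have 1: "(\<lambda>m. \<Sum>i<m. 1 * (1 - exp (- real k * (path \<omega> (real (Suc i) * (t / real m)) - path \<omega> (real i * (t / real m))))))
      \<longlonglongrightarrow> (LINT s:{0<..t}|interval_measure (path \<omega>). 1 * exp_slope (real k) (jump (path \<omega>) s))"
      by (rule p.grid_sum_tendsto) (use t in auto)
    \<comment> \<open>At b = 0 all weights are 1, so this is the plain sum of the centring
      terms.\<close>
    have 2: "(\<lambda>m. \<Sum>i<m. p.weight 0 t m i * (1 - exp (- \<eta> (real k) * (t / m)))) \<longlonglongrightarrow> \<eta> (real k) * t"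
      using p.weight_sum_tendsto[OF t order_refl exponent_nonneg[of "real k"]] t
      by (simp add: set_lebesgue_integral_def)
    have "f k m \<omega> = (\<Sum>i<m. p.weight 0 t m i * (1 - exp (- \<eta> (real k) * (t / m)))) -
        (\<Sum>i<m. 1 * (1 - exp (- real k * (path \<omega> (real (Suc i) * (t / real m)) - path \<omega> (real i * (t / real m))))))" for m
    proof -
      have h: "0 \<le> t / real m" using t by simp
      have "max 0 (increment (t / real m) i \<omega>) = increment (t / real m) i \<omega>" for i
        using increment_nonneg[OF h \<omega>, of i] by simp
      then show ?thesis
        unfolding path_grid[OF h] f_def p.weight_def sum_subtractf[symmetric]
        by (intro sum.cong refl) (simp add: mult.commute)
    qed
    then show ?thesis
      using tendsto_diff[OF 2 1] by (simp add: g_def mult.commute)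
  qed
  have "\<exists>q. q \<in> borel_measurable M \<and> (\<integral>\<^sup>+\<omega>. q \<omega> \<partial>M) \<le> ennreal (t * \<eta> (real k)) \<and>
      (AE \<omega> in M. q \<omega> = ennreal ((g k \<omega>)\<^sup>2))" for k
    by (rule nn_integral_square_limit_le[where f = "f k" and g = "g k", OF meas bound]) (auto intro: lim)
  then obtain q where q[measurable]: "\<And>k. q k \<in> borel_measurable M"
    and qb: "\<And>k. (\<integral>\<^sup>+\<omega>. q k \<omega> \<partial>M) \<le> ennreal (t * \<eta> (real k))"
    and qg: "\<And>k. AE \<omega> in M. q k \<omega> = ennreal ((g k \<omega>)\<^sup>2)"
    by metis
  let ?r = "\<lambda>k \<omega>. ennreal (1 / (real (Suc k))\<^sup>2) * q (Suc k) \<omega>"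
  have "(\<integral>\<^sup>+\<omega>. liminf (\<lambda>k. ?r k \<omega>) \<partial>M) \<le> liminf (\<lambda>k. \<integral>\<^sup>+\<omega>. ?r k \<omega> \<partial>M)"
    by (rule nn_integral_liminf) simp
  also have "\<dots> \<le> liminf (\<lambda>k. ennreal (t * R * (1 / real (Suc k))))"
  proof (rule Liminf_mono, intro always_eventually allI)
    fix k
    have "(\<integral>\<^sup>+\<omega>. ?r k \<omega> \<partial>M) \<le> ennreal (1 / (real (Suc k))\<^sup>2) * ennreal (t * \<eta> (real (Suc k)))"
      by (subst nn_integral_cmult) (auto intro!: mult_left_mono qb simp del: of_nat_Suc)
    also have "\<dots> = ennreal (1 / (real (Suc k))\<^sup>2 * (t * \<eta> (real (Suc k))))"
      using t exponent_nonneg[of "real (Suc k)"] by (subst ennreal_mult) auto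
    also have "\<dots> \<le> ennreal (1 / (real (Suc k))\<^sup>2 * (t * (R * real (Suc k))))"
      using t \<eta>_le[of "Suc k"] by (intro ennreal_leI mult_left_mono) auto
    also have "1 / (real (Suc k))\<^sup>2 * (t * (R * real (Suc k))) = t * R * (1 / real (Suc k))"
      by (simp add: power2_eq_square del: of_nat_Suc)
    finally show "(\<integral>\<^sup>+\<omega>. ?r k \<omega> \<partial>M) \<le> ennreal (t * R * (1 / real (Suc k)))" .
  qed
  also have "liminf (\<lambda>k. ennreal (t * R * (1 / real (Suc k)))) = ennreal (t * R * 0)"
    by (intro lim_imp_Liminf tendsto_ennrealI tendsto_mult tendsto_const LIMSEQ_Suc[OF lim_1_over_n]) simp
  finally have "AE \<omega> in M. liminf (\<lambda>k. ?r k \<omega>) = 0"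
    by (subst nn_integral_0_iff_AE[symmetric]) auto
  moreover have "AE \<omega> in M. \<forall>k. q k \<omega> = ennreal ((g k \<omega>)\<^sup>2)"
    using qg by (simp add: AE_all_countable)
  ultimately show ?thesis
  proof (rule AE_mp[OF AE_conjI], intro AE_I2 impI, elim conjE)
    fix \<omega> assume \<omega>: "\<omega> \<in> space M" and 0: "liminf (\<lambda>k. ?r k \<omega>) = 0"
      and q: "\<forall>k. q k \<omega> = ennreal ((g k \<omega>)\<^sup>2)"
    interpret p: input_path "path \<omega>" by (rule input_path_path[OF \<omega>])
    let ?C = "LINT s:{0<..t}|interval_measure (path \<omega>). indicator {s. jump (path \<omega>) s = 0} s"
    have "(\<lambda>k. (LINT s|p.\<mu>. indicat_real {0<..t} s *\<^sub>R (exp_slope (real k) (jump (path \<omega>) s) / real k)))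
        \<longlonglongrightarrow> (LINT s|p.\<mu>. indicat_real {0<..t} s *\<^sub>R (indicator {s. jump (path \<omega>) s = 0} s))"
    proof (rule integral_dominated_convergence)
      show "integrable p.\<mu> (indicat_real {0<..t})" by (rule p.integrable_Ioc)
      show "AE s in p.\<mu>. (\<lambda>k. indicat_real {0<..t} s *\<^sub>R (exp_slope (real k) (jump (path \<omega>) s) / real k))
          \<longlonglongrightarrow> indicat_real {0<..t} s *\<^sub>R (indicator {s. jump (path \<omega>) s = 0} s)"
      proof (intro AE_I2 tendsto_scaleR tendsto_const)
        fix s
        show "(\<lambda>k. exp_slope (real k) (jump (path \<omega>) s) / real k) \<longlonglongrightarrow> indicator {s. jump (path \<omega>) s = 0} s"
          using exp_slope_div_tendsto[OF p.jump_nonneg[of s]] by (simp add: indicator_def of_bool_def)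
      qed
      show "AE s in p.\<mu>. norm (indicat_real {0<..t} s *\<^sub>R (exp_slope (real k) (jump (path \<omega>) s) / real k)) \<le> indicat_real {0<..t} s" for k
      proof (rule AE_I2)
        fix s
        have "exp_slope (real k) (jump (path \<omega>) s) \<le> real k" "0 \<le> exp_slope (real k) (jump (path \<omega>) s)"
          by (intro exp_slope_le exp_slope_nonneg p.jump_nonneg; simp)+
        then show "norm (indicat_real {0<..t} s *\<^sub>R (exp_slope (real k) (jump (path \<omega>) s) / real k)) \<le> indicat_real {0<..t} s"
          by (auto simp: indicator_def divide_le_eq)
      qed
    qed measurable
    then have "(\<lambda>k. (LINT s:{0<..t}|p.\<mu>. 1 * exp_slope (real k) (jump (path \<omega>) s)) / real k) \<longlonglongrightarrow> ?C"
      by (simp add: set_lebesgue_integral_def)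
    from tendsto_diff[OF tendsto_mult[OF tendsto_const drift, of t] this]
    have "(\<lambda>k. g k \<omega> / real k) \<longlonglongrightarrow> t * c - ?C"
      by (simp add: g_def diff_divide_distrib)
    then have "(\<lambda>k. ennreal ((g (Suc k) \<omega> / real (Suc k))\<^sup>2)) \<longlonglongrightarrow> ennreal ((t * c - ?C)\<^sup>2)"
      by (intro tendsto_ennrealI tendsto_power LIMSEQ_Suc)
    then have "liminf (\<lambda>k. ennreal ((g (Suc k) \<omega> / real (Suc k))\<^sup>2)) = ennreal ((t * c - ?C)\<^sup>2)"
      by (intro lim_imp_Liminf) simp
    moreover have "ennreal ((g (Suc k) \<omega> / real (Suc k))\<^sup>2) = ?r k \<omega>" for k
      using q by (simp add: power_divide ennreal_mult[symmetric] del: of_nat_Suc)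
    ultimately have "ennreal ((t * c - ?C)\<^sup>2) = 0" using 0 by simp
    then show "?C = c * t" by (simp add: ennreal_eq_0_iff mult.commute)
  qed
qed

end

text \<open>For k >= 1 and x > 0 the quotient (1 - exp(-k x)) / k is at most min(1, x), which the
  Levy measure integrates, and it tends to 0. Only the drift survives the division by k.\<close>

lemma tendsto_laplace_exponent_div_drift:
  assumes "has_drift_levy_measure M J c \<nu>"
  shows "(\<lambda>k. laplace_exponent M J (real k) / real k) \<longlonglongrightarrow> c"
proof -
  have sets[measurable_cong]: "sets \<nu> = sets borel"
    and fin: "(\<integral>\<^sup>+x\<in>{0<..}. ennreal (min 1 x) \<partial>\<nu>) < \<infinity>"
    and eq: "\<And>\<alpha>. 0 \<le> \<alpha> \<Longrightarrow> laplace_exponent M J \<alpha> = c * \<alpha> + (LINT x:{0<..}|\<nu>. 1 - exp (- \<alpha> * x))"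
    using assms by (auto simp: has_drift_levy_measure_def)
  let ?f = "\<lambda>x::real. indicator {0<..} x * min 1 x"
  have int: "integrable \<nu> ?f"
  proof (rule integrableI_nonneg)
    show "AE x in \<nu>. 0 \<le> ?f x" by (auto simp: indicator_def)
    have "(\<integral>\<^sup>+x. ennreal (?f x) \<partial>\<nu>) = (\<integral>\<^sup>+x\<in>{0<..}. ennreal (min 1 x) \<partial>\<nu>)"
      by (intro nn_integral_cong) (auto simp: indicator_def)
    with fin show "(\<integral>\<^sup>+x. ennreal (?f x) \<partial>\<nu>) < \<infinity>" by simp
  qed measurable
  let ?u = "\<lambda>k x. indicator {0<..} x *\<^sub>R ((1 - exp (- real k * x)) / real k)"
  have lim: "(\<lambda>k. LINT x|\<nu>. ?u k x) \<longlonglongrightarrow> (LINT x|\<nu>. 0)"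
  proof (rule integral_dominated_convergence[OF _ _ int])
    show "AE x in \<nu>. norm (?u k x) \<le> ?f x" for k
    proof (rule AE_I2)
      fix x :: real
      have "(1 - exp (- real k * x)) / real k \<le> min 1 x" if x: "0 < x"
      proof (cases "k = 0")
        case False
        have "1 - exp (- real k * x) \<le> real k * x" using exp_ge_add_one_self[of "- real k * x"] by simp
        moreover have "1 \<le> real k" using False by simp
        then have "1 - exp (- real k * x) \<le> real k"
          using exp_gt_zero[of "- real k * x"] by linarith
        ultimately show ?thesis using x by (simp add: divide_le_eq mult.commute)
      qed (use x in simp)
      then show "norm (?u k x) \<le> ?f x" by (auto simp: indicator_def)
    qed
    show "AE x in \<nu>. (\<lambda>k. ?u k x) \<longlonglongrightarrow> 0"
    proof (rule AE_I2)
      fix x :: real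
      show "(\<lambda>k. ?u k x) \<longlonglongrightarrow> 0"
      proof (rule Lim_null_comparison[OF always_eventually lim_1_over_n], rule allI)
        fix k show "norm (?u k x) \<le> 1 / real k"
          by (auto simp: indicator_def intro!: divide_right_mono)
      qed
    qed
  qed measurable
  have "(\<lambda>k. c + (LINT x|\<nu>. ?u k x)) \<longlonglongrightarrow> c"
    using tendsto_add[OF tendsto_const lim, of c] by simp
  then show ?thesis
  proof (rule Lim_transform_eventually)
    show "\<forall>\<^sub>F k in sequentially. c + (LINT x|\<nu>. ?u k x) = laplace_exponent M J (real k) / real k"
      using eventually_gt_at_top[of 0]
      by eventually_elim (simp add: eq set_lebesgue_integral_def add_divide_distrib)
  qed
qed

section \<open>The Kella--Whitt martingale\<close>

context input_path
begin

text \<open>A statement about a single path. The idle time is at least t - F t, of order (1 - r) t;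
  conversely every s - F s with s <= t is at most slightly above (1 - r) t, apart from early
  times.\<close>

lemma idle_time_div_tendsto:
  assumes lim: "((\<lambda>t. F t / t) \<longlongrightarrow> r) at_top" and r: "r < 1"
  shows "((\<lambda>t. idle_time F t / t) \<longlongrightarrow> 1 - r) at_top"
proof (rule tendstoI)
  fix e :: real assume e: "0 < e"
  define d where "d = min e (1 - r) / 2"
  have d: "0 < d" "d < e" "d < 1 - r" using e r by (auto simp: d_def min_def)
  have "\<forall>\<^sub>F t in at_top. dist (F t / t) r < d" using lim d(1) by (rule tendstoD)
  then obtain T0 where T0: "\<And>t. T0 \<le> t \<Longrightarrow> \<bar>F t / t - r\<bar> < d"
    by (auto simp: eventually_at_top_linorder dist_real_def)
  define T where "T = max 1 T0"
  have T: "\<bar>F t - r * t\<bar> \<le> d * t" if "T \<le> t" for t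
  proof -
    have "1 \<le> t" "T0 \<le> t" using that by (auto simp: T_def)
    then have "\<bar>F t / t - r\<bar> * t \<le> d * t" using T0[of t] by (intro mult_right_mono) auto
    also have "\<bar>F t / t - r\<bar> * t = \<bar>F t - r * t\<bar>"
      using \<open>1 \<le> t\<close> abs_mult_pos[of t "F t / t - r"] by (simp add: left_diff_distrib)
    finally show ?thesis .
  qed
  \<comment> \<open>The second condition absorbs the early times: for s < T the deficit s - F s is
    below T, hence below (1 - r + d) t.\<close>
  have "\<forall>\<^sub>F t in at_top. T \<le> t \<and> T / (1 - r + d) \<le> t"
    by (intro eventually_conj eventually_ge_at_top)
  then show "\<forall>\<^sub>F t in at_top. dist (idle_time F t / t) (1 - r) < e"
  proof eventually_elim
    case (elim t)
    then have t: "0 < t" by (auto simp: T_def)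
    have Tt: "T \<le> (1 - r + d) * t" using elim d by (simp add: divide_le_eq mult.commute)
    have "(1 - r - d) * t \<le> t - F t" using T[of t] elim by (auto simp: algebra_simps abs_le_iff)
    also have "\<dots> \<le> idle_time F t" using t by (intro idle_time_ge) auto
    finally have lo: "(1 - r - d) * t \<le> idle_time F t" .
    have up: "idle_time F t \<le> (1 - r + d) * t"
    proof (rule idle_time_le)
      fix s assume s: "0 \<le> s" "s \<le> t"
      show "s - F s \<le> (1 - r + d) * t"
      proof (cases "T \<le> s")
        case True
        have "s - F s \<le> (1 - r + d) * s" using T[OF True] by (auto simp: algebra_simps abs_le_iff)
        also have "\<dots> \<le> (1 - r + d) * t" using s d by (intro mult_left_mono) auto
        finally show ?thesis .
      qed (use nonneg[OF s(1)] Tt in linarith)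
    qed (use t d in auto)
    have "\<bar>idle_time F t / t - (1 - r)\<bar> \<le> d"
      using lo up t by (auto simp: abs_le_iff field_simps)
    then show ?case using d by (simp add: dist_real_def)
  qed
qed

end

section \<open>The joint increments of two independent inputs\<close>

locale two_inputs = prob_space M + A: integrable_subordinator M J1 + B: integrable_subordinator M J2
  for M :: "'a measure" and J1 J2 :: "real \<Rightarrow> 'a \<Rightarrow> real" +
  assumes indep: "independent_processes M J1 J2"
    and stable: "A.\<rho> + B.\<rho> < 1"
begin

lemma indep_functionals:
  assumes "f \<in> Pi\<^sub>M {0..} (\<lambda>_. borel) \<rightarrow>\<^sub>M N1" "g \<in> Pi\<^sub>M {0..} (\<lambda>_. borel) \<rightarrow>\<^sub>M N2"
  shows "indep_var N1 (\<lambda>\<omega>. f (\<lambda>t\<in>{0..}. J1 t \<omega>)) N2 (\<lambda>\<omega>. g (\<lambda>t\<in>{0..}. J2 t \<omega>))"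
  using indep_var_compose[OF indep[unfolded independent_processes_def] assms] by (simp add: o_def)

lemma measurable_increment_functional:
  assumes "0 \<le> h"
  shows "(\<lambda>u. u (real (Suc i) * h) - u (real i * h)) \<in> Pi\<^sub>M {0..} (\<lambda>_. borel) \<rightarrow>\<^sub>M (borel :: real measure)"
  using assms by (intro borel_measurable_diff measurable_component_singleton) auto

definition increments :: "real \<Rightarrow> nat \<Rightarrow> 'a \<Rightarrow> real \<times> real" where
  "increments h i \<omega> = (A.increment h i \<omega>, B.increment h i \<omega>)"

text \<open>Independence of the two processes factors an event about finitely many increments into
  its class 1 and class 2 parts, and independent increments factor each part. The resulting family
  indexed by class and cell is then grouped by cell.\<close>

lemma indep_increment_pairs:
  assumes h: "0 \<le> h"
  shows "indep_vars (\<lambda>_. borel \<Otimes>\<^sub>M borel) (increments h) {..<n}"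
proof -
  define Y where "Y = (\<lambda>(b, i). if b then A.increment h i else B.increment h i)"
  have Ym: "Y j \<in> borel_measurable M" for j
    using A.measurable_increment[OF h] B.measurable_increment[OF h] by (auto simp: Y_def split: prod.split)
  have "indep_vars (\<lambda>_. borel) Y (UNIV \<times> {..<n})"
    unfolding indep_vars_def2
  proof (intro conjI ballI)
    show "indep_sets (\<lambda>j. {Y j -` A \<inter> space M |A. A \<in> sets borel}) (UNIV \<times> {..<n})"
    proof (rule indep_setsI)
      fix A K assume K: "K \<noteq> {}" "K \<subseteq> UNIV \<times> {..<n}" "finite K"
        and "\<forall>j\<in>K. A j \<in> {Y j -` A \<inter> space M |A. A \<in> sets borel}"
      then obtain E where E: "\<And>j. j \<in> K \<Longrightarrow> E j \<in> sets borel" "\<And>j. j \<in> K \<Longrightarrow> A j = Y j -` E j \<inter> space M"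
        by (simp add: Bex_def) metis
      define K1 K2 where "K1 = {i. (True, i) \<in> K}" and "K2 = {i. (False, i) \<in> K}"
      have KU: "K = Pair True ` K1 \<union> Pair False ` K2"
      proof (rule set_eqI)
        fix j show "j \<in> K \<longleftrightarrow> j \<in> Pair True ` K1 \<union> Pair False ` K2"
          by (cases j; cases "fst j") (auto simp: K1_def K2_def)
      qed
      have fin: "finite K1" "finite K2"
        using K(3) by (auto simp: K1_def K2_def intro: finite_vimageI[of K "Pair _", unfolded vimage_def] inj_onI)
      have sub: "K1 \<subseteq> {..<n}" "K2 \<subseteq> {..<n}" using K(2) by (auto simp: K1_def K2_def)
      \<comment> \<open>Written on whole paths, so that the independence of the processes, which is
        formulated for path-valued variables, applies to it.\<close>
      define ev where "ev b L u \<longleftrightarrow> (\<forall>i\<in>L. u (real (Suc i) * h) - u (real i * h) \<in> E (b, i))"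
        for b and L :: "nat set" and u :: "real \<Rightarrow> real"
      have evm: "Measurable.pred (Pi\<^sub>M {0..} (\<lambda>_. borel)) (ev b L)" if "finite L" "\<And>i. i \<in> L \<Longrightarrow> (b, i) \<in> K" for b L
        unfolding ev_def using that measurable_increment_functional[OF h] E(1)
        by (intro pred_intros_finite pred_sets2[where N = borel]) auto
      have e1: "Measurable.pred (Pi\<^sub>M {0..} (\<lambda>_. borel)) (ev True K1)"
        and e2: "Measurable.pred (Pi\<^sub>M {0..} (\<lambda>_. borel)) (ev False K2)"
        by (rule evm; use fin in \<open>auto simp: K1_def K2_def\<close>)+
      let ?J1 = "\<lambda>\<omega>. \<lambda>t\<in>{0..}. J1 t \<omega>" and ?J2 = "\<lambda>\<omega>. \<lambda>t\<in>{0..}. J2 t \<omega>"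
      have ev1: "ev True K1 (?J1 \<omega>) \<longleftrightarrow> (\<forall>i\<in>K1. A.increment h i \<omega> \<in> E (True, i))"
        and ev2: "ev False K2 (?J2 \<omega>) \<longleftrightarrow> (\<forall>i\<in>K2. B.increment h i \<omega> \<in> E (False, i))" for \<omega>
        using h by (auto simp: ev_def A.increment_def B.increment_def)
      have iv: "indep_var (count_space UNIV) (\<lambda>\<omega>. ev True K1 (?J1 \<omega>)) (count_space UNIV) (\<lambda>\<omega>. ev False K2 (?J2 \<omega>))"
        by (rule indep_functionals[OF e1 e2])
      have "(\<Inter>j\<in>K. A j) = {\<omega> \<in> space M. \<forall>j\<in>K. Y j \<omega> \<in> E j}"
        using K(1) E(2) by auto
      also have "(\<forall>j\<in>K. Y j \<omega> \<in> E j) \<longleftrightarrow> ev True K1 (?J1 \<omega>) \<and> ev False K2 (?J2 \<omega>)" for \<omega>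
        unfolding ev1 ev2 by (simp add: KU ball_Un Y_def)
      then have "{\<omega> \<in> space M. \<forall>j\<in>K. Y j \<omega> \<in> E j} = (\<lambda>\<omega>. (ev True K1 (?J1 \<omega>), ev False K2 (?J2 \<omega>))) -` ({True} \<times> {True}) \<inter> space M"
        by auto
      finally have "prob (\<Inter>j\<in>K. A j) =
          prob ((\<lambda>\<omega>. ev True K1 (?J1 \<omega>)) -` {True} \<inter> space M) * prob ((\<lambda>\<omega>. ev False K2 (?J2 \<omega>)) -` {True} \<inter> space M)"
        by (simp only:) (rule indep_varD[OF iv], auto)
      also have "prob ((\<lambda>\<omega>. ev True K1 (?J1 \<omega>)) -` {True} \<inter> space M) = (\<Prod>i\<in>K1. prob (A (True, i)))"
      proof (cases "K1 = {}")
        case False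
        have "prob (\<Inter>i\<in>K1. A.increment h i -` E (True, i) \<inter> space M) = (\<Prod>i\<in>K1. prob (A.increment h i -` E (True, i) \<inter> space M))"
          using A.indep_increments[OF h, of n] False fin sub E(1)
          by (intro indep_varsD[where I = "{..<n}" and M' = "\<lambda>_. borel"]) (auto simp: K1_def)
        also have "(\<Inter>i\<in>K1. A.increment h i -` E (True, i) \<inter> space M) = (\<lambda>\<omega>. ev True K1 (?J1 \<omega>)) -` {True} \<inter> space M"
          using False unfolding vimage_def by (auto simp: ev1)
        also have "(\<Prod>i\<in>K1. prob (A.increment h i -` E (True, i) \<inter> space M)) = (\<Prod>i\<in>K1. prob (A (True, i)))"
          by (intro prod.cong refl) (simp add: K1_def E(2) Y_def)
        finally show ?thesis .
      qed (simp add: ev_def prob_space)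
      also have "prob ((\<lambda>\<omega>. ev False K2 (?J2 \<omega>)) -` {True} \<inter> space M) = (\<Prod>i\<in>K2. prob (A (False, i)))"
      proof (cases "K2 = {}")
        case False
        have "prob (\<Inter>i\<in>K2. B.increment h i -` E (False, i) \<inter> space M) = (\<Prod>i\<in>K2. prob (B.increment h i -` E (False, i) \<inter> space M))"
          using B.indep_increments[OF h, of n] False fin sub E(1)
          by (intro indep_varsD[where I = "{..<n}" and M' = "\<lambda>_. borel"]) (auto simp: K2_def)
        also have "(\<Inter>i\<in>K2. B.increment h i -` E (False, i) \<inter> space M) = (\<lambda>\<omega>. ev False K2 (?J2 \<omega>)) -` {True} \<inter> space M"
          using False unfolding vimage_def by (auto simp: ev2)
        also have "(\<Prod>i\<in>K2. prob (B.increment h i -` E (False, i) \<inter> space M)) = (\<Prod>i\<in>K2. prob (A (False, i)))"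
          by (intro prod.cong refl) (simp add: K2_def E(2) Y_def)
        finally show ?thesis .
      qed (simp add: ev_def prob_space)
      also have "(\<Prod>i\<in>K1. prob (A (True, i))) * (\<Prod>i\<in>K2. prob (A (False, i))) = (\<Prod>j\<in>K. prob (A j))"
        unfolding KU using fin
        by (subst prod.union_disjoint) (auto simp: prod.reindex inj_on_def)
      finally show "prob (\<Inter>j\<in>K. A j) = (\<Prod>j\<in>K. prob (A j))" .
    qed (use Ym in \<open>auto intro: measurable_sets\<close>)
  qed (use Ym in auto)
  then have "indep_vars (\<lambda>i. Pi\<^sub>M {(True, i), (False, i)} (\<lambda>_. borel)) (\<lambda>i \<omega>. restrict (\<lambda>j. Y j \<omega>) {(True, i), (False, i)}) {..<n}"
    by (rule indep_vars_restrict) (auto simp: disjoint_family_on_def)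
  then have "indep_vars (\<lambda>_. borel \<Otimes>\<^sub>M borel)
      (\<lambda>i \<omega>. (\<lambda>u. (u (True, i), u (False, i))) (restrict (\<lambda>j. Y j \<omega>) {(True, i), (False, i)})) {..<n}"
    by (rule indep_vars_compose2) simp
  then show ?thesis by (simp add: increments_def[abs_def] Y_def)
qed

lemma indep_increment_components:
  assumes h: "0 \<le> h"
  shows "indep_var borel (A.increment h i) borel (B.increment h i)"
  using indep_functionals[OF measurable_increment_functional[OF h] measurable_increment_functional[OF h], of i i] h
  by (simp add: A.increment_def[abs_def] B.increment_def[abs_def])

lemma measurable_increments: "0 \<le> h \<Longrightarrow> increments h i \<in> M \<rightarrow>\<^sub>M borel \<Otimes>\<^sub>M borel"
  unfolding increments_def[abs_def] by (intro measurable_Pair A.measurable_increment B.measurable_increment)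

lemma expectation_exp_increments:
  assumes "0 \<le> \<alpha>" "0 \<le> h"
  shows "expectation (\<lambda>\<omega>. exp (- \<alpha> * (A.increment h i \<omega> + B.increment h i \<omega>))) = exp (- (h * (A.\<eta> \<alpha> + B.\<eta> \<alpha>)))"
proof -
  have iv: "indep_var borel (\<lambda>\<omega>. exp (- \<alpha> * A.increment h i \<omega>)) borel (\<lambda>\<omega>. exp (- \<alpha> * B.increment h i \<omega>))"
    using indep_var_compose[OF indep_increment_components[OF assms(2), of i], of "\<lambda>x. exp (- \<alpha> * x)" borel "\<lambda>x. exp (- \<alpha> * x)" borel]
    by (simp add: o_def)
  have "expectation (\<lambda>\<omega>. exp (- \<alpha> * A.increment h i \<omega>) * exp (- \<alpha> * B.increment h i \<omega>)) =
      expectation (\<lambda>\<omega>. exp (- \<alpha> * A.increment h i \<omega>)) * expectation (\<lambda>\<omega>. exp (- \<alpha> * B.increment h i \<omega>))"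
  proof (rule indep_var_lebesgue_integral[OF iv])
    show "integrable M (\<lambda>\<omega>. exp (- \<alpha> * A.increment h i \<omega>))"
      using A.increment_nonneg[OF assms(2)] A.measurable_increment[OF assms(2), of i] assms
      by (intro integrable_const_bound[of _ 1]) auto
    show "integrable M (\<lambda>\<omega>. exp (- \<alpha> * B.increment h i \<omega>))"
      using B.increment_nonneg[OF assms(2)] B.measurable_increment[OF assms(2), of i] assms
      by (intro integrable_const_bound[of _ 1]) auto
  qed
  then show ?thesis
    unfolding A.expectation_exp_increment[OF assms] B.expectation_exp_increment[OF assms]
    by (simp add: exp_add[symmetric] algebra_simps)
qed

definition total :: "'a \<Rightarrow> real \<Rightarrow> real" where "total \<omega> s = A.path \<omega> s + B.path \<omega> s"

lemma input_path_total: "\<omega> \<in> space M \<Longrightarrow> input_path (total \<omega>)"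
  unfolding total_def[abs_def] by (intro input_path_add A.input_path_path B.input_path_path)

text \<open>The weight as a measurable function of the earlier pairs of increments, as
  \<open>second_moment_martingale_sum\<close> expects; the subtracted \<open>h\<close> is the
  service available during one cell.\<close>

definition past_weight :: "real \<Rightarrow> real \<Rightarrow> nat \<Rightarrow> (nat \<Rightarrow> real \<times> real) \<Rightarrow> real" where
  "past_weight b h i u = exp (- b * reflected_walk (\<lambda>l. \<Sum>k<l. fst (u k) + snd (u k) - h) i)"

lemma measurable_past_weight: "past_weight b h i \<in> borel_measurable (Pi\<^sub>M {..<i} (\<lambda>_. borel \<Otimes>\<^sub>M borel))"
proof -
  have s: "(\<lambda>u::nat \<Rightarrow> real \<times> real. \<Sum>k<l. fst (u k) + snd (u k) - h) \<in> borel_measurable (Pi\<^sub>M {..<i} (\<lambda>_. borel \<Otimes>\<^sub>M borel))"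
    if "l \<le> i" for l
  proof (intro borel_measurable_sum borel_measurable_diff borel_measurable_add borel_measurable_const)
    fix k assume "k \<in> {..<l}"
    with that have *: "(\<lambda>u. u k) \<in> Pi\<^sub>M {..<i} (\<lambda>_. borel \<Otimes>\<^sub>M borel) \<rightarrow>\<^sub>M (borel \<Otimes>\<^sub>M borel :: (real \<times> real) measure)"
      by (intro measurable_component_singleton) auto
    show "(\<lambda>u :: nat \<Rightarrow> real \<times> real. fst (u k)) \<in> borel_measurable (Pi\<^sub>M {..<i} (\<lambda>_. borel \<Otimes>\<^sub>M (borel :: real measure)))"
      by (rule measurable_compose[OF * measurable_fst])
    show "(\<lambda>u :: nat \<Rightarrow> real \<times> real. snd (u k)) \<in> borel_measurable (Pi\<^sub>M {..<i} (\<lambda>_. (borel :: real measure) \<Otimes>\<^sub>M borel))"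
      by (rule measurable_compose[OF * measurable_snd])
  qed
  have r: "(\<lambda>u::nat \<Rightarrow> real \<times> real. running_deficit (\<lambda>l. \<Sum>k<l. fst (u k) + snd (u k) - h) l)
      \<in> borel_measurable (Pi\<^sub>M {..<i} (\<lambda>_. borel \<Otimes>\<^sub>M borel))" if "l \<le> i" for l
    using that
  proof (induction l)
    case (Suc l)
    then show ?case
      unfolding running_deficit.simps by (intro borel_measurable_max borel_measurable_uminus s Suc.IH) auto
  qed simp
  show ?thesis
    unfolding past_weight_def[abs_def] reflected_walk_def
    by (intro measurable_compose[OF _ borel_measurable_exp] borel_measurable_times borel_measurable_add
        borel_measurable_const s r order_refl)
qed

lemma past_weight_bound: "0 \<le> b \<Longrightarrow> \<bar>past_weight b h i u\<bar> \<le> 1"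
  by (simp add: past_weight_def reflected_walk_nonneg)

lemma weight_eq_past_weight:
  assumes \<omega>: "\<omega> \<in> space M" and t: "0 \<le> t"
  shows "input_path.weight (total \<omega>) b t m i = past_weight b (t / m) i (\<lambda>l\<in>{..<i}. increments (t / m) l \<omega>)"
proof -
  interpret p: input_path "total \<omega>" by (rule input_path_total[OF \<omega>])
  have h: "0 \<le> t / m" using t by simp
  have eq: "p.grid_walk (t / m) l = (\<Sum>k<l. fst ((\<lambda>l\<in>{..<i}. increments (t / m) l \<omega>) k) + snd ((\<lambda>l\<in>{..<i}. increments (t / m) l \<omega>) k) - t / m)"
    if "l \<le> i" for l
  proof -
    have "(\<Sum>k<l. fst ((\<lambda>l\<in>{..<i}. increments (t / m) l \<omega>) k) + snd ((\<lambda>l\<in>{..<i}. increments (t / m) l \<omega>) k) - t / m)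
      = (\<Sum>k<l. A.increment (t / m) k \<omega> + B.increment (t / m) k \<omega> - t / m)"
      using that by (intro sum.cong refl) (simp add: increments_def)
    also have "\<dots> = (\<Sum>k<l. A.increment (t / m) k \<omega>) + (\<Sum>k<l. B.increment (t / m) k \<omega>) - real l * (t / m)"
      by (simp add: sum.distrib sum_subtractf)
    also have "\<dots> = p.grid_walk (t / m) l"
      using h by (simp only: A.sum_increment[OF \<omega>] B.sum_increment[OF \<omega>]) (simp add: p.grid_walk_def total_def A.path_eq B.path_eq t)
    finally show ?thesis by simp
  qed
  have rd: "running_deficit (p.grid_walk (t / m)) i = running_deficit (\<lambda>l. \<Sum>k<l. fst ((\<lambda>l\<in>{..<i}. increments (t / m) l \<omega>) k) + snd ((\<lambda>l\<in>{..<i}. increments (t / m) l \<omega>) k) - t / m) i"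
    by (rule running_deficit_cong) (rule eq)
  show ?thesis
    unfolding p.weight_def past_weight_def reflected_walk_def rd eq[OF order_refl] ..
qed

text \<open>
  Only meshes \<open>1 / Suc m \<le> 1\<close> are used, so that the second moment bound is uniform in the mesh and
  linear in the horizon.
\<close>

lemma AE_weighted_martingale:
  fixes H :: "real \<Rightarrow> real \<times> real \<Rightarrow> real"
  assumes b: "0 \<le> b"
    and H: "\<And>h. H h \<in> borel_measurable (borel \<Otimes>\<^sub>M borel)" "\<And>h x. \<bar>H h x\<bar> \<le> K h"
    and H0: "\<And>h i. 0 \<le> h \<Longrightarrow> expectation (\<lambda>\<omega>. H h (increments h i \<omega>)) = 0"
    and H2: "\<And>h i. 0 \<le> h \<Longrightarrow> h \<le> 1 \<Longrightarrow> expectation (\<lambda>\<omega>. (H h (increments h i \<omega>))\<^sup>2) \<le> C * h"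
    and C: "0 \<le> C"
    and lim: "\<And>\<omega> t. \<omega> \<in> space M \<Longrightarrow> 0 < t \<Longrightarrow>
      (\<lambda>m. \<Sum>i<m. input_path.weight (total \<omega>) b t m i * H (t / m) (increments (t / m) i \<omega>)) \<longlonglongrightarrow> g \<omega> t"
  shows "AE \<omega> in M. (\<lambda>n. g \<omega> ((real n)\<^sup>2) / (real n)\<^sup>2) \<longlonglongrightarrow> 0"
proof -
  define h where "h m = 1 / real (Suc m)" for m
  have h: "0 \<le> h m" "h m \<le> 1" for m by (auto simp: h_def)
  define f where "f m N \<omega> = (\<Sum>i<N * Suc m. past_weight b (h m) i (\<lambda>l\<in>{..<i}. increments (h m) l \<omega>) * H (h m) (increments (h m) i \<omega>))"
    for m N \<omega>
  \<comment> \<open>The limits are assumed only for t > 0; at N = 0 the sums are empty and tend to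
    0.\<close>
  define g' where "g' N \<omega> = (if N = 0 then 0 else g \<omega> (real N))" for N :: nat and \<omega>
  have sm: "integrable M (\<lambda>\<omega>. (f m N \<omega>)\<^sup>2)" "expectation (\<lambda>\<omega>. (f m N \<omega>)\<^sup>2) \<le> real (N * Suc m) * (C * h m)" for m N
    unfolding f_def
    by (rule second_moment_martingale_sum[where H = "H (h m)" and C = "K (h m)", OF indep_increment_pairs[OF h(1)]
          measurable_past_weight past_weight_bound[OF b] H H0[OF h(1)] H2[OF h]])+
  have "AE \<omega> in M. (\<lambda>n. g' (n\<^sup>2) \<omega> / (real n)\<^sup>2) \<longlonglongrightarrow> 0"
  proof (rule AE_square_times_limit_zero[where f = f, OF _ _ C])
    show "f m N \<in> borel_measurable M" for m N
      unfolding f_def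
      by (intro borel_measurable_sum borel_measurable_times measurable_compose[OF _ measurable_past_weight]
          measurable_compose[OF _ H(1)] measurable_restrict measurable_increments h)
    show "(\<integral>\<^sup>+\<omega>. ennreal ((f m N \<omega>)\<^sup>2) \<partial>M) \<le> ennreal (C * real N)" for m N
    proof -
      have "expectation (\<lambda>\<omega>. (f m N \<omega>)\<^sup>2) \<le> real (N * Suc m) * (C * h m)"
        by (rule sm(2))
      also have "\<dots> = C * real N" unfolding h_def of_nat_mult by simp
      finally show ?thesis
        using sm(1)[of m N] by (subst nn_integral_eq_integral) (auto intro: ennreal_leI)
    qed
    show "AE \<omega> in M. \<forall>N. (\<lambda>m. f m N \<omega>) \<longlonglongrightarrow> g' N \<omega>"
    proof (intro AE_I2 allI)
      fix \<omega> N assume \<omega>: "\<omega> \<in> space M"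
      show "(\<lambda>m. f m N \<omega>) \<longlonglongrightarrow> g' N \<omega>"
      proof (cases "N = 0")
        case False
        \<comment> \<open>Dividing [0, N] into N (m+1) cells gives mesh 1 / (m+1) for every N, and
          is a subsequence of all divisions of [0, N].\<close>
        have "strict_mono (\<lambda>m. N * Suc m)" using False by (simp add: strict_mono_Suc_iff)
        from LIMSEQ_subseq_LIMSEQ[OF lim[OF \<omega>, of "real N"] this] False
        have "(\<lambda>m. \<Sum>i<N * Suc m. input_path.weight (total \<omega>) b (real N) (N * Suc m) i * H (real N / real (N * Suc m)) (increments (real N / real (N * Suc m)) i \<omega>)) \<longlonglongrightarrow> g \<omega> (real N)"
          by (simp add: o_def)
        moreover have "real N / real (N * Suc m) = h m" for m using False by (simp add: h_def del: of_nat_Suc mult_Suc_right)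
        ultimately show ?thesis
          using False by (simp only: weight_eq_past_weight[OF \<omega> of_nat_0_le_iff] f_def g'_def if_False)
      qed (simp add: f_def g'_def)
    qed
  qed
  then show ?thesis
  proof eventually_elim
    case (elim \<omega>)
    then show ?case
      by (rule Lim_transform_eventually)
         (use eventually_gt_at_top[of 0] in \<open>eventually_elim, simp add: g'_def\<close>)
  qed
qed

definition \<phi> :: "real \<Rightarrow> real" where "\<phi> b = b - A.\<eta> b - B.\<eta> b"

lemma phi_ge: "0 \<le> b \<Longrightarrow> (1 - (A.\<rho> + B.\<rho>)) * b \<le> \<phi> b"
  using A.exponent_le[of b] B.exponent_le[of b] by (simp add: \<phi>_def algebra_simps)

lemma phi_pos: "0 < b \<Longrightarrow> 0 < \<phi> b"
  using phi_ge[of b] mult_pos_pos[of "1 - (A.\<rho> + B.\<rho>)" b] stable by linarith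

abbreviation workload_transform :: "real \<Rightarrow> 'a \<Rightarrow> real \<Rightarrow> real" where
  "workload_transform b \<omega> t \<equiv> LINT s:{0<..t}|lborel. exp (- b * input_path.W_left (total \<omega>) s)"

text \<open>This is b times the numerator of the content average of exp(-b x): an atom of size d
  contributes b times the integral over the batch, and the jump-free part carries the factor
  b.\<close>

abbreviation class2_transform :: "real \<Rightarrow> 'a \<Rightarrow> real \<Rightarrow> real" where
  "class2_transform b \<omega> t \<equiv> LINT s:{0<..t}|interval_measure (B.path \<omega>).
     exp (- b * input_path.W_left (total \<omega>) s) * exp_slope b (jump (B.path \<omega>) s)"

lemma AE_kella_whitt:
  assumes b: "0 < b"
  shows "AE \<omega> in M. (\<lambda>n. (exp (- b * input_path.W (total \<omega>) ((real n)\<^sup>2)) - 1 + b * idle_time (total \<omega>) ((real n)\<^sup>2)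
    - \<phi> b * workload_transform b \<omega> ((real n)\<^sup>2)) / (real n)\<^sup>2) \<longlonglongrightarrow> 0"
proof -
  define e where "e = A.\<eta> b + B.\<eta> b"
  have e: "0 \<le> e" using A.exponent_nonneg[of b] B.exponent_nonneg[of b] b by (simp add: e_def)
  have phi: "\<phi> b = b - e" by (simp add: \<phi>_def e_def)
  \<comment> \<open>The mean of the first exponential over a step is exp(b h) exp(-h e) =
    exp(\<phi>(b) h), so the difference is centred. The maxima are harmless on nonnegative
    increments and make \<open>H h\<close> bounded.\<close>
  define H where "H h x = exp (- b * (max 0 (fst x) + max 0 (snd x) - h)) - exp (\<phi> b * h)" for h :: real and x :: "real \<times> real"
  have HX: "H h (increments h i \<omega>) = exp (b * h) * (exp (- b * (A.increment h i \<omega> + B.increment h i \<omega>)) - exp (- (h * e)))"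
    if "0 \<le> h" "\<omega> \<in> space M" for h i \<omega>
    using A.increment_nonneg[OF that, of i] B.increment_nonneg[OF that, of i]
    by (simp add: H_def increments_def phi exp_add[symmetric] algebra_simps)
  have Y: "(\<lambda>\<omega>. exp (- b * (A.increment h i \<omega> + B.increment h i \<omega>))) \<in> borel_measurable M" if "0 \<le> h" for h i
    using A.measurable_increment[OF that, of i] B.measurable_increment[OF that, of i] by simp
  have Y1: "0 \<le> exp (- b * (A.increment h i \<omega> + B.increment h i \<omega>)) \<and> exp (- b * (A.increment h i \<omega> + B.increment h i \<omega>)) \<le> 1"
    if "0 \<le> h" "\<omega> \<in> space M" for h i \<omega>
    using A.increment_nonneg[OF that, of i] B.increment_nonneg[OF that, of i] b by simp
  have EY: "expectation (\<lambda>\<omega>. exp (- b * (A.increment h i \<omega> + B.increment h i \<omega>))) = exp (- (h * e))" if "0 \<le> h" for h i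
    unfolding e_def using b that by (intro expectation_exp_increments) auto
  show ?thesis
  \<comment> \<open>The constant \<open>C\<close> comes from variance at most h e, multiplied by
    exp(b h)^2, which is at most exp(2 b) for h <= 1.\<close>
  proof (rule AE_weighted_martingale[where b = b and H = H and K = "\<lambda>h. exp (b * h) + exp (\<phi> b * h)" and C = "exp (2 * b) * e"])
    show "H h \<in> borel_measurable (borel \<Otimes>\<^sub>M borel)" for h unfolding H_def by measurable
    show "\<bar>H h x\<bar> \<le> exp (b * h) + exp (\<phi> b * h)" for h x
    proof -
      have "exp (- b * (max 0 (fst x) + max 0 (snd x) - h)) \<le> exp (b * h)"
        using b by (auto simp: algebra_simps intro!: add_nonneg_nonneg)
      then show ?thesis
        using exp_gt_zero[of "- b * (max 0 (fst x) + max 0 (snd x) - h)"] exp_gt_zero[of "\<phi> b * h"]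
        unfolding H_def by linarith
    qed
    show "expectation (\<lambda>\<omega>. H h (increments h i \<omega>)) = 0" if h: "0 \<le> h" for h i
    proof -
      have "integrable M (\<lambda>\<omega>. exp (- b * (A.increment h i \<omega> + B.increment h i \<omega>)))"
        using Y1[OF h] Y[OF h] by (intro integrable_const_bound[of _ 1]) auto
      then show ?thesis
        using EY[OF h, of i] by (simp add: HX[OF h] prob_space cong: Bochner_Integration.integral_cong)
    qed
    show "expectation (\<lambda>\<omega>. (H h (increments h i \<omega>))\<^sup>2) \<le> exp (2 * b) * e * h" if h: "0 \<le> h" "h \<le> 1" for h i
    proof -
      have "expectation (\<lambda>\<omega>. (H h (increments h i \<omega>))\<^sup>2) =
          (exp (b * h))\<^sup>2 * expectation (\<lambda>\<omega>. (exp (- b * (A.increment h i \<omega> + B.increment h i \<omega>)) - exp (- (h * e)))\<^sup>2)"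
        by (simp add: HX[OF h(1)] power_mult_distrib cong: Bochner_Integration.integral_cong)
      also have "\<dots> \<le> (exp (b * h))\<^sup>2 * (h * e)"
        by (intro mult_left_mono variance_unit_interval_le Y[OF h(1)] Y1[OF h(1)] EY[OF h(1)]) auto
      also have "(exp (b * h))\<^sup>2 \<le> exp (2 * b)"
        using h b by (simp add: power2_eq_square exp_add[symmetric] mult_left_le)
      finally show ?thesis using h e by (simp add: mult_right_mono mult_ac)
    qed
    fix \<omega> t assume \<omega>: "\<omega> \<in> space M" and t: "0 < (t::real)"
    interpret p: input_path "total \<omega>" by (rule input_path_total[OF \<omega>])
    have "H (t / m) (increments (t / m) i \<omega>) = exp (- b * (p.grid_walk (t / m) (Suc i) - p.grid_walk (t / m) i)) - exp (\<phi> b * (t / m))"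
      for m :: nat and i
    proof -
      have h: "0 \<le> t / m" using t by simp
      have "p.grid_walk (t / m) (Suc i) - p.grid_walk (t / m) i = A.increment (t / m) i \<omega> + B.increment (t / m) i \<omega> - t / m"
        unfolding A.path_grid[OF h, symmetric] B.path_grid[OF h, symmetric]
        by (simp add: p.grid_walk_def total_def algebra_simps add_divide_distrib)
      then show ?thesis
        using A.increment_nonneg[OF h \<omega>, of i] B.increment_nonneg[OF h \<omega>, of i] by (simp add: H_def increments_def)
    qed
    then show "(\<lambda>m. \<Sum>i<m. p.weight b t m i * H (t / m) (increments (t / m) i \<omega>)) \<longlonglongrightarrow>
        exp (- b * p.W t) - 1 + b * idle_time (total \<omega>) t - \<phi> b * workload_transform b \<omega> t"
      using p.kella_whitt_tendsto[OF t, of b "\<phi> b"] b phi_pos[OF b] by simp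
  qed (use b e in auto)
qed

lemma AE_class2_martingale:
  assumes b: "0 < b"
  shows "AE \<omega> in M. (\<lambda>n. (class2_transform b \<omega> ((real n)\<^sup>2)
    - B.\<eta> b * workload_transform b \<omega> ((real n)\<^sup>2)) / (real n)\<^sup>2) \<longlonglongrightarrow> 0"
proof -
  define e where "e = B.\<eta> b"
  have e: "0 \<le> e" using B.exponent_nonneg[of b] b by (simp add: e_def)
  \<comment> \<open>This is (1 - exp(-b d)) - (1 - exp(-h e)), with d the class 2 increment: the
    difference of the summands of two grid sums whose limits are known.\<close>
  define H where "H h x = exp (- (h * e)) - exp (- b * max 0 (snd x))" for h :: real and x :: "real \<times> real"
  have HX: "H h (increments h i \<omega>) = exp (- (h * e)) - exp (- b * B.increment h i \<omega>)"
    if "0 \<le> h" "\<omega> \<in> space M" for h i \<omega>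
    using B.increment_nonneg[OF that, of i] by (simp add: H_def increments_def)
  have Y: "(\<lambda>\<omega>. exp (- b * B.increment h i \<omega>)) \<in> borel_measurable M" if "0 \<le> h" for h i
    using B.measurable_increment[OF that, of i] by simp
  have Y1: "0 \<le> exp (- b * B.increment h i \<omega>) \<and> exp (- b * B.increment h i \<omega>) \<le> 1"
    if "0 \<le> h" "\<omega> \<in> space M" for h i \<omega>
    using B.increment_nonneg[OF that, of i] b by simp
  have EY: "expectation (\<lambda>\<omega>. exp (- b * B.increment h i \<omega>)) = exp (- (h * e))" if "0 \<le> h" for h i
    unfolding e_def using b that by (subst B.expectation_exp_increment) auto
  show ?thesis
  proof (rule AE_weighted_martingale[where b = b and H = H and K = "\<lambda>h. exp (- (h * e)) + 1" and C = e])
    show "H h \<in> borel_measurable (borel \<Otimes>\<^sub>M borel)" for h unfolding H_def by measurable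
    show "\<bar>H h x\<bar> \<le> exp (- (h * e)) + 1" for h x
    proof -
      have "exp (- b * max 0 (snd x)) \<le> 1" using b by simp
      then show ?thesis
        using exp_gt_zero[of "- b * max 0 (snd x)"] exp_gt_zero[of "- (h * e)"] unfolding H_def by linarith
    qed
    show "expectation (\<lambda>\<omega>. H h (increments h i \<omega>)) = 0" if h: "0 \<le> h" for h i
    proof -
      have "integrable M (\<lambda>\<omega>. exp (- b * B.increment h i \<omega>))"
        using Y1[OF h] Y[OF h] by (intro integrable_const_bound[of _ 1]) auto
      then show ?thesis
        using EY[OF h, of i] by (simp add: HX[OF h] prob_space cong: Bochner_Integration.integral_cong)
    qed
    show "expectation (\<lambda>\<omega>. (H h (increments h i \<omega>))\<^sup>2) \<le> e * h" if h: "0 \<le> h" "h \<le> 1" for h i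
    proof -
      have "expectation (\<lambda>\<omega>. (exp (- b * B.increment h i \<omega>) - exp (- (h * e)))\<^sup>2) \<le> h * e"
        by (intro variance_unit_interval_le Y[OF h(1)] Y1[OF h(1)] EY[OF h(1)])
      then show ?thesis
        by (simp add: HX[OF h(1)] power2_commute mult.commute cong: Bochner_Integration.integral_cong)
    qed
    fix \<omega> t assume \<omega>: "\<omega> \<in> space M" and t: "0 < (t::real)"
    interpret p: input_path "total \<omega>" by (rule input_path_total[OF \<omega>])
    interpret p2: input_path "B.path \<omega>" by (rule B.input_path_path[OF \<omega>])
    have 1: "(\<lambda>m. \<Sum>i<m. p.weight b t m i * (1 - exp (- b * (B.path \<omega> (real (Suc i) * (t / m)) - B.path \<omega> (real i * (t / m))))))
      \<longlonglongrightarrow> class2_transform b \<omega> t"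
      by (rule p2.grid_sum_tendsto) (use t b p.weight_bounds p.weight_tendsto in auto)
    have 2: "(\<lambda>m. \<Sum>i<m. p.weight b t m i * (1 - exp (- e * (t / m)))) \<longlonglongrightarrow> e * workload_transform b \<omega> t"
      by (rule p.weight_sum_tendsto) (use t b e in auto)
    have "(\<Sum>i<m. p.weight b t m i * (1 - exp (- b * (B.path \<omega> (real (Suc i) * (t / m)) - B.path \<omega> (real i * (t / m)))))) -
      (\<Sum>i<m. p.weight b t m i * (1 - exp (- e * (t / m)))) = (\<Sum>i<m. p.weight b t m i * H (t / m) (increments (t / m) i \<omega>))" for m :: nat
    proof -
      have h: "0 \<le> t / m" using t by simp
      show ?thesis
        unfolding sum_subtractf[symmetric] B.path_grid[OF h] HX[OF h \<omega>] right_diff_distrib[symmetric]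
        by (simp add: mult.commute)
    qed
    with tendsto_diff[OF 1 2]
    show "(\<lambda>m. \<Sum>i<m. p.weight b t m i * H (t / m) (increments (t / m) i \<omega>)) \<longlonglongrightarrow>
        class2_transform b \<omega> t - B.\<eta> b * workload_transform b \<omega> t"
      by (simp add: e_def)
  qed (use b e in auto)
qed

lemma AE_class2_average:
  assumes b: "0 < b"
  shows "AE \<omega> in M. ((\<lambda>t. class2_transform b \<omega> t / t)
    \<longlongrightarrow> B.\<eta> b * (b * (1 - (A.\<rho> + B.\<rho>)) / \<phi> b)) at_top"
  using AE_kella_whitt[OF b] AE_class2_martingale[OF b] A.AE_J_div_tendsto B.AE_J_div_tendsto AE_space
proof eventually_elim
  case (elim \<omega>)
  interpret p: input_path "total \<omega>" by (rule input_path_total) (rule elim)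
  interpret p2: input_path "B.path \<omega>" by (rule B.input_path_path) (rule elim)
  let ?r = "A.\<rho> + B.\<rho>"
  let ?I = "workload_transform b \<omega>" and ?N = "class2_transform b \<omega>"
  let ?q = "\<lambda>n. (real n)\<^sup>2"
  have "((\<lambda>t. J1 t \<omega> / t + J2 t \<omega> / t) \<longlongrightarrow> ?r) at_top" by (intro tendsto_add elim)
  then have "((\<lambda>t. total \<omega> t / t) \<longlongrightarrow> ?r) at_top"
    by (rule Lim_transform_eventually)
       (use eventually_ge_at_top[of 0] in \<open>eventually_elim, simp add: total_def A.path_eq B.path_eq add_divide_distrib\<close>)
  then have idle: "((\<lambda>t. idle_time (total \<omega>) t / t) \<longlongrightarrow> 1 - ?r) at_top"
    by (rule p.idle_time_div_tendsto) (rule stable)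
  have q: "filterlim ?q at_top sequentially"
    by (intro filterlim_pow_at_top filterlim_real_sequentially) simp
  have i: "(\<lambda>n. b * (idle_time (total \<omega>) (?q n) / ?q n)) \<longlonglongrightarrow> b * (1 - ?r)"
    by (intro tendsto_mult tendsto_const filterlim_compose[OF idle q])
  have w: "(\<lambda>n. (exp (- b * p.W (?q n)) - 1) / ?q n) \<longlonglongrightarrow> 0"
  proof (rule Lim_null_comparison)
    have "(\<lambda>n. 1 / real n * (1 / real n)) \<longlonglongrightarrow> 0 * 0" by (intro tendsto_mult lim_1_over_n)
    then show "(\<lambda>n. 1 / ?q n) \<longlonglongrightarrow> 0" by (simp add: power2_eq_square)
    have "\<bar>exp (- b * p.W (?q n)) - 1\<bar> \<le> 1" for n
      using p.W_nonneg[of "?q n"] b by (simp add: abs_le_iff)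
    then show "\<forall>\<^sub>F n in sequentially. norm ((exp (- b * p.W (?q n)) - 1) / ?q n) \<le> 1 / ?q n"
      by (intro always_eventually allI) (auto simp: abs_divide intro!: divide_right_mono)
  qed
  have "(\<lambda>n. ((exp (- b * p.W (?q n)) - 1) / ?q n + b * (idle_time (total \<omega>) (?q n) / ?q n)
      - (exp (- b * p.W (?q n)) - 1 + b * idle_time (total \<omega>) (?q n) - \<phi> b * ?I (?q n)) / ?q n) / \<phi> b)
      \<longlonglongrightarrow> (0 + b * (1 - ?r) - 0) / \<phi> b"
    using phi_pos[OF b] by (intro tendsto_divide tendsto_diff tendsto_add w i elim(1) tendsto_const) auto
  \<comment> \<open>The exponential term of the first martingale is bounded, so the growth of the
    idle time fixes this average. The limit is the generalised Pollaczek--Khinchine transform of the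
    stationary workload.\<close>
  then have I: "(\<lambda>n. ?I (?q n) / ?q n) \<longlonglongrightarrow> b * (1 - ?r) / \<phi> b"
    using phi_pos[OF b] by (simp add: add_divide_distrib diff_divide_distrib)
  have "(\<lambda>n. (?N (?q n) - B.\<eta> b * ?I (?q n)) / ?q n + B.\<eta> b * (?I (?q n) / ?q n)) \<longlonglongrightarrow> 0 + B.\<eta> b * (b * (1 - ?r) / \<phi> b)"
    by (intro tendsto_add elim(2) tendsto_mult tendsto_const I)
  then have N: "(\<lambda>n. ?N (?q n) / ?q n) \<longlonglongrightarrow> B.\<eta> b * (b * (1 - ?r) / \<phi> b)"
    by (simp add: diff_divide_distrib)
  have pos: "0 \<le> exp (- b * p.W_left s) * exp_slope b (jump (B.path \<omega>) s)" for s
    using b p2.jump_nonneg by (intro mult_nonneg_nonneg exp_slope_nonneg) auto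
  have le: "exp (- b * p.W_left s) * exp_slope b (jump (B.path \<omega>) s) \<le> 1 * b" if "0 < s" for s
    using b p2.jump_nonneg[of s] p.W_left_nonneg[OF that] by (intro mult_mono exp_slope_le exp_slope_nonneg) auto
  have int: "set_integrable p2.\<mu> {0<..t} (\<lambda>s. exp (- b * p.W_left s) * exp_slope b (jump (B.path \<omega>) s))" for t
    unfolding set_integrable_def real_scaleR_def
    using pos le by (intro p2.integrable_bounded_Ioc[where B = b]) auto
  show ?case
  \<comment> \<open>The integrand is nonnegative, so the class 2 integral increases and the squares
    determine its growth at all times.\<close>
  proof (rule mono_div_tendsto_at_top[OF _ _ N])
    show "mono_on {0..} ?N"
    proof (rule mono_onI)
      fix r t :: real assume "r \<le> t"
      then show "?N r \<le> ?N t"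
        unfolding set_lebesgue_integral_def
        using int[of r, unfolded set_integrable_def] int[of t, unfolded set_integrable_def] pos
        using b by (intro integral_mono) (auto simp: indicator_def intro!: exp_slope_nonneg p2.jump_nonneg)
    qed
    show "0 \<le> ?N t" for t
      unfolding set_lebesgue_integral_def using pos by (intro integral_nonneg_AE AE_I2) simp
  qed
qed

end

section \<open>Content in front of class 2 particles\<close>

lemma infsum_eq_integral_count_space:
  fixes f :: "'a \<Rightarrow> real"
  assumes "integrable (count_space A) f"
  shows "infsum f A = (LINT x|count_space A. f x)"
proof -
  have "Infinite_Set_Sum.abs_summable_on f A"
    using assms by (simp add: Infinite_Set_Sum.abs_summable_on_def)
  then show ?thesis
    by (simp add: infsetsum_infsum[symmetric] infsetsum_def abs_summable_equivalent)
qed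

section \<open>The jump part and the drift part of a Stieltjes integral\<close>

context stieltjes
begin

text \<open>On a countable set a measure is the sum of its atoms, and the atoms are the jumps.
  Expressed through a counting measure, so that integrals over the set become sums.\<close>

lemma density_jumps_eq:
  assumes D: "countable D"
  shows "density \<mu> (indicator D) = distr (density (count_space D) (\<lambda>s. ennreal (jump F s))) borel (\<lambda>s. s)"
proof (rule measure_eqI)
  fix B assume "B \<in> sets (density \<mu> (indicator D))"
  then have [measurable]: "B \<in> sets borel" by simp
  have [measurable]: "D \<in> sets borel" using D by (rule sets.countable[rotated]) auto
  have "emeasure (density \<mu> (indicator D)) B = emeasure \<mu> (D \<inter> B)"
    by (subst emeasure_density) (auto simp: indicator_inter_arith[symmetric])
  also have "\<dots> = (\<integral>\<^sup>+s. emeasure \<mu> {s} \<partial>count_space (D \<inter> B))"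
    using D by (intro emeasure_countable_singleton) auto
  also have "\<dots> = (\<integral>\<^sup>+s. ennreal (jump F s) * indicator B s \<partial>count_space D)"
    unfolding emeasure_singleton
    by (subst (1 2) nn_integral_count_space_indicator) (auto intro!: nn_integral_cong simp: indicator_def)
  also have "\<dots> = emeasure (density (count_space D) (\<lambda>s. ennreal (jump F s))) (B \<inter> D)"
    by (subst emeasure_density) (auto intro!: nn_integral_cong simp: indicator_def)
  also have "\<dots> = emeasure (distr (density (count_space D) (\<lambda>s. ennreal (jump F s))) borel (\<lambda>s. s)) B"
    by (subst emeasure_distr) auto
  finally show "emeasure (density \<mu> (indicator D)) B = emeasure (distr (density (count_space D) (\<lambda>s. ennreal (jump F s))) borel (\<lambda>s. s)) B" .
qed simp

text \<open>Brings the jump part of the integral into the form of the unconditional sum in the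
  content average; boundedness of K on the interval gives absolute summability.\<close>

lemma integral_jumps:
  fixes K :: "real \<Rightarrow> real"
  assumes D: "countable D" "D \<subseteq> {a<..b}" and [measurable]: "K \<in> borel_measurable borel"
    and K: "\<And>s. a < s \<Longrightarrow> s \<le> b \<Longrightarrow> \<bar>K s\<bar> \<le> B"
  shows "(LINT s:D|\<mu>. K s) = infsum (\<lambda>s. jump F s * K s) D"
proof -
  have [measurable]: "D \<in> sets borel" using D(1) by (rule sets.countable[rotated]) auto
  have "integrable \<mu> (\<lambda>s. indicat_real {a<..b} s * (indicator D s * K s))"
    using K D(2) by (intro integrable_bounded_Ioc[where B = "\<bar>B\<bar>"]) (force simp: indicator_def)+
  then have i: "integrable \<mu> (\<lambda>s. indicator D s *\<^sub>R K s)"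
    by (rule Bochner_Integration.integrable_cong[THEN iffD1, OF refl, rotated]) (use D(2) in \<open>auto simp: indicator_def\<close>)
  have d: "density \<mu> (indicator D) = density \<mu> (\<lambda>s. ennreal (indicat_real D s))"
    by (intro density_cong) (auto simp: indicator_def)
  have "integrable (density \<mu> (indicator D)) K"
    unfolding d using i by (subst integrable_density) auto
  then have "integrable (count_space D) (\<lambda>s. jump F s * K s)"
    unfolding density_jumps_eq[OF D(1)] using jump_nonneg
    by (subst (asm) integrable_distr_eq) (auto simp: integrable_density)
  then have "infsum (\<lambda>s. jump F s * K s) D = (LINT s|count_space D. jump F s * K s)"
    by (rule infsum_eq_integral_count_space)
  also have "\<dots> = (LINT s|density \<mu> (indicator D). K s)"
    unfolding density_jumps_eq[OF D(1)] using jump_nonneg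
    by (subst integral_distr) (auto simp: integral_density)
  also have "\<dots> = (LINT s:D|\<mu>. K s)"
    unfolding d set_lebesgue_integral_def by (subst integral_density) auto
  finally show ?thesis by simp
qed

definition no_jump :: "real set" where "no_jump = {s. jump F s = 0}"

lemma measurable_no_jump [measurable]: "no_jump \<in> sets borel"
  unfolding no_jump_def by measurable

text \<open>The jump-free part of the measure and c times Lebesgue measure have equal distribution
  functions on (0, t]. Finite Borel measures are determined by these, so the identity passes from
  intervals to all integrands.\<close>

lemma integral_continuous_part:
  fixes K :: "real \<Rightarrow> real"
  assumes c: "0 \<le> c" and C: "\<And>t. 0 < t \<Longrightarrow> (LINT s:{0<..t}|\<mu>. indicator no_jump s) = c * t"
    and [measurable]: "K \<in> borel_measurable borel" and t: "0 < t"
  shows "(LINT s:{0<..t} \<inter> no_jump|\<mu>. K s) = c * (LINT s:{0<..t}|lborel. K s)"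
proof -
  let ?A = "density \<mu> (\<lambda>s. ennreal (indicat_real ({0<..t} \<inter> no_jump) s))"
  let ?B = "density lborel (\<lambda>s. ennreal (c * indicat_real {0<..t} s))"
  have m: "measure \<mu> ({0<..r} \<inter> no_jump) = c * r" if "0 < r" for r
    using C[OF that] by (simp add: set_lebesgue_integral_def indicator_inter_arith[symmetric])
  have fin: "emeasure \<mu> ({0<..r} \<inter> no_jump) < \<infinity>" if "0 < r" for r
    by (rule le_less_trans[OF emeasure_mono[of _ "{0<..r}"]]) (auto simp: emeasure_Ioc that less_imp_le)
  have e: "emeasure \<mu> ({0<..r} \<inter> no_jump) = ennreal (c * r)" if "0 < r" for r
    using fin[OF that] m[OF that] by (subst emeasure_eq_ennreal_measure) auto
  have eA: "emeasure ?A X = emeasure \<mu> ({0<..t} \<inter> no_jump \<inter> X)" if [measurable]: "X \<in> sets borel" for X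
    by (subst emeasure_density) (auto intro!: arg_cong2[where f = emeasure] simp: indicator_def nn_integral_indicator[symmetric] intro!: nn_integral_cong)
  have eB: "emeasure ?B X = ennreal c * emeasure lborel ({0<..t} \<inter> X)" if [measurable]: "X \<in> sets borel" for X
  proof -
    have "emeasure ?B X = (\<integral>\<^sup>+s. ennreal c * indicator ({0<..t} \<inter> X) s \<partial>lborel)"
      by (subst emeasure_density) (auto intro!: nn_integral_cong simp: indicator_def)
    then show ?thesis by (simp add: nn_integral_cmult_indicator)
  qed
  have "?A = ?B"
  proof (rule cdf_unique')
    show "finite_borel_measure ?A"
    proof (intro finite_borel_measure.intro finite_measureI finite_borel_measure_axioms.intro)
      show "emeasure ?A (space ?A) \<noteq> \<infinity>" using fin[OF t] eA[of UNIV] by simp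
    qed simp
    show "finite_borel_measure ?B"
    proof (intro finite_borel_measure.intro finite_measureI finite_borel_measure_axioms.intro)
      show "emeasure ?B (space ?B) \<noteq> \<infinity>" using t eB[of UNIV] by (simp add: ennreal_mult_eq_top_iff)
    qed simp
    show "cdf ?A = cdf ?B"
    proof
      fix x
      have "emeasure ?A {..x} = emeasure ?B {..x}"
      proof (cases "0 < x")
        case True
        have "{0<..t} \<inter> no_jump \<inter> {..x} = {0<..min t x} \<inter> no_jump" "{0<..t} \<inter> {..x} = {0<..min t x}" by auto
        moreover have "emeasure ?A {..x} = emeasure \<mu> ({0<..t} \<inter> no_jump \<inter> {..x})" by (rule eA) simp
        moreover have "emeasure ?B {..x} = ennreal c * emeasure lborel ({0<..t} \<inter> {..x})" by (rule eB) simp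
        ultimately show ?thesis
          using True t c e[of "min t x"] by (simp only:) (simp add: ennreal_mult')
      next
        case False
        then have "{0<..t} \<inter> no_jump \<inter> {..x} = {}" "{0<..t} \<inter> {..x} = {}" by auto
        moreover have "emeasure ?A {..x} = emeasure \<mu> ({0<..t} \<inter> no_jump \<inter> {..x})" by (rule eA) simp
        moreover have "emeasure ?B {..x} = ennreal c * emeasure lborel ({0<..t} \<inter> {..x})" by (rule eB) simp
        ultimately show ?thesis by (simp only: emeasure_empty mult_zero_right)
      qed
      then show "cdf ?A x = cdf ?B x" by (simp add: cdf_def measure_def)
    qed
  qed
  then have "integral\<^sup>L ?A K = integral\<^sup>L ?B K" by simp
  then show ?thesis
    using c by (simp add: integral_density set_lebesgue_integral_def mult.assoc)
qed

end

lemma lborel_integral_Icc_scale: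
  fixes f :: "real \<Rightarrow> real"
  assumes "0 \<le> d"
  shows "(LINT x:{0..d}|lborel. f x) = d * (LINT u:{0..1}|lborel. f (u * d))"
proof (cases "d = 0")
  case True
  have "AE x in lborel. indicat_real {0..d} x *\<^sub>R f x = 0"
    using AE_lborel_singleton[of 0] by eventually_elim (auto simp: True indicator_def)
  then show ?thesis by (simp add: set_lebesgue_integral_def integral_eq_zero_AE True)
next
  case False
  with assms have d: "0 < d" by simp
  have "(LINT x:{0..d}|lborel. f x) = \<bar>d\<bar> *\<^sub>R (\<integral>x. indicator {0..d} (0 + d * x) *\<^sub>R f (0 + d * x) \<partial>lborel)"
    unfolding set_lebesgue_integral_def using d by (intro lborel_integral_real_affine) auto
  also have "(\<lambda>x. indicator {0..d} (0 + d * x) *\<^sub>R f (0 + d * x)) = (\<lambda>u. indicator {0..1} u *\<^sub>R f (u * d))"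
    using d by (auto simp: fun_eq_iff indicator_def mult.commute zero_le_mult_iff)
  finally show ?thesis using d by (simp add: set_lebesgue_integral_def)
qed

abbreviation unit_uniform :: "real measure" where
  "unit_uniform \<equiv> density lborel (\<lambda>u::real. ennreal (indicat_real {0..1} u))"

text \<open>One sample path of the queue, without probability. G and F extend the total and the
  class 2 input to negative times; the raw paths j1 and j2 are tied to them only on [0,
  \<infinity>). \<open>drift\<close> is the pathwise property that \<open>AE_continuous_part\<close>
  provides almost surely.\<close>

locale queue_paths = G: input_path G + F: input_path F for G F :: "real \<Rightarrow> real" +
  fixes j1 j2 :: "real \<Rightarrow> real" and c :: real
  assumes c: "0 \<le> c"
    and G: "\<And>s. 0 \<le> s \<Longrightarrow> G s = j1 s + j2 s"
    and F: "\<And>s. 0 \<le> s \<Longrightarrow> F s = j2 s"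
    and drift: "\<And>t. 0 < t \<Longrightarrow> (LINT s:{0<..t}|F.\<mu>. indicator F.no_jump s) = c * t"
begin

lemma workload_eq: "0 \<le> s \<Longrightarrow> workload j1 j2 s = G.W s"
proof -
  assume s: "0 \<le> s"
  have "(INF r\<in>{0..s}. j1 r + j2 r - r) = (INF r\<in>{0..s}. G r - r)"
    by (intro INF_cong) (auto simp: G)
  then show ?thesis
    using s by (simp add: workload_def reflection_def G.W_def idle_time_def G)
qed

lemma left_lim_workload: "0 < s \<Longrightarrow> left_lim (workload j1 j2) s = G.W_left s"
proof -
  assume s: "0 < s"
  have "(workload j1 j2 \<longlongrightarrow> G.W_left s) (at_left s)"
    using G.W_tendsto_left[OF s]
    by (rule Lim_transform_eventually) (use s in \<open>auto simp: eventually_at_left[of 0] workload_eq intro!: exI[of _ 0]\<close>)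
  then show ?thesis unfolding left_lim_def by (rule tendsto_Lim[rotated]) simp
qed

lemma jump_eq: "0 < s \<Longrightarrow> jump j2 s = jump F s"
proof -
  assume s: "0 < s"
  have "(j2 \<longlongrightarrow> left_lim F s) (at_left s)"
    using F.tendsto_left_lim[of s]
    by (rule Lim_transform_eventually) (use s in \<open>auto simp: eventually_at_left[of 0] F intro!: exI[of _ 0]\<close>)
  then have "left_lim j2 s = left_lim F s" unfolding left_lim_def[of j2] by (rule tendsto_Lim[rotated]) simp
  then show ?thesis using s by (simp add: jump_def F)
qed

definition content :: "real \<times> real \<Rightarrow> real" where
  "content = (\<lambda>(s, u). G.W_left s + u * jump F s)"

abbreviation arrival_time :: "real \<Rightarrow> real measure" where
  "arrival_time t \<equiv> density F.\<mu> (\<lambda>s. ennreal (indicat_real {0<..t} s / F t))"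

text \<open>Picks one of the class 2 particles arriving up to t: its arrival time by the normalised
  Stieltjes measure, its location as a uniform fraction of the batch. The content average thereby
  becomes an expectation, and weak convergence applies.\<close>

definition arrival_law :: "real \<Rightarrow> (real \<times> real) measure" where
  "arrival_law t = arrival_time t \<Otimes>\<^sub>M unit_uniform"

definition content_law :: "real \<Rightarrow> real measure" where
  "content_law t = distr (arrival_law t) borel content"

lemma sets_arrival_law [measurable_cong]: "sets (arrival_law t) = sets (borel \<Otimes>\<^sub>M borel)"
  unfolding arrival_law_def by (intro sets_pair_measure_cong) simp_all

lemma measurable_content [measurable]: "content \<in> borel_measurable (borel \<Otimes>\<^sub>M borel)"
  unfolding content_def by measurable

lemma prob_space_uniform_unit: "prob_space unit_uniform"
  by (rule prob_spaceI) (simp add: emeasure_density ennreal_indicator)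

lemma prob_space_arrival_time:
  assumes "0 < t" "0 < F t"
  shows "prob_space (arrival_time t)"
proof (rule prob_spaceI)
  have "(\<integral>\<^sup>+s. ennreal (indicat_real {0<..t} s / F t) \<partial>F.\<mu>) = (\<integral>\<^sup>+s. ennreal (1 / F t) * indicator {0<..t} s \<partial>F.\<mu>)"
    by (intro nn_integral_cong) (auto simp: indicator_def)
  also have "\<dots> = ennreal (1 / F t) * ennreal (F t)"
    using assms by (subst nn_integral_cmult_indicator) (auto simp: F.emeasure_Ioc F.zero)
  also have "\<dots> = 1" using assms by (simp add: ennreal_mult[symmetric])
  finally show "emeasure (arrival_time t) (space (arrival_time t)) = 1"
    by (simp add: emeasure_density)
qed

lemma real_distribution_content_law:
  assumes "0 < t" "0 < F t"
  shows "real_distribution (content_law t)"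
proof -
  interpret S: prob_space "arrival_time t"
    by (rule prob_space_arrival_time[OF assms])
  interpret U: prob_space "unit_uniform"
    by (rule prob_space_uniform_unit)
  interpret P: pair_prob_space "arrival_time t" "unit_uniform" ..
  have "prob_space (content_law t)"
    unfolding content_law_def arrival_law_def by (rule P.prob_space_distr) simp
  then show ?thesis
    by (simp add: real_distribution_def real_distribution_axioms_def content_law_def)
qed

lemma integral_content_law:
  fixes f :: "real \<Rightarrow> real"
  assumes t: "0 < t" "0 < F t" and [measurable]: "f \<in> borel_measurable borel" and f: "\<And>x. \<bar>f x\<bar> \<le> B"
  shows "(LINT x|content_law t. f x) = (LINT s:{0<..t}|F.\<mu>. LINT u:{0..1}|lborel. f (G.W_left s + u * jump F s)) / F t"
proof -
  interpret S: prob_space "arrival_time t"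
    by (rule prob_space_arrival_time[OF t])
  interpret U: prob_space "unit_uniform"
    by (rule prob_space_uniform_unit)
  interpret P: pair_prob_space "arrival_time t" "unit_uniform" ..
  have "(LINT x|content_law t. f x) = (LINT z|arrival_law t. f (content z))"
    unfolding content_law_def by (rule integral_distr) auto
  also have "\<dots> = (LINT s|arrival_time t. (LINT u|unit_uniform. f (content (s, u))))"
    unfolding arrival_law_def
    by (rule P.integral_fst'[symmetric]) (use f in \<open>intro P.integrable_const_bound[of _ B], auto\<close>)
  also have "\<dots> = (LINT s|arrival_time t. (LINT u:{0..1}|lborel. f (G.W_left s + u * jump F s)))"
    by (intro Bochner_Integration.integral_cong refl)
       (simp add: integral_density set_lebesgue_integral_def content_def)
  also have "\<dots> = (LINT s|F.\<mu>. (indicat_real {0<..t} s / F t) *\<^sub>R (LINT u:{0..1}|lborel. f (G.W_left s + u * jump F s)))"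
    using t by (intro integral_density) (auto simp: set_lebesgue_integral_def)
  finally show ?thesis
    by (simp add: set_lebesgue_integral_def)
qed

text \<open>The Stieltjes integral splits into its jump-free part, which becomes the time integral
  with factor c, and its atoms, which become the batches after rescaling each batch to the unit
  interval.\<close>

lemma content_average_eq:
  fixes f :: "real \<Rightarrow> real"
  assumes t: "0 < t" "0 < F t" and cont: "continuous_on {0..} f" and bdd: "bounded (f ` {0..})"
  shows "content_average c j1 j2 f t = (LINT x|content_law t. f (max 0 x))"
proof -
  \<comment> \<open>Values of f on negative arguments are arbitrary; g is continuous and bounded on
    the whole line.\<close>
  define g where "g x = f (max 0 x)" for x
  have "continuous_on UNIV g"
    unfolding g_def by (intro continuous_on_compose2[OF cont] continuous_intros) auto
  then have [measurable]: "g \<in> borel_measurable borel" by (rule borel_measurable_continuous_onI)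
  obtain B where "\<And>x. 0 \<le> x \<Longrightarrow> \<bar>f x\<bar> \<le> B" using bdd by (auto simp: bounded_iff)
  then have g: "\<bar>g x\<bar> \<le> B" for x by (simp add: g_def)
  define K where "K s = (LINT u:{0..1}|lborel. g (G.W_left s + u * jump F s))" for s
  have Km[measurable]: "K \<in> borel_measurable borel" unfolding K_def set_lebesgue_integral_def by measurable
  have KB: "\<bar>K s\<bar> \<le> B" for s
  proof -
    interpret U: prob_space "unit_uniform"
      by (rule prob_space_uniform_unit)
    have "K s = (LINT u|unit_uniform. g (G.W_left s + u * jump F s))"
      by (simp add: K_def integral_density set_lebesgue_integral_def)
    moreover have i: "integrable unit_uniform (\<lambda>u. g (G.W_left s + u * jump F s))"
      using g by (intro U.integrable_const_bound[of _ B]) auto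
    have "- B \<le> g x" "g x \<le> B" for x using g[of x] by auto
    then have "U.expectation (\<lambda>u. g (G.W_left s + u * jump F s)) \<le> B" "- B \<le> U.expectation (\<lambda>u. g (G.W_left s + u * jump F s))"
      by (auto intro!: U.integral_le_const U.integral_ge_const i)
    ultimately show ?thesis by (simp add: abs_le_iff)
  qed
  define D where "D = {0<..t} - F.no_jump"
  have D: "countable D" "D \<subseteq> {0<..t}"
    using F.countable_jumps by (auto simp: D_def F.no_jump_def intro: countable_subset[rotated])
  have [measurable]: "D \<in> sets borel" unfolding D_def by measurable
  have iK: "integrable F.\<mu> (\<lambda>s. indicat_real {0<..t} s * (indicator X s * K s))" if "X \<in> sets borel" for X
    using that KB order.trans[OF abs_ge_zero KB] by (intro F.integrable_bounded_Ioc[where B = B]) (auto simp: indicator_def)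
  have e: "indicat_real {0<..t} s *\<^sub>R K s = indicat_real {0<..t} s * (indicator F.no_jump s * K s) + indicat_real {0<..t} s * (indicator D s * K s)"
    "indicat_real ({0<..t} \<inter> F.no_jump) s *\<^sub>R K s = indicat_real {0<..t} s * (indicator F.no_jump s * K s)"
    "indicat_real D s *\<^sub>R K s = indicat_real {0<..t} s * (indicator D s * K s)" for s
    by (auto simp: D_def indicator_def)
  have "(LINT s:{0<..t}|F.\<mu>. K s) = (LINT s:{0<..t} \<inter> F.no_jump|F.\<mu>. K s) + (LINT s:D|F.\<mu>. K s)"
    unfolding set_lebesgue_integral_def e by (intro Bochner_Integration.integral_add iK) measurable
  also have "(LINT s:{0<..t} \<inter> F.no_jump|F.\<mu>. K s) = c * (LINT s:{0<..t}|lborel. K s)"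
    by (rule F.integral_continuous_part[OF c drift Km t(1)])
  also have "(LINT s:{0<..t}|lborel. K s) = (LINT s:{0..t}|lborel. f (workload j1 j2 s))"
    unfolding set_lebesgue_integral_def
  proof (rule integral_cong_AE)
    \<comment> \<open>A countable, hence Lebesgue null, set. Outside it there is no batch and the
      workload equals its left limit; 0 accounts for the two intervals (0, t] and [0, t].\<close>
    let ?E = "{s. jump F s \<noteq> 0} \<union> {s. jump G s \<noteq> 0} \<union> {0}"
    have nE: "AE s in lborel. s \<notin> ?E"
      using F.countable_jumps G.countable_jumps
      by (intro AE_not_in countable_imp_null_set_lborel) auto
    have eq: "indicat_real {0<..t} s *\<^sub>R K s = indicat_real {0..t} s *\<^sub>R f (workload j1 j2 s)" if "s \<notin> ?E" for s
    proof (cases "0 < s")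
      case True
      then have "workload j1 j2 s = G.W_left s" using that by (simp add: workload_eq G.W_left_eq_W)
      then have "K s = f (workload j1 j2 s)"
        using that G.W_left_nonneg[OF True] by (simp add: K_def g_def set_lebesgue_integral_def)
      then show ?thesis using True by (simp add: indicator_def)
    qed (use that in \<open>auto simp: indicator_def\<close>)
    show "AE s in lborel. indicat_real {0<..t} s *\<^sub>R K s = indicat_real {0..t} s *\<^sub>R f (workload j1 j2 s)"
      by (rule eventually_mono[OF nE]) (rule eq)
    show "(\<lambda>s. indicat_real {0..t} s *\<^sub>R f (workload j1 j2 s)) \<in> borel_measurable lborel"
    proof -
      have "(\<lambda>s. indicat_real {0..t} s *\<^sub>R f (workload j1 j2 s)) = (\<lambda>s. indicat_real {0..t} s * g (G.W (max 0 s)))"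
        by (auto simp: fun_eq_iff indicator_def workload_eq g_def G.W_nonneg max_def)
      moreover have "(\<lambda>s. G.W (max 0 s)) \<in> borel_measurable borel"
      proof -
        have "mono (\<lambda>s. idle_time G (max 0 s))" by (intro monoI G.idle_time_mono) auto
        then have [measurable]: "(\<lambda>s. idle_time G (max 0 s)) \<in> borel_measurable borel" by (rule borel_measurable_mono)
        show ?thesis unfolding G.W_def by measurable
      qed
      ultimately show ?thesis by simp
    qed
  qed measurable
  also have "(LINT s:D|F.\<mu>. K s) = infsum (\<lambda>s. jump F s * K s) D"
    by (rule F.integral_jumps[OF D Km KB])
  also have "\<dots> = (\<Sum>\<^sub>\<infinity>s\<in>{0<..t}. LINT x:{0..jump j2 s}|lborel. f (left_lim (workload j1 j2) s + x))"
  proof (rule infsum_cong_neutral)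
    have *: "(LINT x:{0..jump j2 s}|lborel. f (left_lim (workload j1 j2) s + x)) = jump F s * K s" if "s \<in> {0<..t}" for s
    proof -
      have s: "0 < s" using that by simp
      have "(LINT x:{0..jump j2 s}|lborel. f (left_lim (workload j1 j2) s + x)) = (LINT x:{0..jump F s}|lborel. g (G.W_left s + x))"
        unfolding jump_eq[OF s] left_lim_workload[OF s] set_lebesgue_integral_def
        using G.W_left_nonneg[OF s] by (intro Bochner_Integration.integral_cong) (auto simp: g_def indicator_def)
      also have "\<dots> = jump F s * K s"
        unfolding K_def by (rule lborel_integral_Icc_scale[OF F.jump_nonneg])
      finally show ?thesis .
    qed
    show "(LINT x:{0..jump j2 s}|lborel. f (left_lim (workload j1 j2) s + x)) = 0" if "s \<in> {0<..t} - D" for s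
      using *[of s] that by (auto simp: D_def F.no_jump_def)
    show "jump F s * K s = (LINT x:{0..jump j2 s}|lborel. f (left_lim (workload j1 j2) s + x))" if "s \<in> D \<inter> {0<..t}" for s
      using *[of s] that by simp
  qed (use D in auto)
  finally have "(LINT s:{0<..t}|F.\<mu>. K s) / F t = content_average c j1 j2 f t"
    using t by (simp add: content_average_def F)
  then show ?thesis
    using integral_content_law[OF t, of g B] g by (simp add: K_def g_def)
qed

text \<open>Averaging exp(-b u d) over the uniform location u in a batch of size d gives
  \<open>exp_slope b d / b\<close>, by \<open>exp_slope_eq_integral\<close>.\<close>

lemma laplace_content_law:
  assumes t: "0 < t" "0 < F t" and b: "0 < b"
  shows "(LINT x|content_law t. exp (- b * max 0 x)) =
    (LINT s:{0<..t}|F.\<mu>. exp (- b * G.W_left s) * exp_slope b (jump F s)) / (b * F t)"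
proof -
  have "(LINT x|content_law t. exp (- b * max 0 x)) =
      (LINT s:{0<..t}|F.\<mu>. LINT u:{0..1}|lborel. exp (- b * max 0 (G.W_left s + u * jump F s))) / F t"
    using b by (intro integral_content_law[OF t, where B = 1]) auto
  also have "(LINT s:{0<..t}|F.\<mu>. LINT u:{0..1}|lborel. exp (- b * max 0 (G.W_left s + u * jump F s))) =
      (LINT s:{0<..t}|F.\<mu>. exp (- b * G.W_left s) * exp_slope b (jump F s) / b)"
  proof (rule set_lebesgue_integral_cong)
    show "\<forall>s. s \<in> {0<..t} \<longrightarrow> (LINT u:{0..1}|lborel. exp (- b * max 0 (G.W_left s + u * jump F s))) =
        exp (- b * G.W_left s) * exp_slope b (jump F s) / b"
    proof (intro allI impI)
      fix s assume "s \<in> {0<..t}"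
      then have "0 \<le> G.W_left s" by (intro G.W_left_nonneg) auto
      then have "(LINT u:{0..1}|lborel. exp (- b * max 0 (G.W_left s + u * jump F s))) =
          (LINT u:{0..1}|lborel. exp (- b * G.W_left s) * exp (- b * (u * jump F s)))"
        using F.jump_nonneg[of s]
        by (intro set_lebesgue_integral_cong) (auto simp: exp_add[symmetric] algebra_simps)
      also have "\<dots> = exp (- b * G.W_left s) * (exp_slope b (jump F s) / b)"
        using b by (simp add: exp_slope_eq_integral)
      finally show "(LINT u:{0..1}|lborel. exp (- b * max 0 (G.W_left s + u * jump F s))) =
        exp (- b * G.W_left s) * exp_slope b (jump F s) / b" by simp
    qed
  qed simp
  finally show ?thesis by simp
qed

end

section \<open>Weak convergence from Laplace transforms\<close>

text \<open>Transforms at integer arguments are the moments of the image. Mass that escapes to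
  infinity does not get lost but collects at 0.\<close>

definition exp_image :: "real measure \<Rightarrow> real measure" where
  "exp_image N = distr N borel (\<lambda>x. exp (- max 0 x))"

lemma real_distribution_exp_image:
  assumes "real_distribution N" shows "real_distribution (exp_image N)"
proof -
  interpret real_distribution N by fact
  show ?thesis unfolding exp_image_def by (rule real_distribution_distr) simp
qed

lemma integral_exp_image:
  fixes f :: "real \<Rightarrow> 'b::{banach, second_countable_topology}"
  assumes "real_distribution N" "f \<in> borel_measurable borel"
  shows "(LINT u|exp_image N. f u) = (LINT x|N. f (exp (- max 0 x)))"
proof -
  interpret real_distribution N by fact
  show ?thesis unfolding exp_image_def using assms(2) by (intro integral_distr) simp_all
qed

lemma AE_exp_image: "real_distribution N \<Longrightarrow> AE u in exp_image N. 0 < u \<and> u \<le> 1"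
proof -
  assume "real_distribution N"
  then interpret real_distribution N .
  show ?thesis unfolding exp_image_def by (subst AE_distr_iff) auto
qed

text \<open>The image lives on (0, 1], so all its moments are at most 1 and the Taylor remainder of
  the characteristic function is bounded uniformly over all laws.\<close>

lemma char_exp_image_approx:
  assumes N: "real_distribution N"
  shows "cmod (char (exp_image N) \<theta> - (\<Sum>k\<le>n. ((\<i> * \<theta>) ^ k / fact k) * (LINT x|N. exp (- real k * max 0 x))))
    \<le> 2 * \<bar>\<theta>\<bar> ^ n / fact n"
proof -
  interpret N: real_distribution N by fact
  interpret E: real_distribution "exp_image N" by (rule real_distribution_exp_image[OF N])
  have m: "E.expectation (\<lambda>u. u ^ k) = (LINT x|N. exp (- real k * max 0 x))" for k
    by (subst integral_exp_image[OF N]) (auto simp: exp_of_nat_mult[symmetric])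
  have i: "integrable (exp_image N) (\<lambda>u. u ^ k)" for k
  proof (rule E.integrable_const_bound[of _ 1])
    show "AE u in exp_image N. norm (u ^ k) \<le> 1"
      using AE_exp_image[OF N] by eventually_elim (auto intro: power_le_one)
  qed simp
  have le: "cmod (char (exp_image N) \<theta> - (\<Sum>k\<le>n. ((\<i> * \<theta>) ^ k / fact k) * E.expectation (\<lambda>u. u ^ k)))
      \<le> (2 * \<bar>\<theta>\<bar> ^ n / fact n) * E.expectation (\<lambda>u. \<bar>u\<bar> ^ n)"
    by (rule E.char_approx1) (rule i)
  have "E.expectation (\<lambda>u. \<bar>u\<bar> ^ n) \<le> 1"
  proof (rule E.integral_le_const)
    show "integrable (exp_image N) (\<lambda>u. \<bar>u\<bar> ^ n)"
      using integrable_abs[OF i[of n]] by (simp add: power_abs)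
    show "AE u in exp_image N. \<bar>u\<bar> ^ n \<le> 1"
      using AE_exp_image[OF N] by eventually_elim (auto intro: power_le_one)
  qed
  then have "(2 * \<bar>\<theta>\<bar> ^ n / fact n) * E.expectation (\<lambda>u. \<bar>u\<bar> ^ n) \<le> (2 * \<bar>\<theta>\<bar> ^ n / fact n) * 1"
    by (intro mult_left_mono) auto
  with le show ?thesis unfolding m by linarith
qed

text \<open>The Taylor polynomials converge because their coefficients are transforms at integers,
  and the remainders are uniformly small.\<close>

lemma char_exp_image_tendsto:
  assumes E: "\<And>n. real_distribution (E n)" and N: "real_distribution N"
    and lim: "\<And>k. 0 < k \<Longrightarrow> (\<lambda>n. LINT x|E n. exp (- real k * max 0 x)) \<longlonglongrightarrow> (LINT x|N. exp (- real k * max 0 x))"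
  shows "(\<lambda>n. char (exp_image (E n)) \<theta>) \<longlonglongrightarrow> char (exp_image N) \<theta>"
proof (rule LIMSEQ_I)
  fix r :: real assume r: "0 < r"
  have "(\<lambda>n. 2 * (\<bar>\<theta>\<bar> ^ n / fact n)) \<longlonglongrightarrow> 2 * 0"
    using summable_LIMSEQ_zero[OF summable_exp[of "\<bar>\<theta>\<bar>"]]
    by (intro tendsto_mult tendsto_const) (simp add: divide_inverse mult.commute)
  then have "\<forall>\<^sub>F n in sequentially. 2 * (\<bar>\<theta>\<bar> ^ n / fact n) < r / 3"
    using r by (intro order_tendstoD(2)) auto
  then obtain n where n: "2 * \<bar>\<theta>\<bar> ^ n / fact n < r / 3"
    by (auto simp: eventually_sequentially)
  let ?S = "\<lambda>L. \<Sum>k\<le>n. ((\<i> * \<theta>) ^ k / fact k) * complex_of_real (LINT x|L. exp (- real k * max 0 x))"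
  have lim0: "(\<lambda>m. LINT x|E m. exp (- real k * max 0 x)) \<longlonglongrightarrow> (LINT x|N. exp (- real k * max 0 x))" for k
  proof (cases "k = 0")
    case True
    have "measure (E m) (space (E m)) = 1" "measure N (space N) = 1" for m
      using E N by (auto simp: real_distribution_def prob_space.prob_space)
    then show ?thesis using True by simp
  qed (use lim in simp)
  have "(\<lambda>m. ?S (E m)) \<longlonglongrightarrow> ?S N"
    by (intro tendsto_intros lim0)
  then have "\<forall>\<^sub>F m in sequentially. dist (?S (E m)) (?S N) < r / 3"
    using r by (intro tendstoD) auto
  then obtain M where M: "\<And>m. M \<le> m \<Longrightarrow> cmod (?S (E m) - ?S N) < r / 3"
    by (auto simp: eventually_sequentially dist_norm)
  show "\<exists>M. \<forall>m\<ge>M. norm (char (exp_image (E m)) \<theta> - char (exp_image N) \<theta>) < r"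
  proof (intro exI allI impI)
    fix m assume m: "M \<le> m"
    have "norm (char (exp_image (E m)) \<theta> - char (exp_image N) \<theta>) \<le>
        cmod (char (exp_image (E m)) \<theta> - ?S (E m)) + cmod (?S (E m) - ?S N) + cmod (char (exp_image N) \<theta> - ?S N)"
    proof -
      have eq: "char (exp_image (E m)) \<theta> - char (exp_image N) \<theta> =
          (char (exp_image (E m)) \<theta> - ?S (E m)) + (?S (E m) - ?S N) - (char (exp_image N) \<theta> - ?S N)" by simp
      have tri: "cmod (x + y - z) \<le> cmod x + cmod y + cmod z" for x y z
        using norm_triangle_ineq4[of "x + y" z] norm_triangle_ineq[of x y] by linarith
      show ?thesis unfolding eq by (rule tri)
    qed
    also have "\<dots> < r"
      using char_exp_image_approx[OF E, of m \<theta> n] char_exp_image_approx[OF N, of \<theta> n] M[OF m] n by linarith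
    finally show "norm (char (exp_image (E m)) \<theta> - char (exp_image N) \<theta>) < r" .
  qed
qed

text \<open>By Levy continuity the images converge weakly. Read in u = exp(-x), a bounded continuous
  f becomes \<open>g\<close>, which is discontinuous at most at u = 0; the image of N has no mass
  there, so bounded functions continuous almost everywhere are covered.\<close>

lemma laplace_limit_imp_weak_limit:
  fixes f :: "real \<Rightarrow> real"
  assumes E: "\<And>n. real_distribution (E n)" and N: "real_distribution N"
    and lim: "\<And>k. 0 < k \<Longrightarrow> (\<lambda>n. LINT x|E n. exp (- real k * max 0 x)) \<longlonglongrightarrow> (LINT x|N. exp (- real k * max 0 x))"
    and cont: "continuous_on {0..} f" and bdd: "bounded (f ` {0..})"
  shows "(\<lambda>n. LINT x|E n. f (max 0 x)) \<longlonglongrightarrow> (LINT x|N. f (max 0 x))"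
proof -
  define g where "g u = (if u \<le> 0 then 0 else f (max 0 (- ln u)))" for u :: real
  have gc: "isCont g u" if "u \<noteq> 0" for u
  proof (cases "u < 0")
    case True
    have "\<forall>\<^sub>F y in nhds u. g y = 0"
      using eventually_nhds_in_open[of "{..<0}" u] True by (auto elim!: eventually_mono simp: g_def)
    then show ?thesis by (subst isCont_cong) auto
  next
    case False
    with that have u: "0 < u" by simp
    have "continuous_on {0<..} (\<lambda>u. f (max 0 (- ln u)))"
      by (intro continuous_on_compose2[OF cont] continuous_intros) auto
    then have "isCont (\<lambda>u. f (max 0 (- ln u))) u"
      using u by (simp add: continuous_on_eq_continuous_at)
    moreover have "\<forall>\<^sub>F y in nhds u. g y = f (max 0 (- ln y))"
      using eventually_nhds_in_open[of "{0<..}" u] u by (auto elim!: eventually_mono simp: g_def)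
    ultimately show ?thesis by (subst isCont_cong) auto
  qed
  obtain B where B: "\<And>x. 0 \<le> x \<Longrightarrow> \<bar>f x\<bar> \<le> B" using bdd by (auto simp: bounded_iff)
  have gB: "\<bar>g u\<bar> \<le> \<bar>B\<bar>" for u using B[of "max 0 (- ln u)"] by (auto simp: g_def)
  have cm: "continuous_on UNIV (\<lambda>x. f (max 0 x))"
    by (intro continuous_on_compose2[OF cont] continuous_intros) auto
  then have [measurable]: "(\<lambda>x. f (max 0 x)) \<in> borel_measurable borel" by (rule borel_measurable_continuous_onI)
  have gm[measurable]: "g \<in> borel_measurable borel"
    unfolding g_def by measurable
  have ge: "g (exp (- max 0 x)) = f (max 0 x)" for x by (simp add: g_def max_def)
  have rd: "real_distribution (exp_image (E n))" "real_distribution (exp_image N)" for n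
    using E N by (auto intro: real_distribution_exp_image)
  have wc: "weak_conv_m (\<lambda>n. exp_image (E n)) (exp_image N)"
    by (intro levy_continuity rd char_exp_image_tendsto[OF E N lim])
  have "{x. \<not> isCont g x} \<subseteq> {0}" using gc by auto
  moreover have "emeasure (exp_image N) {0} = 0"
  proof -
    interpret N: real_distribution N by fact
    have "(\<lambda>x. exp (- max 0 x)) -` {0} = ({} :: real set)" by auto
    then show ?thesis by (simp add: exp_image_def emeasure_distr)
  qed
  ultimately have z: "emeasure (exp_image N) {x. \<not> isCont g x} = 0"
    by (metis (no_types, lifting) emeasure_empty subset_singletonD)
  have "(\<lambda>n. LINT u|exp_image (E n). g u) \<longlonglongrightarrow> (LINT u|exp_image N. g u)"
    by (rule weak_conv_imp_bdd_ae_continuous_conv[OF rd(1) rd(2) wc z _ gm]) (use gB in auto)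
  then show ?thesis
    by (simp add: integral_exp_image[OF E gm] integral_exp_image[OF N gm] ge)
qed

text \<open>Tightness of the images is automatic on (0, 1], but their limit L could have an atom at
  0. The transforms at 1/k are the means of u powr (1/k) and tend to the L-mass of {u > 0};
  \<open>\<psi> (1 / k)\<close> tending to 1 excludes the atom, and -ln carries L back.\<close>

lemma laplace_limit_imp_ex_distribution:
  fixes \<psi> :: "real \<Rightarrow> real"
  assumes E: "\<And>n. real_distribution (E n)"
    and lim: "\<And>k. (\<lambda>n. LINT x|E n. exp (- real (Suc k) * max 0 x)) \<longlonglongrightarrow> \<psi> (real (Suc k))"
    and lim': "\<And>k. (\<lambda>n. LINT x|E n. exp (- (1 / real (Suc k)) * max 0 x)) \<longlonglongrightarrow> \<psi> (1 / real (Suc k))"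
    and \<psi>: "(\<lambda>k. \<psi> (1 / real (Suc k))) \<longlonglongrightarrow> 1"
  shows "\<exists>N. real_distribution N \<and> (AE x in N. 0 \<le> x) \<and> (\<forall>k. (LINT x|N. exp (- real (Suc k) * max 0 x)) = \<psi> (real (Suc k)))"
proof -
  have rd: "real_distribution (exp_image (E n))" for n by (intro real_distribution_exp_image E)
  have "tight (\<lambda>n. exp_image (E n))"
    unfolding tight_def
  proof (intro conjI allI impI rd)
    fix e :: real assume e: "0 < e"
    have "measure (exp_image (E n)) {- 1<..1} = 1" for n
    proof -
      interpret X: real_distribution "exp_image (E n)" by (rule rd)
      show ?thesis using AE_exp_image[OF E, of n]
        by (subst X.prob_eq_1) (auto elim!: eventually_mono)
    qed
    then show "\<exists>a b. a < b \<and> (\<forall>n. 1 - e < measure (exp_image (E n)) {a<..b})"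
      using e by (intro exI[of _ "-1"] exI[of _ 1]) auto
  qed
  then obtain r L where r: "strict_mono (r :: nat \<Rightarrow> nat)" and L: "real_distribution L"
    and wc: "weak_conv_m ((\<lambda>n. exp_image (E n)) \<circ> (\<lambda>n. n) \<circ> r) L"
    using tight_imp_convergent_subsubsequence[of "\<lambda>n. exp_image (E n)" "\<lambda>n. n"] by (auto simp: strict_mono_def)
  interpret L: real_distribution L by fact
  have conv: "(\<lambda>n. LINT x|E (r n). g (exp (- max 0 x))) \<longlonglongrightarrow> (LINT u|L. g u)"
    if g: "\<And>u. isCont g u" "\<And>u. \<bar>g u\<bar> \<le> 1" for g :: "real \<Rightarrow> real"
  proof -
    have gm: "g \<in> borel_measurable borel"
      using g(1) by (intro borel_measurable_continuous_onI continuous_at_imp_continuous_on) auto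
    have "(\<lambda>n. LINT u|((\<lambda>n. exp_image (E n)) \<circ> (\<lambda>n. n) \<circ> r) n. g u) \<longlonglongrightarrow> (LINT u|L. g u)"
      by (rule weak_conv_imp_integral_bdd_continuous_conv[OF _ L wc, where B = 1]) (use rd g in auto)
    then show ?thesis by (simp add: integral_exp_image[OF E gm])
  qed
  \<comment> \<open>Clipped to [0, 1], so that it is a bounded continuous test function on the whole
    line, as weak convergence requires.\<close>
  define p where "p b u = (max 0 (min 1 u)) powr b" for b u :: real
  have pe: "p b (exp (- max 0 x)) = exp (- b * max 0 x)" for b x
    by (simp add: p_def exp_powr_real mult.commute)
  have p1: "\<bar>p b u\<bar> \<le> 1" if "0 \<le> b" for b u
    using that by (auto simp: p_def intro: powr_le1)
  have pc: "isCont (p b) u" if "0 < b" for b u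
  proof -
    have "continuous_on UNIV (p b)" unfolding p_def
      using that by (intro continuous_on_powr' continuous_intros) auto
    then show ?thesis by (simp add: continuous_on_eq_continuous_at)
  qed
  have Lp: "(LINT u|L. p (real (Suc k)) u) = \<psi> (real (Suc k))"
      "(LINT u|L. p (1 / real (Suc k)) u) = \<psi> (1 / real (Suc k))" for k
    using LIMSEQ_unique[OF conv[OF pc p1] LIMSEQ_subseq_LIMSEQ[OF lim[of k] r, unfolded o_def, folded pe]]
      LIMSEQ_unique[OF conv[OF pc p1] LIMSEQ_subseq_LIMSEQ[OF lim'[of k] r, unfolded o_def, folded pe]]
    by simp_all
  have "AE u in L. 0 < u \<and> u \<le> 1"
  proof -
    \<comment> \<open>A test function that is positive exactly above 1, where none of the
      approximating laws has mass.\<close>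
    have "isCont (\<lambda>u::real. min 1 (max 0 (u - 1))) u" for u by (intro continuous_intros)
    then have "(\<lambda>n. LINT x|E (r n). min 1 (max 0 (exp (- max 0 x) - 1))) \<longlonglongrightarrow> (LINT u|L. min 1 (max 0 (u - 1)))"
      by (rule conv) auto
    moreover have "min 1 (max 0 (exp (- max 0 x) - 1)) = 0" for x :: real by (auto simp: max_def min_def)
    ultimately have "(LINT u|L. min 1 (max 0 (u - 1))) = 0" by (simp add: LIMSEQ_const_iff)
    moreover have "integrable L (\<lambda>u. min 1 (max 0 (u - 1)))"
      by (rule L.integrable_const_bound[of _ 1]) auto
    ultimately have 1: "AE u in L. min 1 (max 0 (u - 1)) = 0"
      by (subst (asm) integral_nonneg_eq_0_iff_AE) auto
    \<comment> \<open>As the exponent decreases to 0, the clipped power tends to 1 for u > 0 and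
      stays 0 otherwise.\<close>
    have "(\<lambda>k. LINT u|L. p (1 / real (Suc k)) u) \<longlonglongrightarrow> (LINT u|L. indicat_real {0<..} u)"
    proof (rule integral_dominated_convergence[where w = "\<lambda>_. 1"])
      show "AE u in L. (\<lambda>k. p (1 / real (Suc k)) u) \<longlonglongrightarrow> indicator {0<..} u"
      proof (rule AE_I2)
        fix u :: real
        show "(\<lambda>k. p (1 / real (Suc k)) u) \<longlonglongrightarrow> indicator {0<..} u"
        proof (cases "0 < u")
          case True
          have "(\<lambda>k. (max 0 (min 1 u)) powr (1 / real (Suc k))) \<longlonglongrightarrow> (max 0 (min 1 u)) powr 0"
            using True LIMSEQ_Suc[OF lim_1_over_n] by (intro tendsto_powr tendsto_const) auto
          moreover have "max 0 (min 1 u) powr 0 = indicat_real {0<..} u" using True by (simp add: min_def)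
          ultimately show ?thesis by (simp only: p_def)
        qed (simp add: p_def)
      qed
      show "p (1 / real (Suc k)) \<in> borel_measurable L" for k
        unfolding p_def by measurable
    qed (use p1 in auto)
    then have "(LINT u|L. indicat_real {0<..} u) = 1"
      unfolding Lp using \<psi> by (rule LIMSEQ_unique)
    then have "L.prob {0<..} = 1" by simp
    then have "AE u in L. u \<in> {0<..}" by (subst (asm) L.prob_eq_1) auto
    with 1 show ?thesis by eventually_elim (auto split: if_splits simp: min_def max_def)
  qed
  note AE = this
  define N where "N = distr L borel (\<lambda>u. max 0 (- ln u))"
  have N: "real_distribution N" unfolding N_def by (rule L.real_distribution_distr) simp
  have "AE x in N. 0 \<le> x" unfolding N_def by (subst AE_distr_iff) auto
  moreover have "(LINT x|N. exp (- real (Suc k) * max 0 x)) = \<psi> (real (Suc k))" for k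
  proof -
    have "(LINT x|N. exp (- real (Suc k) * max 0 x)) = (LINT u|L. exp (- real (Suc k) * max 0 (max 0 (- ln u))))"
      unfolding N_def by (rule integral_distr) auto
    also have "\<dots> = (LINT u|L. p (real (Suc k)) u)"
    proof (rule integral_cong_AE)
      show "AE u in L. exp (- real (Suc k) * max 0 (max 0 (- ln u))) = p (real (Suc k)) u"
        using AE
      proof eventually_elim
        case (elim u)
        then have "max 0 (max 0 (- ln u)) = - ln u" "max 0 (min 1 u) = u" by auto
        then show ?case using elim by (simp add: p_def powr_def del: of_nat_Suc)
      qed
      show "p (real (Suc k)) \<in> borel_measurable L" unfolding p_def by measurable
    qed measurable
    finally show ?thesis using Lp by simp
  qed
  ultimately show ?thesis using N by blast
qed

section \<open>First passage times\<close>

locale input_function =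
  fixes K :: "real \<Rightarrow> real"
  assumes K_mono: "0 \<le> s \<Longrightarrow> s \<le> t \<Longrightarrow> K s \<le> K t" and K_0: "K 0 = 0"
begin

lemma K_nonneg: "0 \<le> t \<Longrightarrow> 0 \<le> K t"
  using K_mono[of 0 t] K_0 by simp

lemma waiting_iter_ge: "0 \<le> v \<Longrightarrow> v \<le> waiting_iter K v n"
  by (induction n) (auto intro: K_nonneg)

lemma waiting_iter_nonneg: "0 \<le> v \<Longrightarrow> 0 \<le> waiting_iter K v n"
  by (rule order.trans[OF _ waiting_iter_ge])

lemma waiting_iter_mono: "0 \<le> v \<Longrightarrow> incseq (waiting_iter K v)"
proof (rule incseq_SucI)
  fix n assume v: "0 \<le> v"
  show "waiting_iter K v n \<le> waiting_iter K v (Suc n)"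
  proof (induction n)
    case 0
    then show ?case using K_nonneg[OF v] by simp
  next
    case (Suc n)
    then show ?case using waiting_iter_nonneg[OF v] by (simp add: K_mono)
  qed
qed

text \<open>Every time by which the net input has covered v bounds all iterates, by monotonicity of
  K; this yields both convergence and minimality of the limit.\<close>

lemma waiting_iter_le: "0 \<le> v \<Longrightarrow> 0 \<le> t \<Longrightarrow> v + K t \<le> t \<Longrightarrow> waiting_iter K v n \<le> t"
proof (induction n)
  case 0
  then show ?case using K_nonneg[of t] by simp
next
  case (Suc n)
  then have "K (waiting_iter K v n) \<le> K t" by (intro K_mono waiting_iter_nonneg) auto
  with Suc.prems show ?case by simp
qed

lemma waiting_iter_tendsto:
  assumes "0 \<le> v" "0 \<le> t" "v + K t \<le> t"
  shows "waiting_iter K v \<longlonglongrightarrow> waiting_time K v"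
proof -
  have "Bseq (waiting_iter K v)"
    using waiting_iter_le[OF assms] waiting_iter_nonneg[OF assms(1)] by (intro BseqI'[of _ t]) auto
  then have "convergent (waiting_iter K v)"
    using waiting_iter_mono[OF assms(1)] by (intro Bseq_monoseq_convergent) (auto simp: incseq_imp_monoseq)
  then show ?thesis by (simp add: convergent_LIMSEQ_iff waiting_time_def)
qed

lemma waiting_time_le:
  assumes "0 \<le> v" "0 \<le> t" "v + K t \<le> t" shows "waiting_time K v \<le> t"
  using waiting_iter_tendsto[OF assms] waiting_iter_le[OF assms] by (intro LIMSEQ_le_const2) auto

lemma waiting_time_ge:
  assumes "0 \<le> v" "0 \<le> t" "v + K t \<le> t" shows "v \<le> waiting_time K v"
  using waiting_iter_tendsto[OF assms] waiting_iter_ge[OF assms(1)] by (intro LIMSEQ_le_const) auto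

text \<open>
  The waiting time is a first passage time of \<open>t - K t\<close> and is therefore squeezed by the first
  passage time of the walk on the grid of mesh \<open>h\<close>.
\<close>

lemma grid_point_below_waiting_time:
  assumes v: "0 \<le> v" and h: "0 < h" and t: "0 \<le> t" "v + h + K t \<le> t"
  shows "\<exists>j. v + K (real j * h) \<le> real j * h \<and> real j * h \<le> waiting_time K (v + h)"
proof -
  let ?T = "waiting_time K (v + h)"
  have vh: "0 \<le> v + h" using v h by simp
  note lim = waiting_iter_tendsto[OF vh t]
  have Tpos: "0 < ?T" using waiting_time_ge[OF vh t] v h by linarith
  \<comment> \<open>The last grid point strictly below the waiting time T for v + h. Strictness lets
    some iterate pass it, so that v + h + K (j h) <= T <= j h + h, and the extra h cancels.\<close>
  define j where "j = nat (\<lceil>?T / h\<rceil> - 1)"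
  have "0 < ?T / h" using Tpos h by simp
  then have "real j < ?T / h" "?T / h \<le> real j + 1" unfolding j_def by linarith+
  then have j: "real j * h < ?T" "?T \<le> real j * h + h" using h by (simp_all add: field_simps)
  have "\<forall>\<^sub>F n in sequentially. real j * h < waiting_iter K (v + h) n"
    by (rule order_tendstoD(1)[OF lim j(1)])
  then obtain n where n: "real j * h < waiting_iter K (v + h) n"
    by (auto simp: eventually_sequentially)
  have "waiting_iter K (v + h) (Suc n) \<le> ?T"
    by (rule incseq_le[OF waiting_iter_mono[OF vh] lim])
  moreover have "K (real j * h) \<le> K (waiting_iter K (v + h) n)" using n h by (intro K_mono) auto
  ultimately have "v + K (real j * h) \<le> real j * h" using j(2) by simp
  with j(1) show ?thesis by auto
qed

end

section \<open>The waiting time when the input is a subordinator\<close>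

context integrable_subordinator
begin

text \<open>Right continuity makes the process a limit of its values at the next grid time strictly
  to the right. Joint measurability is needed because each iterate evaluates the input at a random
  time.\<close>

lemma measurable_process: "(\<lambda>(t, \<omega>). J (max 0 t) \<omega>) \<in> borel_measurable (borel \<Otimes>\<^sub>M M)"
proof -
  define f where "f m z = J (real (nat \<lfloor>max 0 (fst z) * real (Suc m)\<rfloor> + 1) / real (Suc m)) (snd z)" for m :: nat and z :: "real \<times> 'a"
  have fm: "f m \<in> borel_measurable (borel \<Otimes>\<^sub>M M)" for m
  proof -
    have "(\<lambda>z. J (real (k + 1) / real (Suc m)) (snd z)) \<in> borel_measurable (borel \<Otimes>\<^sub>M M)" for k
      by (rule measurable_compose[OF measurable_snd measurable_J]) simp
    moreover have "(\<lambda>z::real \<times> 'a. nat \<lfloor>max 0 (fst z) * real (Suc m)\<rfloor>) \<in> borel \<Otimes>\<^sub>M M \<rightarrow>\<^sub>M count_space UNIV"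
      by measurable
    ultimately show ?thesis
      unfolding f_def by (rule measurable_compose_countable)
  qed
  show ?thesis
  proof (rule borel_measurable_LIMSEQ_real[OF _ fm])
    fix z assume "z \<in> space (borel \<Otimes>\<^sub>M M :: (real \<times> 'a) measure)"
    then obtain t \<omega> where z: "z = (t, \<omega>)" and \<omega>: "\<omega> \<in> space M" by (auto simp: space_pair_measure)
    let ?t = "max 0 t"
    let ?u = "\<lambda>m. real (nat \<lfloor>?t * real (Suc m)\<rfloor> + 1) / real (Suc m)"
    have gen: "r < real (nat \<lfloor>r * real (Suc m)\<rfloor> + 1) / real (Suc m) \<and> real (nat \<lfloor>r * real (Suc m)\<rfloor> + 1) / real (Suc m) \<le> r + 1 / real (Suc m)"
      if "0 \<le> r" for r :: real and m
    proof -
      have "0 \<le> r * real (Suc m)" using that by simp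
      then have "r * real (Suc m) < real (nat \<lfloor>r * real (Suc m)\<rfloor> + 1)" "real (nat \<lfloor>r * real (Suc m)\<rfloor> + 1) \<le> r * real (Suc m) + 1"
        by linarith+
      then show ?thesis
        by (simp add: pos_less_divide_eq pos_divide_le_eq distrib_right del: of_nat_Suc of_nat_add)
    qed
    have u: "?t < ?u m \<and> ?u m \<le> ?t + 1 / real (Suc m)" for m by (rule gen) simp
    have "(\<lambda>m. ?t + 1 / real (Suc m)) \<longlonglongrightarrow> ?t + 0"
      by (intro tendsto_add tendsto_const LIMSEQ_Suc[OF lim_1_over_n])
    then have "?u \<longlonglongrightarrow> ?t"
      using u by (intro tendsto_sandwich[of "\<lambda>_. ?t" ?u _ "\<lambda>m. ?t + 1 / real (Suc m)"]) (auto intro!: always_eventually less_imp_le simp del: of_nat_Suc)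
    then have "filterlim ?u (at_right ?t) sequentially"
      unfolding filterlim_at
    proof (intro conjI always_eventually allI)
      fix m
      show "?u m \<in> {?t<..}" using u[of m] by (simp only: greaterThan_iff)
      show "?u m \<noteq> ?t" using u[of m] by (metis less_irrefl)
    qed
    moreover have "((\<lambda>s. J s \<omega>) \<longlongrightarrow> J ?t \<omega>) (at_right ?t)"
      using J_right_cont[OF \<omega>, of ?t] by (simp add: continuous_within)
    ultimately have "(\<lambda>m. J (?u m) \<omega>) \<longlonglongrightarrow> J ?t \<omega>"
      by (rule filterlim_compose[rotated])
    then show "(\<lambda>m. f m z) \<longlonglongrightarrow> (case z of (t, \<omega>) \<Rightarrow> J (max 0 t) \<omega>)"
      by (simp add: f_def z del: of_nat_Suc)
  qed
qed

lemma input_function_J: "\<omega> \<in> space M \<Longrightarrow> 0 \<le> a \<Longrightarrow> input_function (\<lambda>t. J (a * t) \<omega>)"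
  by unfold_locales (auto intro!: J_mono mult_left_mono simp: J_zero)

text \<open>Every iterate is measurable by induction, and \<open>lim\<close> of a measurable
  sequence is measurable even where the sequence diverges.\<close>

lemma measurable_waiting_time:
  assumes a: "0 \<le> a"
  shows "(\<lambda>(v, \<omega>). waiting_time (\<lambda>t. J (a * t) \<omega>) v) \<in> borel_measurable (restrict_space borel {0..} \<Otimes>\<^sub>M M)"
proof -
  let ?N = "restrict_space borel {0..} \<Otimes>\<^sub>M M :: (real \<times> 'a) measure"
  have fst[measurable]: "fst \<in> borel_measurable ?N"
    by (rule measurable_compose[OF measurable_fst]) (simp add: measurable_restrict_space1)
  have "(\<lambda>z. waiting_iter (\<lambda>t. J (a * t) (snd z)) (fst z) n) \<in> borel_measurable ?N" for n
  proof (induction n)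
    case (Suc n)
    note Suc[measurable]
    have "(\<lambda>z. (a * waiting_iter (\<lambda>t. J (a * t) (snd z)) (fst z) n, snd z)) \<in> ?N \<rightarrow>\<^sub>M borel \<Otimes>\<^sub>M M"
      by (intro measurable_Pair borel_measurable_times borel_measurable_const Suc measurable_snd)
    from measurable_compose[OF this measurable_process]
    have "(\<lambda>z. fst z + J (max 0 (a * waiting_iter (\<lambda>t. J (a * t) (snd z)) (fst z) n)) (snd z)) \<in> borel_measurable ?N"
      by (intro borel_measurable_add fst) simp
    then show ?case
    proof (rule measurable_cong[THEN iffD1, rotated])
      fix z assume "z \<in> space ?N"
      then have z: "0 \<le> fst z" "snd z \<in> space M" by (auto simp: space_pair_measure space_restrict_space)
      interpret i: input_function "\<lambda>t. J (a * t) (snd z)" by (rule input_function_J[OF z(2) a])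
      show "fst z + J (max 0 (a * waiting_iter (\<lambda>t. J (a * t) (snd z)) (fst z) n)) (snd z) = waiting_iter (\<lambda>t. J (a * t) (snd z)) (fst z) (Suc n)"
        using i.waiting_iter_nonneg[OF z(1), of n] a by simp
    qed
  qed (simp add: fst)
  then have "(\<lambda>z. lim (\<lambda>n. waiting_iter (\<lambda>t. J (a * t) (snd z)) (fst z) n)) \<in> borel_measurable ?N"
    by (rule borel_measurable_lim_metric)
  then show ?thesis by (simp add: waiting_time_def split_beta')
qed

text \<open>By the law of large numbers t - J(a t) grows like (1 - a \<rho>) t, so on a single event
  it passes every level v.\<close>

lemma AE_ex_passage:
  assumes a: "0 < a" "a * \<rho> < 1"
  shows "AE \<omega> in M. \<forall>v. \<exists>t\<ge>0. v + J (a * t) \<omega> \<le> t"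
  using AE_J_div_tendsto
proof eventually_elim
  case (elim \<omega>)
  show ?case
  proof
    fix v
    define d where "d = 1 - a * \<rho>"
    have d: "0 < d" using a by (simp add: d_def)
    have "\<rho> < (1 - d / 2) / a" using a d by (simp add: d_def field_simps)
    then have "\<forall>\<^sub>F t in at_top. J t \<omega> / t < (1 - d / 2) / a" using elim by (intro order_tendstoD(2))
    then obtain T where T: "\<And>t. T \<le> t \<Longrightarrow> J t \<omega> / t < (1 - d / 2) / a" by (auto simp: eventually_at_top_linorder)
    \<comment> \<open>\<open>T / a\<close> brings a t into the range of the law of large numbers,
      and \<open>2 * v / d\<close> lets the remaining slack d t / 2 cover v.\<close>
    define t where "t = Max {1, T / a, 2 * v / d}"
    have t: "1 \<le> t" "T / a \<le> t" "2 * v / d \<le> t" by (auto simp: t_def)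
    have "J (a * t) \<omega> / (a * t) < (1 - d / 2) / a" using t(2) a by (intro T) (simp add: divide_le_eq mult.commute)
    then have "J (a * t) \<omega> < (1 - d / 2) * t" using a t(1) by (simp add: field_simps)
    moreover have "v \<le> d / 2 * t" using t(3) d by (simp add: field_simps)
    ultimately have "v + J (a * t) \<omega> \<le> t" by (simp add: algebra_simps)
    then show "\<exists>t\<ge>0. v + J (a * t) \<omega> \<le> t" using t(1) by (intro exI[of _ t]) auto
  qed
qed

text \<open>\<open>j\<close> is the first passage over v on the grid. The walk rises by at most h
  per step, so at passage it lies between v and v + h; this encloses the stopped Wald martingale
  \<open>z\<close>.\<close>

abbreviation grid_passage_bound :: "real \<Rightarrow> real \<Rightarrow> real \<Rightarrow> real \<Rightarrow> real \<Rightarrow> 'a \<Rightarrow> real \<Rightarrow> bool" where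
  "grid_passage_bound a h v \<alpha> \<beta> \<omega> z \<equiv> \<exists>j. v + J (a * (real j * h)) \<omega> \<le> real j * h \<and>
      (\<forall>i. v + J (a * (real i * h)) \<omega> \<le> real i * h \<longrightarrow> j \<le> i) \<and>
      exp (\<beta> * v) * exp (- \<alpha> * (real j * h)) \<le> z \<and> z \<le> exp (\<beta> * (v + h)) * exp (- \<alpha> * (real j * h))"

text \<open>The relation between \<alpha> and \<beta> makes exp(\<beta> walk - \<alpha> time) a
  martingale. Stopped at the first passage it never exceeds exp(\<beta> (v + h)), so dominated
  convergence carries the mean 1 to the limit.\<close>

lemma laplace_grid_passage:
  assumes a: "0 < a" "a * \<rho> < 1" and \<beta>: "0 \<le> \<beta>" and \<alpha>: "\<alpha> = \<beta> - a * \<eta> \<beta>" "0 \<le> \<alpha>" and v: "0 \<le> v" and h: "0 < h"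
  obtains Z where "Z \<in> borel_measurable M" "expectation Z = 1" "integrable M Z"
    "AE \<omega> in M. grid_passage_bound a h v \<alpha> \<beta> \<omega> (Z \<omega>)"
proof -
  define k where "k = a * h"
  have k: "0 \<le> k" using a h by (simp add: k_def)
  define x where "x i \<omega> = J (a * (real i * h)) \<omega>" for i \<omega>
  have xsum: "x i \<omega> = (\<Sum>l<i. increment k l \<omega>)" if "\<omega> \<in> space M" for i \<omega>
    using sum_increment[OF that, of k i] by (simp add: x_def k_def mult_ac)
  \<comment> \<open>The relative increment of \<open>Z\<close> over one step; \<open>max 0\<close>
    makes it bounded for arbitrary arguments.\<close>
  define H where "H y = exp (\<beta> * h - \<beta> * max 0 y - \<alpha> * h) - 1" for y :: real
  \<comment> \<open>The value of \<open>Z n\<close> as a function of the past, switched off once the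
    level has been passed. The sum in \<open>N\<close> therefore telescopes to the stopped
    \<open>Z\<close>.\<close>
  define F where "F n u = (if \<forall>i\<le>n. real i * h < v + (\<Sum>l<i. u l) then exp (\<beta> * (real n * h - (\<Sum>l<n. u l)) - \<alpha> * (real n * h)) else 0)"
    for n and u :: "nat \<Rightarrow> real"
  define P where "P n \<omega> = (\<lambda>l\<in>{..<n}. increment k l \<omega>)" for n \<omega>
  define Z where "Z n \<omega> = exp (\<beta> * (real n * h - x n \<omega>) - \<alpha> * (real n * h))" for n \<omega>
  define N where "N n \<omega> = 1 + (\<Sum>i<n. F i (P i \<omega>) * H (increment k i \<omega>))" for n \<omega>
  have Fm: "F n \<in> borel_measurable (Pi\<^sub>M {..<n} (\<lambda>_. borel))" for n
  proof -
    have s: "(\<lambda>u. \<Sum>l<i. u l) \<in> borel_measurable (Pi\<^sub>M {..<n} (\<lambda>_. borel :: real measure))" if "i \<le> n" for i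
      using that by (intro borel_measurable_sum measurable_component_singleton) auto
    have "Measurable.pred (Pi\<^sub>M {..<n} (\<lambda>_. borel)) (\<lambda>u::nat\<Rightarrow>real. \<forall>i\<in>{..n}. real i * h < v + (\<Sum>l<i. u l))"
      by (intro pred_intros_finite) (auto intro!: borel_measurable_pred_less borel_measurable_add s)
    then have p: "Measurable.pred (Pi\<^sub>M {..<n} (\<lambda>_. borel)) (\<lambda>u::nat\<Rightarrow>real. \<forall>i\<le>n. real i * h < v + (\<Sum>l<i. u l))"
      by (simp add: Ball_def)
    show ?thesis
      unfolding F_def
      by (intro measurable_If p[unfolded pred_def] measurable_compose[OF _ borel_measurable_exp] borel_measurable_diff borel_measurable_times
          borel_measurable_const s order_refl)
  qed
  have FB: "\<bar>F n u\<bar> \<le> exp (\<beta> * v)" for n u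
  proof (cases "\<forall>i\<le>n. real i * h < v + (\<Sum>l<i. u l)")
    case True
    then have "real n * h - (\<Sum>l<n. u l) \<le> v" by (auto dest: spec[of _ n])
    then have "\<beta> * (real n * h - (\<Sum>l<n. u l)) \<le> \<beta> * v" using \<beta> by (intro mult_left_mono)
    moreover have "0 \<le> \<alpha> * (real n * h)" using \<alpha>(2) h by simp
    ultimately have "exp (\<beta> * (real n * h - (\<Sum>l<n. u l)) - \<alpha> * (real n * h)) \<le> exp (\<beta> * v)" by simp
    then show ?thesis using True by (simp add: F_def)
  next
    case False
    then show ?thesis unfolding F_def by (subst if_not_P) auto
  qed
  have Hm: "H \<in> borel_measurable borel" unfolding H_def by measurable
  have HB: "\<bar>H y\<bar> \<le> exp (\<beta> * h) + 1" for y
  proof -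
    have "0 \<le> \<beta> * max 0 y" "0 \<le> \<alpha> * h" using \<beta> \<alpha>(2) h by simp_all
    then have "exp (\<beta> * h - \<beta> * max 0 y - \<alpha> * h) \<le> exp (\<beta> * h)" by simp
    then show ?thesis
      using exp_gt_zero[of "\<beta> * h - \<beta> * max 0 y - \<alpha> * h"] unfolding H_def by linarith
  qed
  have HX: "H (increment k i \<omega>) = exp (\<beta> * h - \<alpha> * h) * exp (- \<beta> * increment k i \<omega>) - 1" if "\<omega> \<in> space M" for i \<omega>
    using increment_nonneg[OF k that, of i] by (simp add: H_def exp_add[symmetric] algebra_simps)
  have inc[measurable]: "increment k i \<in> borel_measurable M" for i by (rule measurable_increment[OF k])
  have EH: "expectation (\<lambda>\<omega>. H (increment k i \<omega>)) = 0" for i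
  proof -
    have "integrable M (\<lambda>\<omega>. exp (- \<beta> * increment k i \<omega>))"
      using increment_nonneg[OF k] \<beta> by (intro integrable_const_bound[of _ 1]) auto
    then have "expectation (\<lambda>\<omega>. H (increment k i \<omega>)) = exp (\<beta> * h - \<alpha> * h) * exp (- k * \<eta> \<beta>) - 1"
      using expectation_exp_increment[OF \<beta> k, of i] by (simp add: HX prob_space cong: Bochner_Integration.integral_cong)
    also have "\<dots> = 0" by (simp add: exp_add[symmetric] \<alpha>(1) k_def algebra_simps)
    finally show ?thesis .
  qed
  have FPm[measurable]: "(\<lambda>\<omega>. F i (P i \<omega>)) \<in> borel_measurable M" for i
    unfolding P_def by (intro measurable_compose[OF _ Fm] measurable_restrict inc)
  have HXm[measurable]: "(\<lambda>\<omega>. H (increment k i \<omega>)) \<in> borel_measurable M" for i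
    by (intro measurable_compose[OF inc Hm])
  have Nm[measurable]: "N n \<in> borel_measurable M" for n
    unfolding N_def by (intro borel_measurable_add borel_measurable_sum borel_measurable_times FPm HXm borel_measurable_const)
  have EN: "expectation (N n) = 1" for n
  proof -
    have "expectation (\<lambda>\<omega>. F i (P i \<omega>) * H (increment k i \<omega>)) = 0" for i
      using expectation_past_mult_next[OF indep_increments[OF k, of "Suc i"] lessI Fm FB Hm HB] EH[of i]
      by (simp add: P_def)
    moreover have "integrable M (\<lambda>\<omega>. F i (P i \<omega>) * H (increment k i \<omega>))" for i
      by (intro integrable_const_bound[of _ "exp (\<beta> * v) * (exp (\<beta> * h) + 1)"])
         (auto simp: abs_mult intro!: mult_mono FB HB)
    ultimately show ?thesis unfolding N_def by (simp add: prob_space)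
  qed
  have FZ: "F i (P i \<omega>) = (if \<forall>l\<le>i. real l * h < v + x l \<omega> then Z i \<omega> else 0)" if \<omega>: "\<omega> \<in> space M" for i \<omega>
  proof -
    have "(\<Sum>r<l. P i \<omega> r) = x l \<omega>" if "l \<le> i" for l
      unfolding xsum[OF \<omega>] using that by (intro sum.cong refl) (auto simp: P_def)
    then show ?thesis by (simp add: F_def Z_def)
  qed
  have Zstep: "Z i \<omega> * H (increment k i \<omega>) = Z (Suc i) \<omega> - Z i \<omega>" if \<omega>: "\<omega> \<in> space M" for i \<omega>
  proof -
    have "x (Suc i) \<omega> = x i \<omega> + increment k i \<omega>" using xsum[OF \<omega>] by simp
    then show ?thesis
      using increment_nonneg[OF k \<omega>, of i]
      by (simp add: Z_def H_def right_diff_distrib exp_add[symmetric]) (simp add: algebra_simps)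
  qed
  have good: "\<exists>j. v + x j \<omega> \<le> real j * h \<and> (\<forall>i. v + x i \<omega> \<le> real i * h \<longrightarrow> j \<le> i) \<and>
      (\<forall>n. N n \<omega> = Z (min n j) \<omega>) \<and> (\<forall>i\<le>j. Z i \<omega> \<le> exp (\<beta> * (v + h)) * exp (- \<alpha> * (real i * h))) \<and>
      exp (\<beta> * v) * exp (- \<alpha> * (real j * h)) \<le> Z j \<omega>"
    if \<omega>: "\<omega> \<in> space M" and ex: "\<forall>v. \<exists>t\<ge>0. v + J (a * t) \<omega> \<le> t" for \<omega>
  proof -
    interpret i: input_function "\<lambda>t. J (a * t) \<omega>" using \<omega> a by (intro input_function_J) auto
    obtain t where "0 \<le> t" "v + h + J (a * t) \<omega> \<le> t" using ex by blast
    from i.grid_point_below_waiting_time[OF v h this] have "\<exists>j. v + x j \<omega> \<le> real j * h" by (auto simp: x_def)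
    define j where "j = (LEAST j. v + x j \<omega> \<le> real j * h)"
    have j: "v + x j \<omega> \<le> real j * h" unfolding j_def by (rule LeastI_ex) fact
    have jl: "j \<le> i" if "v + x i \<omega> \<le> real i * h" for i unfolding j_def using that by (rule Least_le)
    have below: "real i * h < v + x i \<omega>" if "i < j" for i using jl[of i] that by force
    have xm: "x i \<omega> \<le> x (Suc i) \<omega>" for i
      using i.K_mono[of "real i * h" "real (Suc i) * h"] h by (simp add: x_def mult_right_mono)
    have x0: "0 \<le> x i \<omega>" for i using i.K_nonneg[of "real i * h"] h by (simp add: x_def)
    \<comment> \<open>Before the passage the walk is below v, and one step adds at most h; the walk
      starts at 0, below v + h.\<close>
    have le: "real i * h - x i \<omega> \<le> v + h" if "i \<le> j" for i
    proof (cases i)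
      case 0
      then show ?thesis using v h x0[of 0] by simp
    next
      case (Suc l)
      then show ?thesis using below[of l] xm[of l] that by (simp add: algebra_simps)
    qed
    have NZ: "N n \<omega> = Z (min n j) \<omega>" for n
    proof (induction n)
      case 0
      show ?case using xsum[OF \<omega>, of 0] by (simp add: N_def Z_def)
    next
      case (Suc n)
      have "N (Suc n) \<omega> = N n \<omega> + F n (P n \<omega>) * H (increment k n \<omega>)" by (simp add: N_def)
      also have "\<dots> = Z (min (Suc n) j) \<omega>"
      proof (cases "n < j")
        case True
        then have "\<forall>l\<le>n. real l * h < v + x l \<omega>" using below by auto
        then show ?thesis using Suc True by (simp add: FZ[OF \<omega>] Zstep[OF \<omega>] min_def)
      next
        case False
        then have "\<not> (\<forall>l\<le>n. real l * h < v + x l \<omega>)" using j by (auto simp: not_less intro!: exI[of _ j])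
        then have "F n (P n \<omega>) = 0" by (simp only: FZ[OF \<omega>] if_False)
        moreover have "min n j = j" "min (Suc n) j = j" using False by auto
        ultimately show ?thesis using Suc by simp
      qed
      finally show ?case .
    qed
    have "Z i \<omega> \<le> exp (\<beta> * (v + h)) * exp (- \<alpha> * (real i * h))" if "i \<le> j" for i
      using mult_left_mono[OF le[OF that] \<beta>] by (simp add: Z_def exp_add[symmetric])
    moreover have "exp (\<beta> * v) * exp (- \<alpha> * (real j * h)) \<le> Z j \<omega>"
      using mult_left_mono[of v "real j * h - x j \<omega>" \<beta>] \<beta> j by (simp add: Z_def exp_add[symmetric])
    ultimately show ?thesis using j jl NZ by blast
  qed
  let ?L = "\<lambda>\<omega>. lim (\<lambda>n. N n \<omega>)"
  let ?good = "\<lambda>\<omega>. \<exists>j. v + x j \<omega> \<le> real j * h \<and> (\<forall>i. v + x i \<omega> \<le> real i * h \<longrightarrow> j \<le> i) \<and>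
      (\<lambda>n. N n \<omega>) \<longlonglongrightarrow> ?L \<omega> \<and> (\<forall>n. \<bar>N n \<omega>\<bar> \<le> exp (\<beta> * (v + h))) \<and>
      exp (\<beta> * v) * exp (- \<alpha> * (real j * h)) \<le> ?L \<omega> \<and> ?L \<omega> \<le> exp (\<beta> * (v + h)) * exp (- \<alpha> * (real j * h))"
  have good': "AE \<omega> in M. ?good \<omega>"
    using AE_ex_passage[OF a]
  proof (rule AE_mp, intro AE_I2 impI)
    fix \<omega> assume \<omega>: "\<omega> \<in> space M" and "\<forall>v. \<exists>t\<ge>0. v + J (a * t) \<omega> \<le> t"
    from good[OF this] obtain j where j: "v + x j \<omega> \<le> real j * h" "\<forall>i. v + x i \<omega> \<le> real i * h \<longrightarrow> j \<le> i"
      and NZ: "\<And>n. N n \<omega> = Z (min n j) \<omega>"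
      and Z: "\<And>i. i \<le> j \<Longrightarrow> Z i \<omega> \<le> exp (\<beta> * (v + h)) * exp (- \<alpha> * (real i * h))"
      and Zj: "exp (\<beta> * v) * exp (- \<alpha> * (real j * h)) \<le> Z j \<omega>" by blast
    have "\<forall>\<^sub>F n in sequentially. N n \<omega> = Z j \<omega>"
      using eventually_ge_at_top[of j] by eventually_elim (simp add: NZ min_def)
    then have lim: "(\<lambda>n. N n \<omega>) \<longlonglongrightarrow> Z j \<omega>" by (rule tendsto_eventually)
    then have L: "?L \<omega> = Z j \<omega>" by (rule limI)
    have "\<bar>N n \<omega>\<bar> \<le> exp (\<beta> * (v + h))" for n
    proof -
      let ?i = "min n j"
      have "Z ?i \<omega> \<le> exp (\<beta> * (v + h)) * exp (- \<alpha> * (real ?i * h))" by (rule Z) simp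
      also have "\<dots> \<le> exp (\<beta> * (v + h)) * 1" using \<alpha>(2) h by (intro mult_left_mono) auto
      finally show ?thesis unfolding NZ by (simp add: Z_def)
    qed
    with j Zj Z[of j] lim show "?good \<omega>"
      unfolding L by blast
  qed
  have Lm: "?L \<in> borel_measurable M" by (rule borel_measurable_lim_metric[OF Nm])
  have "(\<lambda>n. expectation (N n)) \<longlonglongrightarrow> expectation ?L" and "integrable M ?L"
  proof -
    have lim: "AE \<omega> in M. (\<lambda>n. N n \<omega>) \<longlonglongrightarrow> ?L \<omega>" using good' by eventually_elim blast
    have bd: "AE \<omega> in M. norm (N n \<omega>) \<le> exp (\<beta> * (v + h))" for n using good' by eventually_elim auto
    show "(\<lambda>n. expectation (N n)) \<longlonglongrightarrow> expectation ?L"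
      by (rule integral_dominated_convergence[OF Lm Nm _ lim bd]) simp
    show "integrable M ?L"
      by (rule integrable_dominated_convergence[OF Lm Nm _ lim bd]) simp
  qed
  then have "expectation ?L = 1" by (simp add: EN LIMSEQ_const_iff)
  moreover have "AE \<omega> in M. grid_passage_bound a h v \<alpha> \<beta> \<omega> (?L \<omega>)"
    using good' unfolding x_def by eventually_elim blast
  ultimately show thesis using that[of ?L] Lm \<open>integrable M ?L\<close> by blast
qed

lemma AE_waiting_time_nonneg:
  assumes a: "0 < a" "a * \<rho> < 1" and v: "0 \<le> v"
  shows "AE \<omega> in M. 0 \<le> waiting_time (\<lambda>t. J (a * t) \<omega>) v"
  using AE_ex_passage[OF a]
proof (rule AE_mp, intro AE_I2 impI)
  fix \<omega> assume \<omega>: "\<omega> \<in> space M" and "\<forall>v. \<exists>t\<ge>0. v + J (a * t) \<omega> \<le> t"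
  then obtain t where t: "0 \<le> t" "v + J (a * t) \<omega> \<le> t" by blast
  interpret i: input_function "\<lambda>t. J (a * t) \<omega>" using \<omega> a by (intro input_function_J) auto
  from i.waiting_time_ge[OF v t] v show "0 \<le> waiting_time (\<lambda>t. J (a * t) \<omega>) v" by simp
qed

text \<open>The first passage j h on the grid lies between the waiting times for v and v + h. With
  the stopped martingale of mean 1 this bounds the transform at v from below and the one at v + h
  from above, and the mesh tends to 0.\<close>

lemma laplace_waiting_time:
  assumes a: "0 < a" "a * \<rho> < 1" and \<beta>: "0 \<le> \<beta>" and \<alpha>: "\<alpha> = \<beta> - a * \<eta> \<beta>" "0 \<le> \<alpha>" and v: "0 \<le> v"
  shows "expectation (\<lambda>\<omega>. exp (- \<alpha> * waiting_time (\<lambda>t. J (a * t) \<omega>) v)) = exp (- \<beta> * v)"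
proof -
  let ?T = "\<lambda>v \<omega>. waiting_time (\<lambda>t. J (a * t) \<omega>) v"
  have Tm: "?T v \<in> borel_measurable M" if "0 \<le> v" for v
    using measurable_compose[OF measurable_Pair1'[of v "restrict_space borel {0..}" M] measurable_waiting_time[of a]] a that
    by (simp add: space_restrict_space)
  note AE_pos = AE_waiting_time_nonneg[OF a]
  have iT: "integrable M (\<lambda>\<omega>. exp (- \<alpha> * ?T v \<omega>))" if "0 \<le> v" for v
  proof (rule integrable_const_bound[of _ 1])
    show "AE \<omega> in M. norm (exp (- \<alpha> * ?T v \<omega>)) \<le> 1"
      using AE_pos[OF that] by eventually_elim (use \<alpha>(2) in simp)
    show "(\<lambda>\<omega>. exp (- \<alpha> * ?T v \<omega>)) \<in> borel_measurable M" using Tm[OF that] by simp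
  qed
  have step: "exp (- \<beta> * (v + h)) \<le> expectation (\<lambda>\<omega>. exp (- \<alpha> * ?T v \<omega>)) \<and>
      expectation (\<lambda>\<omega>. exp (- \<alpha> * ?T (v + h) \<omega>)) \<le> exp (- \<beta> * v)" if v: "0 \<le> v" and h: "0 < h" for v h
  proof -
    obtain Z where Z: "Z \<in> borel_measurable M" "expectation Z = 1" "integrable M Z"
      "AE \<omega> in M. grid_passage_bound a h v \<alpha> \<beta> \<omega> (Z \<omega>)"
      by (rule laplace_grid_passage[OF a \<beta> \<alpha> v h])
    have AE: "AE \<omega> in M. exp (- \<beta> * (v + h)) * Z \<omega> \<le> exp (- \<alpha> * ?T v \<omega>) \<and> exp (- \<alpha> * ?T (v + h) \<omega>) \<le> exp (- \<beta> * v) * Z \<omega>"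
      using Z(4) AE_ex_passage[OF a] AE_space
    proof eventually_elim
      case (elim \<omega>)
      then obtain j where j: "v + J (a * (real j * h)) \<omega> \<le> real j * h"
        "\<And>i. v + J (a * (real i * h)) \<omega> \<le> real i * h \<Longrightarrow> j \<le> i"
        "exp (\<beta> * v) * exp (- \<alpha> * (real j * h)) \<le> Z \<omega>" "Z \<omega> \<le> exp (\<beta> * (v + h)) * exp (- \<alpha> * (real j * h))" by blast
      from elim obtain t where t: "0 \<le> t" "v + h + J (a * t) \<omega> \<le> t" by blast
      interpret i: input_function "\<lambda>t. J (a * t) \<omega>" using elim a by (intro input_function_J) auto
      have 1: "?T v \<omega> \<le> real j * h" by (rule i.waiting_time_le[OF v _ j(1)]) (use h in simp)
      obtain l where l: "v + J (a * (real l * h)) \<omega> \<le> real l * h" "real l * h \<le> ?T (v + h) \<omega>"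
        using i.grid_point_below_waiting_time[OF v h t] by blast
      have 2: "real j * h \<le> ?T (v + h) \<omega>"
      proof -
        have "real j * h \<le> real l * h" using j(2)[OF l(1)] h by (intro mult_right_mono) auto
        with l(2) show ?thesis by linarith
      qed
      have "exp (- \<beta> * (v + h)) * Z \<omega> \<le> exp (- \<beta> * (v + h)) * (exp (\<beta> * (v + h)) * exp (- \<alpha> * (real j * h)))"
        by (intro mult_left_mono j(4)) simp
      also have "\<dots> = exp (- \<alpha> * (real j * h))" by (simp add: exp_minus)
      also have "\<dots> \<le> exp (- \<alpha> * ?T v \<omega>)" using mult_left_mono[OF 1 \<alpha>(2)] by simp
      finally have lo: "exp (- \<beta> * (v + h)) * Z \<omega> \<le> exp (- \<alpha> * ?T v \<omega>)" .
      have "exp (- \<alpha> * ?T (v + h) \<omega>) \<le> exp (- \<alpha> * (real j * h))" using mult_left_mono[OF 2 \<alpha>(2)] by simp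
      also have "\<dots> = exp (- \<beta> * v) * (exp (\<beta> * v) * exp (- \<alpha> * (real j * h)))" by (simp add: exp_minus)
      also have "\<dots> \<le> exp (- \<beta> * v) * Z \<omega>" by (intro mult_left_mono j(3)) simp
      finally show ?case using lo by blast
    qed
    have "exp (- \<beta> * (v + h)) * expectation Z \<le> expectation (\<lambda>\<omega>. exp (- \<alpha> * ?T v \<omega>))"
      unfolding integral_mult_right_zero[symmetric] using AE v Z(3)
      by (intro integral_mono_AE iT integrable_mult_right) auto
    moreover have "expectation (\<lambda>\<omega>. exp (- \<alpha> * ?T (v + h) \<omega>)) \<le> exp (- \<beta> * v) * expectation Z"
      unfolding integral_mult_right_zero[symmetric] using AE v h Z(3)
      by (intro integral_mono_AE iT integrable_mult_right) auto
    ultimately show ?thesis using Z(2) by simp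
  qed
  have h0: "(\<lambda>n. 1 / real (Suc n)) \<longlonglongrightarrow> 0" by (rule LIMSEQ_Suc[OF lim_1_over_n])
  show ?thesis
  proof (rule antisym)
    show "exp (- \<beta> * v) \<le> expectation (\<lambda>\<omega>. exp (- \<alpha> * ?T v \<omega>))"
    proof (rule LIMSEQ_le_const2)
      show "(\<lambda>n. exp (- \<beta> * (v + 1 / real (Suc n)))) \<longlonglongrightarrow> exp (- \<beta> * v)"
        using tendsto_exp[OF tendsto_mult[OF tendsto_const tendsto_add[OF tendsto_const h0]], of "- \<beta>" v] by simp
    qed (use step[OF v] in auto)
    \<comment> \<open>The upper bound is applied with v - h in place of v, which needs h < v. For v
      = 0 the trivial bound 1 is the claim.\<close>
    show "expectation (\<lambda>\<omega>. exp (- \<alpha> * ?T v \<omega>)) \<le> exp (- \<beta> * v)"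
    proof (cases "v = 0")
      case True
      have "expectation (\<lambda>\<omega>. exp (- \<alpha> * ?T v \<omega>)) \<le> 1"
        using AE_pos[OF v] by (intro integral_le_const iT v) (auto elim!: eventually_mono simp: \<alpha>(2))
      then show ?thesis using True by simp
    next
      case False
      show ?thesis
      proof (rule LIMSEQ_le_const)
        show "(\<lambda>n. exp (- \<beta> * (v - 1 / real (Suc n)))) \<longlonglongrightarrow> exp (- \<beta> * v)"
          using tendsto_exp[OF tendsto_mult[OF tendsto_const tendsto_diff[OF tendsto_const h0]], of "- \<beta>" v] by simp
        have "0 < v" using False v by simp
        then obtain N where N: "1 / real (Suc N) < v" using nat_approx_posE by blast
        show "\<exists>N. \<forall>n\<ge>N. expectation (\<lambda>\<omega>. exp (- \<alpha> * ?T v \<omega>)) \<le> exp (- \<beta> * (v - 1 / real (Suc n)))"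
        proof (intro exI allI impI)
          fix n assume "N \<le> n"
          then have "1 / real (Suc n) \<le> 1 / real (Suc N)" by (simp add: frac_le)
          with N step[of "v - 1 / real (Suc n)" "1 / real (Suc n)"]
          show "expectation (\<lambda>\<omega>. exp (- \<alpha> * ?T v \<omega>)) \<le> exp (- \<beta> * (v - 1 / real (Suc n)))" by simp
        qed
      qed
    qed
  qed
qed

end

section \<open>The steady state\<close>

text \<open>The jump-free mass increases in t, so its values at rational times fix it everywhere.
  This reduces the exceptional events to countably many.\<close>

lemma (in stieltjes) continuous_part_linear:
  assumes c: "0 \<le> c" and q: "\<And>q. q \<in> \<rat> \<Longrightarrow> 0 < q \<Longrightarrow> (LINT s:{0<..q}|\<mu>. indicator no_jump s) = c * q"
    and t: "0 < t"
  shows "(LINT s:{0<..t}|\<mu>. indicator no_jump s) = c * t"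
proof -
  define C where "C t = (LINT s:{0<..t}|\<mu>. indicat_real no_jump s)" for t
  have mono: "C r \<le> C s" if "r \<le> s" for r s
    unfolding C_def set_lebesgue_integral_def real_scaleR_def
    using that by (intro integral_mono integrable_bounded_Ioc[where B = 1]) (auto simp: indicator_def)
  have C: "C q = c * q" if "q \<in> \<rat>" "0 < q" for q using q[OF that] by (simp add: C_def)
  have "\<bar>C t - c * t\<bar> \<le> c * e" if e: "0 < e" for e
  proof -
    obtain r where r: "r \<in> \<rat>" "max (t / 2) (t - e) < r" "r < t"
      using Rats_dense_in_real[of "max (t / 2) (t - e)" t] t e by auto
    obtain s where s: "s \<in> \<rat>" "t < s" "s < t + e" using Rats_dense_in_real[of t "t + e"] e by auto
    have "c * (t - e) \<le> c * r" using r c by (intro mult_left_mono) auto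
    moreover have "c * s \<le> c * (t + e)" using s c by (intro mult_left_mono) auto
    moreover have "C r = c * r" "C s = c * s" using r s t by (auto intro!: C)
    moreover have "C r \<le> C t" "C t \<le> C s" using r s by (auto intro!: mono)
    ultimately show ?thesis by (simp add: abs_le_iff algebra_simps)
  qed
  then have "\<bar>C t - c * t\<bar> \<le> 0 + e" if e: "0 < e" for e
  proof -
    \<comment> \<open>The denominator c + 1 also works for drift 0.\<close>
    have "c * (e / (c + 1)) \<le> e" using c e by (simp add: field_simps)
    with \<open>\<And>e. 0 < e \<Longrightarrow> \<bar>C t - c * t\<bar> \<le> c * e\<close>[of "e / (c + 1)"] c e show ?thesis by simp
  qed
  then have "\<bar>C t - c * t\<bar> \<le> 0" by (rule field_le_epsilon)
  then show ?thesis by (simp add: C_def)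
qed

lemma (in integrable_subordinator) exponent_div_tendsto: "((\<lambda>x. \<eta> x / x) \<longlongrightarrow> \<rho>) (at 0 within {0..})"
  using exponent_derivative_0 by (simp add: has_field_derivative_iff exponent_0)

locale two_class_queue = two_inputs M J1 J2 for M :: "'a measure" and J1 J2 +
  fixes c :: real and \<nu> :: "real measure"
  assumes drift: "has_drift_levy_measure M J2 c \<nu>"
    and rho2_pos: "0 < B.\<rho>"
begin

lemma c_nonneg: "0 \<le> c"
  using drift by (simp add: has_drift_levy_measure_def)

text \<open>The product of the workload transform (1 - \<rho>) b / \<phi>(b) and \<eta>2(b) /
  (\<rho>2 b), with b cancelled. The second factor is the transform of the location of a typical
  particle in its batch; a particle of the drift has location 0.\<close>

definition content_lst :: "real \<Rightarrow> real" where
  "content_lst b = (1 - (A.\<rho> + B.\<rho>)) * B.\<eta> b / (B.\<rho> * \<phi> b)"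

text \<open>Excludes content at infinity: after division by the argument, the exponents tend to the
  means.\<close>

lemma content_lst_tendsto_1: "(\<lambda>k. content_lst (1 / real (Suc k))) \<longlonglongrightarrow> 1"
proof -
  have "filterlim (\<lambda>k. 1 / real (Suc k)) (at 0 within {0..}) sequentially"
    using LIMSEQ_Suc[OF lim_1_over_n] by (auto simp: filterlim_at)
  note lim = filterlim_compose[OF _ this]
  let ?x = "\<lambda>k. 1 / real (Suc k)"
  have "(\<lambda>k. 1 - A.\<eta> (?x k) / ?x k - B.\<eta> (?x k) / ?x k) \<longlonglongrightarrow> 1 - A.\<rho> - B.\<rho>"
    by (intro tendsto_diff tendsto_const lim A.exponent_div_tendsto B.exponent_div_tendsto)
  moreover have phi_div: "1 - A.\<eta> x / x - B.\<eta> x / x = \<phi> x / x" if "x \<noteq> 0" for x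
    using that by (simp add: \<phi>_def diff_divide_distrib)
  have "1 - A.\<eta> (?x k) / ?x k - B.\<eta> (?x k) / ?x k = \<phi> (?x k) / ?x k" for k
    by (rule phi_div) simp
  ultimately have p: "(\<lambda>k. \<phi> (?x k) / ?x k) \<longlonglongrightarrow> 1 - A.\<rho> - B.\<rho>" by (simp only:)
  have "(\<lambda>k. (1 - (A.\<rho> + B.\<rho>)) * (B.\<eta> (?x k) / ?x k) / (B.\<rho> * (\<phi> (?x k) / ?x k))) \<longlonglongrightarrow>
      (1 - (A.\<rho> + B.\<rho>)) * B.\<rho> / (B.\<rho> * (1 - A.\<rho> - B.\<rho>))"
    using rho2_pos stable by (intro tendsto_divide tendsto_mult tendsto_const p lim[OF B.exponent_div_tendsto]) auto
  moreover have "(1 - (A.\<rho> + B.\<rho>)) * B.\<rho> / (B.\<rho> * (1 - A.\<rho> - B.\<rho>)) = 1"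
  proof -
    have "x * y / (y * x) = 1" if "x \<noteq> 0" "y \<noteq> 0" for x y :: real using that by simp
    moreover have "1 - A.\<rho> - B.\<rho> = 1 - (A.\<rho> + B.\<rho>)" by simp
    ultimately show ?thesis using rho2_pos stable by simp
  qed
  moreover have "(1 - (A.\<rho> + B.\<rho>)) * (B.\<eta> (?x k) / ?x k) / (B.\<rho> * (\<phi> (?x k) / ?x k)) = content_lst (?x k)" for k
  proof -
    have "r * (n / x) / (p * (f / x)) = r * n / (p * f)" if "x \<noteq> 0" for r n x p f :: real
      using that by simp
    from this[of "?x k"] show ?thesis unfolding content_lst_def by simp
  qed
  ultimately show ?thesis by simp
qed

text \<open>Collects what a sample path must satisfy for \<open>queue_paths\<close>, and the growth
  of J2 that makes \<open>content_law\<close> a probability measure at late times.\<close>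

definition regular :: "'a \<Rightarrow> bool" where
  "regular \<omega> \<longleftrightarrow> \<omega> \<in> space M \<and> ((\<lambda>t. J2 t \<omega> / t) \<longlongrightarrow> B.\<rho>) at_top \<and>
    (\<forall>t>0. (LINT s:{0<..t}|interval_measure (B.path \<omega>). indicator (stieltjes.no_jump (B.path \<omega>)) s) = c * t)"

lemma AE_regular: "AE \<omega> in M. regular \<omega>"
proof -
  have "AE \<omega> in M. (LINT s:{0<..q}|interval_measure (B.path \<omega>). indicator {s. jump (B.path \<omega>) s = 0} s) = c * q"
    if "0 < q" for q
    by (rule B.AE_continuous_part[OF _ tendsto_laplace_exponent_div_drift[OF drift] that, of "B.\<rho>"])
       (simp add: B.exponent_le)
  then have "AE \<omega> in M. \<forall>q\<in>\<rat> \<inter> {0<..}. (LINT s:{0<..q}|interval_measure (B.path \<omega>). indicator {s. jump (B.path \<omega>) s = 0} s) = c * q"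
    by (intro AE_ball_countable[THEN iffD2] countable_Int1 countable_rat ballI) auto
  then show ?thesis
    using B.AE_J_div_tendsto AE_space
  proof eventually_elim
    case (elim \<omega>)
    interpret p: input_path "B.path \<omega>" by (rule B.input_path_path[OF elim(3)])
    have "(LINT s:{0<..t}|p.\<mu>. indicator p.no_jump s) = c * t" if "0 < t" for t
      by (rule p.continuous_part_linear[OF c_nonneg _ that]) (use elim(1) in \<open>auto simp: p.no_jump_def\<close>)
    then show ?case
      unfolding regular_def using elim(2,3) by blast
  qed
qed

lemma queue_paths_if_regular:
  assumes "regular \<omega>"
  shows "queue_paths (total \<omega>) (B.path \<omega>) (\<lambda>t. J1 t \<omega>) (\<lambda>t. J2 t \<omega>) c"
proof -
  have \<omega>: "\<omega> \<in> space M" using assms by (simp add: regular_def)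
  interpret G: input_path "total \<omega>" by (rule input_path_total[OF \<omega>])
  interpret F: input_path "B.path \<omega>" by (rule B.input_path_path[OF \<omega>])
  show ?thesis
    by unfold_locales (use assms c_nonneg in \<open>auto simp: regular_def total_def A.path_eq B.path_eq\<close>)
qed

abbreviation content_law :: "'a \<Rightarrow> real \<Rightarrow> real measure" where
  "content_law \<omega> \<equiv> queue_paths.content_law (total \<omega>) (B.path \<omega>)"

lemma eventually_arrivals:
  assumes "regular \<omega>" shows "\<forall>\<^sub>F t in at_top. 0 < t \<and> 0 < B.path \<omega> t"
proof -
  have "\<forall>\<^sub>F t in at_top. 0 < J2 t \<omega> / t"
    using assms rho2_pos by (intro order_tendstoD(1)) (auto simp: regular_def)
  then show ?thesis
    using eventually_gt_at_top[of 0] by eventually_elim (simp add: B.path_eq zero_less_divide_iff)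
qed

lemma eventually_content_average:
  assumes \<omega>: "regular \<omega>" and f: "continuous_on {0..} f" "bounded (f ` {0..})"
  shows "\<forall>\<^sub>F t in at_top. (LINT x|content_law \<omega> t. f (max 0 x)) = content_average c (\<lambda>t. J1 t \<omega>) (\<lambda>t. J2 t \<omega>) f t"
proof -
  interpret q: queue_paths "total \<omega>" "B.path \<omega>" "\<lambda>t. J1 t \<omega>" "\<lambda>t. J2 t \<omega>" c by (rule queue_paths_if_regular[OF \<omega>])
  show ?thesis
    using eventually_arrivals[OF \<omega>] by eventually_elim (use f in \<open>simp add: q.content_average_eq\<close>)
qed

lemma AE_laplace_content:
  assumes b: "0 < b"
  shows "AE \<omega> in M. ((\<lambda>t. LINT x|content_law \<omega> t. exp (- b * max 0 x)) \<longlongrightarrow> content_lst b) at_top"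
  using AE_class2_average[OF b] AE_regular
proof eventually_elim
  case (elim \<omega>)
  interpret q: queue_paths "total \<omega>" "B.path \<omega>" "\<lambda>t. J1 t \<omega>" "\<lambda>t. J2 t \<omega>" c by (rule queue_paths_if_regular[OF elim(2)])
  let ?N = "class2_transform b \<omega>"
  have J: "((\<lambda>t. J2 t \<omega> / t) \<longlongrightarrow> B.\<rho>) at_top" using elim(2) by (simp add: regular_def)
  have "((\<lambda>t. (?N t / t) / (b * (J2 t \<omega> / t))) \<longlongrightarrow> B.\<eta> b * (b * (1 - (A.\<rho> + B.\<rho>)) / \<phi> b) / (b * B.\<rho>)) at_top"
    using b rho2_pos by (intro tendsto_divide tendsto_mult tendsto_const elim(1) J) auto
  moreover have "B.\<eta> b * (b * (1 - (A.\<rho> + B.\<rho>)) / \<phi> b) / (b * B.\<rho>) = content_lst b"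
    using b phi_pos[OF b] rho2_pos by (simp add: content_lst_def field_simps)
  moreover have "\<forall>\<^sub>F t in at_top. (?N t / t) / (b * (J2 t \<omega> / t)) = (LINT x|content_law \<omega> t. exp (- b * max 0 x))"
    using eventually_arrivals[OF elim(2)]
  proof eventually_elim
    case (elim t)
    then have t: "0 < t" "0 < B.path \<omega> t" by auto
    show ?case unfolding q.laplace_content_law[OF t b] using t by (simp add: B.path_eq)
  qed
  ultimately show ?case by (auto elim: Lim_transform_eventually)
qed

text \<open>exp(-b x) is an admissible test function. On an event of probability one its average has
  both limits, so the two nonrandom values coincide.\<close>

lemma laplace_steady_state_content:
  assumes \<mu>: "steady_state_content_law M J1 J2 c \<mu>" and b: "0 < b"
  shows "(LINT v|\<mu>. exp (- b * v)) = content_lst b"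
proof -
  have cont: "continuous_on {0..} (\<lambda>x. exp (- b * x))" by (intro continuous_intros)
  have bdd: "bounded ((\<lambda>x. exp (- b * x)) ` {0..})"
  proof (rule boundedI[of _ 1])
    fix y assume "y \<in> (\<lambda>x. exp (- b * x)) ` {0..}"
    then obtain x where "0 \<le> x" "y = exp (- b * x)" by auto
    then show "norm y \<le> 1" using b by simp
  qed
  have "AE \<omega> in M. (content_average c (\<lambda>t. J1 t \<omega>) (\<lambda>t. J2 t \<omega>) (\<lambda>x. exp (- b * x)) \<longlongrightarrow> (LINT v|\<mu>. exp (- b * v))) at_top"
    using \<mu> cont bdd by (simp only: steady_state_content_law_def)
  then have "AE \<omega> in M. (LINT v|\<mu>. exp (- b * v)) = content_lst b"
    using AE_laplace_content[OF b] AE_regular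
  proof eventually_elim
    case (elim \<omega>)
    have "(content_average c (\<lambda>t. J1 t \<omega>) (\<lambda>t. J2 t \<omega>) (\<lambda>x. exp (- b * x)) \<longlongrightarrow> content_lst b) at_top"
      by (rule Lim_transform_eventually[OF elim(2) eventually_content_average[OF elim(3) cont bdd]])
    from tendsto_unique[OF trivial_limit_at_top_linorder elim(1) this] show ?case .
  qed
  then show ?thesis by (simp only: AE_const)
qed

text \<open>The limit law is built from one good path. Since the limiting transforms do not depend
  on the path, the same law is the weak limit along every good path, for all test functions.\<close>

lemma ex_steady_state_content_law: "\<exists>\<mu>. steady_state_content_law M J1 J2 c \<mu>"
proof -
  define good where "good \<omega> \<longleftrightarrow> regular \<omega> \<and>
    (\<forall>k. ((\<lambda>t. LINT x|content_law \<omega> t. exp (- real (Suc k) * max 0 x)) \<longlongrightarrow> content_lst (real (Suc k))) at_top) \<and>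
    (\<forall>k. ((\<lambda>t. LINT x|content_law \<omega> t. exp (- (1 / real (Suc k)) * max 0 x)) \<longlongrightarrow> content_lst (1 / real (Suc k))) at_top)" for \<omega>
  have "AE \<omega> in M. good \<omega>"
    unfolding good_def
    by (intro AE_conjI AE_regular AE_all_countable[THEN iffD2] allI AE_laplace_content) auto
  have ex_T: "\<exists>T>0. \<forall>t\<ge>T. real_distribution (content_law \<omega> t)" if "good \<omega>" for \<omega>
  proof -
    have \<omega>: "regular \<omega>" using that by (simp add: good_def)
    interpret q: queue_paths "total \<omega>" "B.path \<omega>" "\<lambda>t. J1 t \<omega>" "\<lambda>t. J2 t \<omega>" c by (rule queue_paths_if_regular[OF \<omega>])
    obtain T where T: "\<And>t. T \<le> t \<Longrightarrow> 0 < t \<and> 0 < B.path \<omega> t"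
      using eventually_arrivals[OF \<omega>] by (auto simp: eventually_at_top_linorder)
    show ?thesis
      using T by (intro exI[of _ "max T 1"]) (auto intro!: q.real_distribution_content_law)
  qed
  have "\<exists>N. real_distribution N \<and> (AE x in N. 0 \<le> x) \<and> (\<forall>k. (LINT x|N. exp (- real (Suc k) * max 0 x)) = content_lst (real (Suc k)))"
  proof -
    have "\<exists>\<omega>. good \<omega>"
    proof (rule ccontr)
      assume "\<not> (\<exists>\<omega>. good \<omega>)"
      with \<open>AE \<omega> in M. good \<omega>\<close> have "AE \<omega> in M. False" by simp
      then show False by (simp add: AE_False)
    qed
    then obtain \<omega> where \<omega>: "good \<omega>" ..
    obtain T where T: "0 < T" "\<And>t. T \<le> t \<Longrightarrow> real_distribution (content_law \<omega> t)" using ex_T[OF \<omega>] by blast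
    \<comment> \<open>Starting at T makes every member of the sequence a probability
      measure.\<close>
    have X: "filterlim (\<lambda>n. T + real n) at_top sequentially"
      by (rule filterlim_tendsto_add_at_top[OF tendsto_const filterlim_real_sequentially])
    show ?thesis
    proof (rule laplace_limit_imp_ex_distribution[where E = "\<lambda>n. content_law \<omega> (T + real n)" and \<psi> = content_lst])
      show "real_distribution (content_law \<omega> (T + real n))" for n by (rule T(2)) simp
      show "(\<lambda>n. LINT x|content_law \<omega> (T + real n). exp (- real (Suc k) * max 0 x)) \<longlonglongrightarrow> content_lst (real (Suc k))" for k
        using \<omega> by (intro filterlim_compose[OF _ X]) (simp add: good_def)
      show "(\<lambda>n. LINT x|content_law \<omega> (T + real n). exp (- (1 / real (Suc k)) * max 0 x)) \<longlonglongrightarrow> content_lst (1 / real (Suc k))" for k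
        using \<omega> by (intro filterlim_compose[OF _ X]) (simp add: good_def)
    qed (rule content_lst_tendsto_1)
  qed
  then obtain N where N: "real_distribution N" "AE x in N. 0 \<le> x"
    and lst: "\<And>k. (LINT x|N. exp (- real (Suc k) * max 0 x)) = content_lst (real (Suc k))" by blast
  interpret N: real_distribution N by (rule N(1))
  have conv: "(content_average c (\<lambda>t. J1 t \<omega>) (\<lambda>t. J2 t \<omega>) f \<longlongrightarrow> (LINT x|N. f (max 0 x))) at_top"
    if \<omega>: "good \<omega>" and f: "continuous_on {0..} f" "bounded (f ` {0..})" for \<omega> f
  proof -
    have reg: "regular \<omega>" using \<omega> by (simp add: good_def)
    obtain T where T: "0 < T" "\<And>t. T \<le> t \<Longrightarrow> real_distribution (content_law \<omega> t)" using ex_T[OF \<omega>] by blast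
    have "((\<lambda>t. LINT x|content_law \<omega> t. f (max 0 x)) \<longlongrightarrow> (LINT x|N. f (max 0 x))) at_top"
    proof (rule tendsto_at_topI_sequentially)
      fix X :: "nat \<Rightarrow> real" assume X: "filterlim X at_top sequentially"
      \<comment> \<open>Early members of an arbitrary sequence are raised to T for the same reason;
        this does not affect the limit.\<close>
      have ev: "\<forall>\<^sub>F n in sequentially. max T (X n) = X n"
        using X[unfolded filterlim_at_top, rule_format, of T] by eventually_elim simp
      have X': "filterlim (\<lambda>n. max T (X n)) at_top sequentially"
        by (rule filterlim_at_top_mono[OF X]) simp
      have "(\<lambda>n. LINT x|content_law \<omega> (max T (X n)). f (max 0 x)) \<longlonglongrightarrow> (LINT x|N. f (max 0 x))"
      proof (rule laplace_limit_imp_weak_limit[OF _ N(1) _ f])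
        show "real_distribution (content_law \<omega> (max T (X n)))" for n by (rule T(2)) simp
        fix k :: nat assume "0 < k"
        then obtain l where "k = Suc l" by (cases k) auto
        moreover have "((\<lambda>t. LINT x|content_law \<omega> t. exp (- real (Suc l) * max 0 x)) \<longlongrightarrow> (LINT x|N. exp (- real (Suc l) * max 0 x))) at_top"
          unfolding lst using \<omega> by (simp add: good_def)
        ultimately show "(\<lambda>n. LINT x|content_law \<omega> (max T (X n)). exp (- real k * max 0 x)) \<longlonglongrightarrow> (LINT x|N. exp (- real k * max 0 x))"
          by (simp only:) (rule filterlim_compose[OF _ X'])
      qed
      then show "(\<lambda>n. LINT x|content_law \<omega> (X n). f (max 0 x)) \<longlonglongrightarrow> (LINT x|N. f (max 0 x))"
        by (rule Lim_transform_eventually) (use ev in \<open>eventually_elim, simp only:\<close>)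
    qed
    then show ?thesis
      by (rule Lim_transform_eventually[OF _ eventually_content_average[OF reg f]])
  qed
  \<comment> \<open>The definition asks for a measure on [0, \<infinity>), whereas N is a law on the
    whole line concentrated there.\<close>
  define \<mu> where "\<mu> = restrict_space N {0..}"
  have int: "(LINT v|\<mu>. f v) = (LINT x|N. f (max 0 x))" if f: "continuous_on {0..} f" for f :: "real \<Rightarrow> real"
  proof -
    have "continuous_on UNIV (\<lambda>x. f (max 0 x))" by (intro continuous_on_compose2[OF f] continuous_intros) auto
    then have [measurable]: "(\<lambda>x. f (max 0 x)) \<in> borel_measurable borel" by (rule borel_measurable_continuous_onI)
    have "(LINT v|\<mu>. f v) = (LINT x|N. indicator {0..} x *\<^sub>R f x)"
      unfolding \<mu>_def by (rule integral_restrict_space) simp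
    also have "(\<lambda>x. indicator {0..} x *\<^sub>R f x) = (\<lambda>x. indicator {0..} x *\<^sub>R f (max 0 x))"
      by (auto simp: fun_eq_iff indicator_def)
    also have "(LINT x|N. indicator {0..} x *\<^sub>R f (max 0 x)) = (LINT x|N. f (max 0 x))"
      using N(2) by (intro integral_cong_AE) (auto elim!: eventually_mono simp: indicator_def)
    finally show ?thesis .
  qed
  have "prob_space \<mu>"
  proof (rule prob_spaceI)
    have "N.prob {0..} = 1" using N(2) by (subst N.prob_eq_1) auto
    then show "emeasure \<mu> (space \<mu>) = 1"
      by (simp add: \<mu>_def space_restrict_space emeasure_restrict_space N.emeasure_eq_measure)
  qed
  moreover have "sets \<mu> = sets (restrict_space borel {0..})"
    unfolding \<mu>_def by (rule sets_restrict_space_cong) simp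
  moreover have "AE \<omega> in M. (content_average c (\<lambda>t. J1 t \<omega>) (\<lambda>t. J2 t \<omega>) f \<longlongrightarrow> (LINT v|\<mu>. f v)) at_top"
    if "continuous_on {0..} f" "bounded (f ` {0..})" for f
    using \<open>AE \<omega> in M. good \<omega>\<close>
    by eventually_elim (simp only: int[OF that(1)] conv[OF _ that])
  ultimately show ?thesis unfolding steady_state_content_law_def by blast
qed

end

section \<open>The net input exponent and its inverse\<close>

context integrable_subordinator
begin

lemma log_laplace_net_input:
  assumes "0 \<le> a" "0 \<le> \<alpha>"
  shows "ln (expectation (\<lambda>\<omega>. exp (- \<alpha> * (J (a * 1) \<omega> - 1)))) = \<alpha> - a * \<eta> \<alpha>"
proof -
  have "expectation (\<lambda>\<omega>. exp (- \<alpha> * (J (a * 1) \<omega> - 1))) = expectation (\<lambda>\<omega>. exp \<alpha> * exp (- \<alpha> * J a \<omega>))"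
    by (intro Bochner_Integration.integral_cong refl) (simp add: exp_add[symmetric] algebra_simps)
  also have "\<dots> = exp \<alpha> * exp (- a * \<eta> \<alpha>)"
    unfolding integral_mult_right_zero laplace_eq[OF assms(2,1)] ..
  also have "\<dots> = exp (\<alpha> - a * \<eta> \<alpha>)" by (simp add: exp_add[symmetric])
  finally show ?thesis by simp
qed

lemma net_exponent_strict_mono:
  assumes "0 \<le> a" "a * \<rho> < 1" "0 \<le> x" "x < y"
  shows "x - a * \<eta> x < y - a * \<eta> y"
proof -
  have "a * (\<eta> y - \<eta> x) \<le> a * (\<rho> * (y - x))" using exponent_diff(2)[of x y] assms by (intro mult_left_mono) auto
  also have "\<dots> < y - x" using mult_strict_right_mono[OF assms(2), of "y - x"] assms(4) by (simp add: mult.assoc)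
  finally show ?thesis by (simp add: algebra_simps)
qed

lemma net_exponent_surj:
  assumes a: "0 \<le> a" "a * \<rho> < 1" and \<alpha>: "0 < \<alpha>"
  obtains \<beta> where "0 < \<beta>" "\<beta> - a * \<eta> \<beta> = \<alpha>"
proof -
  \<comment> \<open>The point where the linear lower bound (1 - a \<rho>) b of the net exponent
    reaches \<alpha>; it brackets the solution for the intermediate value theorem.\<close>
  define b where "b = \<alpha> / (1 - a * \<rho>)"
  have b: "0 < b" using a \<alpha> by (simp add: b_def)
  have "a * \<eta> b \<le> a * (\<rho> * b)" using exponent_le[of b] a b by (intro mult_left_mono) auto
  moreover have "b * (1 - a * \<rho>) = \<alpha>" using a(2) by (simp add: b_def)
  then have "b - a * (\<rho> * b) = \<alpha>" by (simp add: algebra_simps)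
  ultimately have up: "\<alpha> \<le> b - a * \<eta> b" by simp
  have "\<rho>-lipschitz_on {0..} \<eta>"
  proof (rule lipschitz_onI)
    fix x y :: real assume "x \<in> {0..}" "y \<in> {0..}"
    then show "dist (\<eta> x) (\<eta> y) \<le> \<rho> * dist x y"
      using exponent_diff[of x y] exponent_diff[of y x] by (cases "x \<le> y") (auto simp: dist_real_def)
  qed (rule rho_nonneg)
  then have "continuous_on {0..} \<eta>" by (rule lipschitz_on_continuous_on)
  then have "continuous_on {0..b} (\<lambda>x. x - a * \<eta> x)"
    by (intro continuous_intros) (rule continuous_on_subset, auto)
  then obtain \<beta> where \<beta>: "0 \<le> \<beta>" "\<beta> - a * \<eta> \<beta> = \<alpha>"
    using IVT'[of "\<lambda>x. x - a * \<eta> x" 0 \<alpha> b] up b \<alpha> by (auto simp: exponent_0)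
  moreover have "\<beta> \<noteq> 0" using \<beta>(2) \<alpha> by (auto simp: exponent_0)
  ultimately show thesis using that[of \<beta>] by simp
qed

end

context two_class_queue
begin

lemma phi_derivative_0: "vector_derivative \<phi> (at 0 within {0..}) = 1 - (A.\<rho> + B.\<rho>)"
proof (rule vector_derivative_within)
  show "at 0 within {0..} \<noteq> (bot :: real filter)"
    using at_within_Ici_at_right[of "0::real"] trivial_limit_at_right_real[of "0::real"] by (simp add: trivial_limit_def)
  have "(\<phi> has_real_derivative 1 - A.\<rho> - B.\<rho>) (at 0 within {0..})"
    unfolding \<phi>_def[abs_def]
    by (intro DERIV_diff DERIV_ident A.exponent_derivative_0 B.exponent_derivative_0)
  then show "(\<phi> has_vector_derivative 1 - (A.\<rho> + B.\<rho>)) (at 0 within {0..})"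
    by (simp add: has_real_derivative_iff_has_vector_derivative diff_diff_eq)
qed

lemma laplace_steady_state_waiting_time:
  assumes \<mu>: "steady_state_content_law M J1 J2 c \<mu>" and a: "0 < a" "a < 1"
    and \<beta>: "0 < \<beta>" and \<alpha>: "\<beta> - a * A.\<eta> \<beta> = \<alpha>" "0 < \<alpha>"
  shows "(LINT z|(\<mu> \<Otimes>\<^sub>M M). exp (- \<alpha> * steady_state_waiting_time (\<lambda>t. J1 (a * t)) z)) = content_lst \<beta>"
proof -
  have "prob_space \<mu>" and sets[measurable_cong]: "sets \<mu> = sets (restrict_space borel {0..})"
    using \<mu> by (auto simp: steady_state_content_law_def)
  interpret \<mu>: prob_space \<mu> by fact
  interpret P: pair_prob_space \<mu> M ..
  have "A.\<rho> < 1" using stable rho2_pos by simp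
  have "a * A.\<rho> \<le> 1 * A.\<rho>" using a A.rho_nonneg by (intro mult_right_mono) auto
  then have a\<rho>: "a * A.\<rho> < 1" using \<open>A.\<rho> < 1\<close> by simp
  have sp: "0 \<le> v" if "v \<in> space \<mu>" for v
    using that sets_eq_imp_space_eq[OF sets] by (simp add: space_restrict_space)
  let ?T = "steady_state_waiting_time (\<lambda>t. J1 (a * t))"
  have Tm[measurable]: "?T \<in> borel_measurable (\<mu> \<Otimes>\<^sub>M M)"
    using A.measurable_waiting_time[of a] a
    by (subst measurable_cong_sets[OF sets_pair_measure_cong[OF sets refl] refl]) (simp add: steady_state_waiting_time_def)
  have "AE z in (\<mu> \<Otimes>\<^sub>M M). 0 \<le> ?T z"
  proof (rule P.AE_pair_measure)
    show "AE v in \<mu>. AE \<omega> in M. 0 \<le> ?T (v, \<omega>)"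
    proof (rule AE_I2)
      fix v assume "v \<in> space \<mu>"
      from A.AE_waiting_time_nonneg[OF a(1) a\<rho> sp[OF this]]
      show "AE \<omega> in M. 0 \<le> ?T (v, \<omega>)" by (simp add: steady_state_waiting_time_def)
    qed
  qed measurable
  then have "AE z in (\<mu> \<Otimes>\<^sub>M M). norm (exp (- \<alpha> * ?T z)) \<le> 1"
    by eventually_elim (use \<alpha>(2) in simp)
  then have int: "integrable (\<mu> \<Otimes>\<^sub>M M) (\<lambda>z. exp (- \<alpha> * ?T z))"
    by (intro P.integrable_const_bound[of _ 1]) auto
  have "(LINT z|(\<mu> \<Otimes>\<^sub>M M). exp (- \<alpha> * ?T z)) = (LINT v|\<mu>. (LINT \<omega>|M. exp (- \<alpha> * ?T (v, \<omega>))))"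
    by (rule P.integral_fst'[OF int, symmetric])
  also have "\<dots> = (LINT v|\<mu>. exp (- \<beta> * v))"
    using A.laplace_waiting_time[OF a(1) a\<rho>, of \<beta> \<alpha>] \<beta> \<alpha> sp
    by (intro Bochner_Integration.integral_cong refl) (simp add: steady_state_waiting_time_def)
  also have "\<dots> = content_lst \<beta>"
    by (rule laplace_steady_state_content[OF \<mu> \<beta>])
  finally show ?thesis .
qed

end

theorem theorem2:
  fixes M :: "'a measure" and J1 J2 Ja :: "real \<Rightarrow> 'a \<Rightarrow> real"
    and c2 b1 b2 a \<rho>1 \<rho>2 \<rho> :: real and \<nu>2 :: "real measure"
    and \<eta>1 \<eta>2 \<phi> \<phi>a \<phi>a_inv :: "real \<Rightarrow> real"
  assumes "prob_space M"
    and "subordinator M J1" and "subordinator M J2"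
    and "independent_processes M J1 J2"
    and "has_drift_levy_measure M J2 c2 \<nu>2"
    and "integrable M (J1 1)" and "integrable M (J2 1)"
    and "\<rho>1 = (LINT \<omega>|M. J1 1 \<omega>)" and "\<rho>2 = (LINT \<omega>|M. J2 1 \<omega>)" and "\<rho> = \<rho>1 + \<rho>2"
    and "\<rho>2 > 0" and "\<rho> < 1"
    and "\<eta>1 = laplace_exponent M J1" and "\<eta>2 = laplace_exponent M J2"
    and "b1 > b2" and "b2 > 0" and "a = 1 - b2 / b1"
    and "Ja = (\<lambda>t. J1 (a * t))"
    and "\<phi> = (\<lambda>\<alpha>. \<alpha> - \<eta>1 \<alpha> - \<eta>2 \<alpha>)"
    and "\<phi>a = (\<lambda>\<alpha>. ln (LINT \<omega>|M. exp (- \<alpha> * (Ja 1 \<omega> - 1))))"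
    and "\<phi>a_inv = the_inv_into {0..} \<phi>a"
  shows "(\<forall>\<alpha>\<ge>0. \<phi>a \<alpha> = \<alpha> - a * \<eta>1 \<alpha>) \<and>
    (\<exists>\<mu>. steady_state_content_law M J1 J2 c2 \<mu>) \<and>
    (\<forall>\<mu>. steady_state_content_law M J1 J2 c2 \<mu> \<longrightarrow>
      (\<forall>\<alpha>>0.
        (LINT z|(\<mu> \<Otimes>\<^sub>M M). exp (- \<alpha> * steady_state_waiting_time Ja z)) =
          (vector_derivative \<phi> (at 0 within {0..}) * \<phi>a_inv \<alpha> / \<phi> (\<phi>a_inv \<alpha>)) *
          (\<eta>2 (\<phi>a_inv \<alpha>) / (\<rho>2 * \<phi>a_inv \<alpha>)) \<and>
        (vector_derivative \<phi> (at 0 within {0..}) * \<phi>a_inv \<alpha> / \<phi> (\<phi>a_inv \<alpha>)) *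
          (\<eta>2 (\<phi>a_inv \<alpha>) / (\<rho>2 * \<phi>a_inv \<alpha>)) =
          vector_derivative \<phi> (at 0 within {0..}) * \<eta>2 (\<phi>a_inv \<alpha>) /
          (\<rho>2 * \<phi> (\<phi>a_inv \<alpha>))))"
proof -
  interpret A: integrable_subordinator M J1
    by (intro integrable_subordinator.intro subordinator_space.intro subordinator_space_axioms.intro
        integrable_subordinator_axioms.intro assms)
  interpret B: integrable_subordinator M J2
    by (intro integrable_subordinator.intro subordinator_space.intro subordinator_space_axioms.intro
        integrable_subordinator_axioms.intro assms)
  have r: "\<rho>1 = A.\<rho>" "\<rho>2 = B.\<rho>" by (simp_all add: assms A.\<rho>_def B.\<rho>_def)
  interpret two_class_queue M J1 J2 c2 \<nu>2
    by unfold_locales (use assms(4,5,10,11,12) r in simp_all)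
  have "0 < b1" using assms(15,16) by simp
  then have a: "0 < a" "a < 1" using assms(15,16) by (simp_all add: assms(17))
  have "a * A.\<rho> \<le> 1 * A.\<rho>" using a A.rho_nonneg by (intro mult_right_mono) auto
  then have a\<rho>: "a * A.\<rho> < 1" using stable rho2_pos by simp
  have \<eta>: "\<eta>1 = A.\<eta>" "\<eta>2 = B.\<eta>" using assms(13,14) by simp_all
  have \<phi>_eq: "\<phi> = two_inputs.\<phi> M J1 J2"
    by (simp add: assms(19) \<eta> fun_eq_iff two_inputs.\<phi>_def[OF two_inputs_axioms])
  have \<phi>a: "\<phi>a \<alpha> = \<alpha> - a * \<eta>1 \<alpha>" if "0 \<le> \<alpha>" for \<alpha>
    using A.log_laplace_net_input[of a \<alpha>] that a by (simp add: assms(18,20) \<eta>)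
  have inj: "inj_on \<phi>a {0..}"
    using A.net_exponent_strict_mono[of a] a a\<rho> by (intro linorder_inj_onI) (auto simp: \<phi>a \<eta> less_imp_neq)
  have inv: "0 < \<phi>a_inv \<alpha> \<and> \<phi>a_inv \<alpha> - a * A.\<eta> (\<phi>a_inv \<alpha>) = \<alpha>" if "0 < \<alpha>" for \<alpha>
  proof -
    obtain \<beta> where \<beta>: "0 < \<beta>" "\<beta> - a * A.\<eta> \<beta> = \<alpha>"
      by (rule A.net_exponent_surj[OF less_imp_le[OF a(1)] a\<rho> \<open>0 < \<alpha>\<close>])
    then have "\<phi>a \<beta> = \<alpha>" using \<phi>a[of \<beta>] by (simp add: \<eta>)
    \<comment> \<open>\<open>the_inv_into\<close> is meaningful here because \<alpha> is attained on
      [0, \<infinity>), at a single point by injectivity.\<close>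
    then have "\<phi>a_inv \<alpha> = \<beta>"
      unfolding assms(21) using \<beta>(1) by (intro the_inv_into_f_eq[OF inj]) auto
    with \<beta> show ?thesis by simp
  qed
  have main: "(LINT z|(\<mu> \<Otimes>\<^sub>M M). exp (- \<alpha> * steady_state_waiting_time Ja z)) =
      vector_derivative \<phi> (at 0 within {0..}) * \<eta>2 (\<phi>a_inv \<alpha>) / (\<rho>2 * \<phi> (\<phi>a_inv \<alpha>))"
    if "steady_state_content_law M J1 J2 c2 \<mu>" "0 < \<alpha>" for \<mu> \<alpha>
    using laplace_steady_state_waiting_time[OF that(1) a conjunct1[OF inv[OF that(2)]] conjunct2[OF inv[OF that(2)]] that(2)]
    by (simp add: assms(18) content_lst_def \<phi>_eq phi_derivative_0 \<eta> r)
  \<comment> \<open>The inverse is positive for \<alpha> > 0, so it cancels between the two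
    factors.\<close>
  have cancel: "x * \<phi>a_inv \<alpha> / y * (w / (\<rho>2 * \<phi>a_inv \<alpha>)) = x * w / (\<rho>2 * y)" if "0 < \<alpha>" for x y w \<alpha>
    using inv[OF that] by simp
  show ?thesis
    by (intro conjI allI impI ex_steady_state_content_law \<phi>a) (simp_all only: main cancel)
qed

end
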